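(* Let $K$ be a field, $Q$ a connected quiver, and $\beta\le\alpha$ dimension vectors for $Q$. Then rank loci are constructible subvarieties of the bundle of $\beta$-dimensional subrepresentations $\operatorname{rep}(\beta\subset\alpha)$; that is, every rank locus in $\operatorname{rep}(\beta\subset\alpha)$ is a constructible subset.
   Context: $K$ is an arbitrary field. A quiver is a finite directed graph (loops and parallel arrows allowed); all quivers are assumed connected. For an arrow $a$, $ta$ and $ha$ denote its tail and head. A representation $\phi=(V_x,\phi_a)$ of $Q$ assigns a finite-dimensional $K$-vector space $V_x$ to each vertex $x$ and a linear map $\phi_a\colon V_{ta}\to V_{ha}$ to each arrow $a$; with the usual morphisms these form a category $\operatorname{rep}(Q)$. A dimension vector $\alpha$ assigns a nonnegative integer $\alpha(x)$ to each vertex $x$; $\beta\le\alpha$ means $\beta(x)\le\alpha(x)$ for all $x$. The representation space is the affine space $\operatorname{rep}(\alpha)=\operatorname{rep}(Q,\alpha)=\bigoplus_{a}\operatorname{Hom}_K(K^{\alpha(ta)},K^{\alpha(ha)})$. Let $\operatorname{Gr}(\alpha,\beta)=\prod_x \operatorname{Gr}(\alpha(x),\beta(x))$ be the product over vertices of Grassmannians of $\beta(x)$-dimensional subspaces of $K^{\alpha(x)}$; a point is a collection of subspaces $W=(W_x\subseteq K^{\alpha(x)})$. The bundle of $\beta$-dimensional subrepresentations is $$\operatorname{rep}(\beta\subset\alpha)=\{(W,\phi)\in\operatorname{Gr}(\alpha,\beta)\times\operatorname{rep}(\alpha)\mid \phi_a(W_{ta})\subseteq W_{ha}\text{ for all arrows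 }a\},$$ with the Zariski topology. A subset of a variety is constructible if it can be obtained from finitely many subsets, each open or closed, via unions and intersections. Global rank function: a representation $\phi$ has a unique largest subrepresentation $\mathcal{E}(\phi)$ in which the map over every arrow is surjective, and a unique largest quotient representation $\mathcal{M}(\phi)$ in which the map over every arrow is injective. The image of the composition $\mathcal{E}(\phi)\hookrightarrow\phi\twoheadrightarrow\mathcal{M}(\phi)$ has an isomorphism over every arrow, so (as $Q$ is connected) its vector spaces at all vertices have a common dimension; this number is $\operatorname{rank}_Q(\phi)$. Rank functions: a morphism of quivers $f\colon Q'\to Q$ sends vertices to vertices and arrows to arrows compatibly with heads and tails. It induces a pullback $f^*\colon\operatorname{rep}(Q)\to\operatorname{rep}(Q')$, $f^*(W_x,\psi_a)=(W_{f(x)},\psi_{f(a)})$, and a pushforward $f_*\colon\operatorname{rep}(Q')\to\operatorname{rep}(Q)$, $f_*(V_x,\phi_a)=\left(\bigoplus_{y\in f^{-1}(x)}V_y,\ \sum_{b\in f^{-1}(a)}\phi_b\right)$, where each $\phi_b$ is extended by zero to the summands $V_y$ with $y\neq tb$. A rank function on $Q$ is any function $\operatorname{rep}(Q)\to\mathbb{Z}_{\ge 0}$ of the form $\phi\mapsto \operatorname{rank}_{Q_m}(F_{m-1}\cdots F_1\phi)$, where $Q=Q_1,Q_2,\dots,Q_m$ is a finite sequence of quivers and each $F_i\colon\operatorname{rep}(Q_i)\to\operatorname{rep}(Q_{i+1})$ is either the pushforward along a morphism $Q_i\to Q_{i+1}$ or the pullback along a morphism $Q_{i+1}\to Q_i$.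 Rank loci in the bundle: a point $(W,\phi)\in\operatorname{rep}(\beta\subset\alpha)$ gives the subrepresentation $\phi|_W=(W_x,\phi_a|_{W_{ta}})$ of $\phi$ and the quotient representation $\phi/\phi|_W$. Each rank function $r$ on $Q$ induces functions $(W,\phi)\mapsto r(\phi|_W)$ and $(W,\phi)\mapsto r(\phi/\phi|_W)$ on $\operatorname{rep}(\beta\subset\alpha)$. A rank locus in $\operatorname{rep}(\beta\subset\alpha)$ is the set of points satisfying some finite list of linear inequalities in the values of such functions. *)

theory Defs
  imports
    "Graph_Theory.Graph_Theory"
    "Jordan_Normal_Form.VS_Connect"
    "HOL-Algebra.AbelCoset"
    "HOL-Analysis.Abstract_Topology"
    "HOL-Library.Infinite_Typeclass"
begin

section \<open>Quivers\<close>

text \<open>Loops and parallel arrows are allowed in \<^locale>\<open>fin_digraph\<close>. The library's notion of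
  connectedness is that of the underlying undirected graph and includes nonemptiness.\<close>

definition quiver :: "('v, 'e) pre_digraph \<Rightarrow> bool" where
  "quiver Q \<longleftrightarrow> fin_digraph Q \<and> Digraph_Component.connected Q"

definition quiver_hom ::
  "('v, 'e) pre_digraph \<Rightarrow> ('w, 'd) pre_digraph \<Rightarrow> ('v \<Rightarrow> 'w) \<Rightarrow> ('e \<Rightarrow> 'd) \<Rightarrow> bool" where
  "quiver_hom Q R fv fe \<longleftrightarrow>
     (\<forall>x\<in>verts Q. fv x \<in> verts R) \<and>
     (\<forall>a\<in>arcs Q. fe a \<in> arcs R \<and>
        tail R (fe a) = fv (tail Q a) \<and> head R (fe a) = fv (head Q a))"


section \<open>Representations\<close>

text \<open>A representation consists of vector spaces over the field \<open>'k\<close>, given as module records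
  over \<^term>\<open>class_ring :: 'k::field ring\<close>, and of linear maps between their carriers. Only the
  values at the vertices and arrows of the quiver, and the values of the maps on the carriers, are
  meaningful. The operations below are total on the record type; they are applied only to records
  satisfying the predicate \<open>representation\<close>.\<close>

record ('v, 'e, 'k, 'u) rep =
  space :: "'v \<Rightarrow> ('k, 'u) module"
  maps :: "'e \<Rightarrow> 'u \<Rightarrow> 'u"

definition representation ::
  "('v, 'e) pre_digraph \<Rightarrow> ('v, 'e, 'k::field, 'u) rep \<Rightarrow> bool" where
  "representation Q \<phi> \<longleftrightarrow>
     (\<forall>x\<in>verts Q. vectorspace class_ring (space \<phi> x) \<and>
        vectorspace.fin_dim class_ring (space \<phi> x)) \<and>
     (\<forall>a\<in>arcs Q. maps \<phi> a \<in>
        module_hom class_ring (space \<phi> (tail Q a)) (space \<phi> (head Q a)))"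

definition subrepresentation ::
  "('v, 'e) pre_digraph \<Rightarrow> ('v, 'e, 'k::field, 'u) rep \<Rightarrow> ('v \<Rightarrow> 'u set) \<Rightarrow> bool" where
  "subrepresentation Q \<phi> W \<longleftrightarrow>
     W \<in> (\<Pi>\<^sub>E x\<in>verts Q. {U. VectorSpace.subspace class_ring U (space \<phi> x)}) \<and>
     (\<forall>a\<in>arcs Q. maps \<phi> a ` W (tail Q a) \<subseteq> W (head Q a))"

definition sub_rep ::
  "('v, 'e, 'k, 'u) rep \<Rightarrow> ('v \<Rightarrow> 'u set) \<Rightarrow> ('v, 'e, 'k, 'u) rep" where
  "sub_rep \<phi> W = \<lparr>space = (\<lambda>x. (space \<phi> x)\<lparr>carrier := W x\<rparr>), maps = maps \<phi>\<rparr>"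

definition quotient_space :: "('k, 'u) module \<Rightarrow> 'u set \<Rightarrow> ('k, 'u set) module" where
  "quotient_space V N =
     \<lparr>carrier = a_rcosets\<^bsub>V\<^esub> N, mult = undefined, one = undefined,
      zero = N, add = set_add V,
      smult = (\<lambda>c X. \<Union>v\<in>X. N +>\<^bsub>V\<^esub> (c \<odot>\<^bsub>V\<^esub> v))\<rparr>"

definition quotient_rep ::
  "('v, 'e) pre_digraph \<Rightarrow> ('v, 'e, 'k, 'u) rep \<Rightarrow> ('v \<Rightarrow> 'u set) \<Rightarrow> ('v, 'e, 'k, 'u set) rep"
  where
  "quotient_rep Q \<phi> N =
     \<lparr>space = (\<lambda>x. quotient_space (space \<phi> x) (N x)),
      maps = (\<lambda>a X. \<Union>v\<in>X. N (head Q a) +>\<^bsub>space \<phi> (head Q a)\<^esub> maps \<phi> a v)\<rparr>"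

definition all_surjective :: "('v, 'e) pre_digraph \<Rightarrow> ('v, 'e, 'k, 'u) rep \<Rightarrow> bool" where
  "all_surjective Q \<phi> \<longleftrightarrow>
     (\<forall>a\<in>arcs Q. maps \<phi> a ` carrier (space \<phi> (tail Q a)) = carrier (space \<phi> (head Q a)))"

definition all_injective :: "('v, 'e) pre_digraph \<Rightarrow> ('v, 'e, 'k, 'u) rep \<Rightarrow> bool" where
  "all_injective Q \<phi> \<longleftrightarrow> (\<forall>a\<in>arcs Q. inj_on (maps \<phi> a) (carrier (space \<phi> (tail Q a))))"


section \<open>The global rank function\<close>

text \<open>Families of subspaces are compared pointwise by inclusion. The largest quotient with all maps
  injective is the quotient by the least subrepresentation for which the quotient has this property.\<close>

definition largest_surjective_sub ::
  "('v, 'e) pre_digraph \<Rightarrow> ('v, 'e, 'k::field, 'u) rep \<Rightarrow> 'v \<Rightarrow> 'u set" where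
  "largest_surjective_sub Q \<phi> =
     (GREATEST W. subrepresentation Q \<phi> W \<and> all_surjective Q (sub_rep \<phi> W))"

definition injective_quotient_kernel ::
  "('v, 'e) pre_digraph \<Rightarrow> ('v, 'e, 'k::field, 'u) rep \<Rightarrow> 'v \<Rightarrow> 'u set" where
  "injective_quotient_kernel Q \<phi> =
     (LEAST N. subrepresentation Q \<phi> N \<and> all_injective Q (quotient_rep Q \<phi> N))"

definition global_rank ::
  "('v, 'e) pre_digraph \<Rightarrow> ('v, 'e, 'k::field, 'u) rep \<Rightarrow> nat" where
  "global_rank Q \<phi> =
     (let E = largest_surjective_sub Q \<phi>;
          N = injective_quotient_kernel Q \<phi>;
          M = quotient_rep Q \<phi> N
      in THE d. \<forall>x\<in>verts Q. d = vectorspace.dim class_ring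
           ((space M x)\<lparr>carrier := (\<lambda>v. N x +>\<^bsub>space \<phi> x\<^esub> v) ` E x\<rparr>))"


section \<open>Pullback and pushforward\<close>

definition pullback ::
  "('v \<Rightarrow> 'w) \<Rightarrow> ('e \<Rightarrow> 'd) \<Rightarrow> ('w, 'd, 'k, 'u) rep \<Rightarrow> ('v, 'e, 'k, 'u) rep" where
  "pullback fv fe \<psi> = \<lparr>space = (\<lambda>y. space \<psi> (fv y)), maps = (\<lambda>b. maps \<psi> (fe b))\<rparr>"

text \<open>A direct sum of spaces indexed by vertices consists of families of vectors. Iterated
  pushforwards produce families of families and so on; the following type contains all of them,
  over the base type \<open>'u\<close> of vectors of the representation one starts with.\<close>

datatype ('v, 'u) tower = Base (base_vector: 'u) | Family (component: "'v \<Rightarrow> ('v, 'u) tower")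

definition base_space :: "('k, 'u) module \<Rightarrow> ('k, ('v, 'u) tower) module" where
  "base_space V =
     \<lparr>carrier = Base ` carrier V, mult = undefined, one = undefined,
      zero = Base \<zero>\<^bsub>V\<^esub>,
      add = (\<lambda>s t. Base (base_vector s \<oplus>\<^bsub>V\<^esub> base_vector t)),
      smult = (\<lambda>c s. Base (c \<odot>\<^bsub>V\<^esub> base_vector s))\<rparr>"

definition base_rep :: "('v, 'e, 'k, 'u) rep \<Rightarrow> ('v, 'e, 'k, ('v, 'u) tower) rep" where
  "base_rep \<phi> =
     \<lparr>space = (\<lambda>x. base_space (space \<phi> x)), maps = (\<lambda>a s. Base (maps \<phi> a (base_vector s)))\<rparr>"

definition direct_sum_space ::
  "'v set \<Rightarrow> ('v \<Rightarrow> ('k, ('v, 'u) tower) module) \<Rightarrow> ('k, ('v, 'u) tower) module" where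
  "direct_sum_space Y V =
     \<lparr>carrier = Family ` (\<Pi>\<^sub>E y\<in>Y. carrier (V y)), mult = undefined, one = undefined,
      zero = Family (\<lambda>y\<in>Y. \<zero>\<^bsub>V y\<^esub>),
      add = (\<lambda>s t. Family (\<lambda>y\<in>Y. component s y \<oplus>\<^bsub>V y\<^esub> component t y)),
      smult = (\<lambda>c s. Family (\<lambda>y\<in>Y. c \<odot>\<^bsub>V y\<^esub> component s y))\<rparr>"

text \<open>In the pushforward along a morphism from \<open>Q\<close> to \<open>R\<close>, the component at \<open>z\<close> of the image of
  \<open>s\<close> under the map over \<open>a\<close> is the sum of \<open>\<phi>\<^sub>b\<close> applied to the component of \<open>s\<close> at the tail of \<open>b\<close>,
  over the arrows \<open>b\<close> above \<open>a\<close> with head \<open>z\<close>.\<close>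

definition pushforward ::
  "('v, 'e) pre_digraph \<Rightarrow> ('v, 'e) pre_digraph \<Rightarrow> ('v \<Rightarrow> 'v) \<Rightarrow> ('e \<Rightarrow> 'e) \<Rightarrow>
   ('v, 'e, 'k, ('v, 'u) tower) rep \<Rightarrow> ('v, 'e, 'k, ('v, 'u) tower) rep" where
  "pushforward Q R fv fe \<phi> =
     \<lparr>space = (\<lambda>x. direct_sum_space {y \<in> verts Q. fv y = x} (space \<phi>)),
      maps = (\<lambda>a s. Family (\<lambda>z\<in>{z \<in> verts Q. fv z = head R a}.
        \<Oplus>\<^bsub>space \<phi> z\<^esub>b\<in>{b \<in> arcs Q. fe b = a \<and> head Q b = z}.
          maps \<phi> b (component s (tail Q b))))\<rparr>"


section \<open>Rank functions\<close>

text \<open>A step carries the next quiver of the sequence and a morphism to it (pushforward) or from it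
  (pullback). All quivers of a sequence share the types \<open>'v\<close> and \<open>'e\<close>; when these are infinite,
  every finite quiver occurs up to isomorphism.\<close>

datatype ('v, 'e) step =
  Push "('v, 'e) pre_digraph" "'v \<Rightarrow> 'v" "'e \<Rightarrow> 'e"
| Pull "('v, 'e) pre_digraph" "'v \<Rightarrow> 'v" "'e \<Rightarrow> 'e"

fun step_sequence :: "('v, 'e) pre_digraph \<Rightarrow> ('v, 'e) step list \<Rightarrow> bool" where
  "step_sequence Q [] \<longleftrightarrow> True"
| "step_sequence Q (Push R fv fe # ss) \<longleftrightarrow>
     quiver R \<and> quiver_hom Q R fv fe \<and> step_sequence R ss"
| "step_sequence Q (Pull R fv fe # ss) \<longleftrightarrow>
     quiver R \<and> quiver_hom R Q fv fe \<and> step_sequence R ss"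

fun rank_after_steps ::
  "('v, 'e) pre_digraph \<Rightarrow> ('v, 'e) step list \<Rightarrow>
   ('v, 'e, 'k::field, ('v, 'u) tower) rep \<Rightarrow> nat" where
  "rank_after_steps Q [] \<phi> = global_rank Q \<phi>"
| "rank_after_steps Q (Push R fv fe # ss) \<phi> = rank_after_steps R ss (pushforward Q R fv fe \<phi>)"
| "rank_after_steps Q (Pull R fv fe # ss) \<phi> = rank_after_steps R ss (pullback fv fe \<phi>)"

text \<open>The rank functions on \<open>Q\<close> are the functions \<open>rank_function Q ss\<close> with \<open>step_sequence Q ss\<close>.
  They are indexed by \<open>ss\<close>, so that the same rank function applies to representations with
  different types of vectors.\<close>

definition rank_function ::
  "('v, 'e) pre_digraph \<Rightarrow> ('v, 'e) step list \<Rightarrow> ('v, 'e, 'k::field, 'u) rep \<Rightarrow> nat" where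
  "rank_function Q ss \<phi> = rank_after_steps Q ss (base_rep \<phi>)"


section \<open>The Zariski topology\<close>

inductive_set polynomial_functions :: "'i set \<Rightarrow> (('i \<Rightarrow> 'k::comm_ring_1) \<Rightarrow> 'k) set"
  for I :: "'i set" where
  const: "(\<lambda>_. c) \<in> polynomial_functions I"
| coord: "i \<in> I \<Longrightarrow> (\<lambda>p. p i) \<in> polynomial_functions I"
| add: "f \<in> polynomial_functions I \<Longrightarrow> g \<in> polynomial_functions I \<Longrightarrow>
    (\<lambda>p. f p + g p) \<in> polynomial_functions I"
| mult: "f \<in> polynomial_functions I \<Longrightarrow> g \<in> polynomial_functions I \<Longrightarrow>
    (\<lambda>p. f p * g p) \<in> polynomial_functions I"

definition affine_space :: "'i set \<Rightarrow> ('i \<Rightarrow> 'k) set" where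
  "affine_space I = (\<Pi>\<^sub>E i\<in>I. UNIV)"

definition zariski_affine :: "'i set \<Rightarrow> ('i \<Rightarrow> 'k::field) topology" where
  "zariski_affine I =
     topology_generated_by {{p \<in> affine_space I. f p \<noteq> 0} | f. f \<in> polynomial_functions I}"

definition rep_space ::
  "('v, 'e) pre_digraph \<Rightarrow> ('v \<Rightarrow> nat) \<Rightarrow> ('e \<Rightarrow> 'k mat) set" where
  "rep_space Q \<alpha> = (\<Pi>\<^sub>E a\<in>arcs Q. carrier_mat (\<alpha> (head Q a)) (\<alpha> (tail Q a)))"

definition grassmannian ::
  "('v, 'e) pre_digraph \<Rightarrow> ('v \<Rightarrow> nat) \<Rightarrow> ('v \<Rightarrow> nat) \<Rightarrow> ('v \<Rightarrow> 'k::field vec set) set" where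
  "grassmannian Q \<alpha> \<beta> =
     (\<Pi>\<^sub>E x\<in>verts Q. {U. VectorSpace.subspace class_ring U (module_vec TYPE('k) (\<alpha> x)) \<and>
        vectorspace.dim class_ring ((module_vec TYPE('k) (\<alpha> x))\<lparr>carrier := U\<rparr>) = \<beta> x})"

text \<open>The product of Grassmannians is covered by the standard affine charts: for a choice of
  \<open>\<beta> x\<close> coordinates \<open>J x\<close> at each vertex, the chart consists of the families of subspaces which are
  graphs of linear maps from \<open>K\<^bsup>J x\<^esup>\<close> to the space of the remaining coordinates, and the matrix
  entries of these maps are the coordinates of the chart.\<close>

datatype ('v, 'e) coordinate = Gr_coord 'v nat nat | Rep_coord 'e nat nat

definition chart_indices ::
  "('v, 'e) pre_digraph \<Rightarrow> ('v \<Rightarrow> nat) \<Rightarrow> ('v \<Rightarrow> nat) \<Rightarrow> ('v \<Rightarrow> nat set) set" where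
  "chart_indices Q \<alpha> \<beta> = (\<Pi>\<^sub>E x\<in>verts Q. {J. J \<subseteq> {..<\<alpha> x} \<and> card J = \<beta> x})"

definition chart_coords ::
  "('v, 'e) pre_digraph \<Rightarrow> ('v \<Rightarrow> nat) \<Rightarrow> ('v \<Rightarrow> nat set) \<Rightarrow> ('v, 'e) coordinate set" where
  "chart_coords Q \<alpha> J =
     {Gr_coord x i j | x i j. x \<in> verts Q \<and> i \<in> {..<\<alpha> x} - J x \<and> j \<in> J x} \<union>
     {Rep_coord a i j | a i j. a \<in> arcs Q \<and> i < \<alpha> (head Q a) \<and> j < \<alpha> (tail Q a)}"

definition chart ::
  "('v, 'e) pre_digraph \<Rightarrow> ('v \<Rightarrow> nat) \<Rightarrow> ('v \<Rightarrow> nat set) \<Rightarrow> (('v, 'e) coordinate \<Rightarrow> 'k::field) \<Rightarrow>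
   ('v \<Rightarrow> 'k vec set) \<times> ('e \<Rightarrow> 'k mat)" where
  "chart Q \<alpha> J p =
     ((\<lambda>x\<in>verts Q. {w \<in> carrier_vec (\<alpha> x).
        \<forall>i\<in>{..<\<alpha> x} - J x. w $ i = (\<Sum>j\<in>J x. p (Gr_coord x i j) * w $ j)}),
      (\<lambda>a\<in>arcs Q. mat (\<alpha> (head Q a)) (\<alpha> (tail Q a)) (\<lambda>(i, j). p (Rep_coord a i j))))"

definition zariski_open ::
  "('v, 'e) pre_digraph \<Rightarrow> ('v \<Rightarrow> nat) \<Rightarrow> ('v \<Rightarrow> nat) \<Rightarrow>
   (('v \<Rightarrow> 'k::field vec set) \<times> ('e \<Rightarrow> 'k mat)) set \<Rightarrow> bool" where
  "zariski_open Q \<alpha> \<beta> U \<longleftrightarrow>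
     U \<subseteq> grassmannian Q \<alpha> \<beta> \<times> rep_space Q \<alpha> \<and>
     (\<forall>J\<in>chart_indices Q \<alpha> \<beta>. openin (zariski_affine (chart_coords Q \<alpha> J))
        {p \<in> affine_space (chart_coords Q \<alpha> J). chart Q \<alpha> J p \<in> U})"

definition zariski_product ::
  "('v, 'e) pre_digraph \<Rightarrow> ('v \<Rightarrow> nat) \<Rightarrow> ('v \<Rightarrow> nat) \<Rightarrow>
   (('v \<Rightarrow> 'k::field vec set) \<times> ('e \<Rightarrow> 'k mat)) topology" where
  "zariski_product Q \<alpha> \<beta> = topology (zariski_open Q \<alpha> \<beta>)"

lemma istopology_zariski_open:
  fixes Q :: "('v, 'e) pre_digraph"
  shows "istopology (zariski_open Q \<alpha> \<beta> ::
           (('v \<Rightarrow> 'k::field vec set) \<times> ('e \<Rightarrow> 'k mat)) set \<Rightarrow> bool)"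
  unfolding istopology_def
proof (intro conjI allI impI)
  fix S T :: "(('v \<Rightarrow> 'k vec set) \<times> ('e \<Rightarrow> 'k mat)) set"
  assume S: "zariski_open Q \<alpha> \<beta> S" and T: "zariski_open Q \<alpha> \<beta> T"
  have "openin (zariski_affine (chart_coords Q \<alpha> J))
      {p \<in> affine_space (chart_coords Q \<alpha> J). chart Q \<alpha> J p \<in> S \<inter> T}"
    if J: "J \<in> chart_indices Q \<alpha> \<beta>" for J
  proof -
    have "{p \<in> affine_space (chart_coords Q \<alpha> J). chart Q \<alpha> J p \<in> S \<inter> T} =
        {p \<in> affine_space (chart_coords Q \<alpha> J). chart Q \<alpha> J p \<in> S} \<inter>
        {p \<in> affine_space (chart_coords Q \<alpha> J). chart Q \<alpha> J p \<in> T}"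
      by blast
    then show ?thesis
      using S T J by (simp only:) (auto intro: openin_Int simp: zariski_open_def)
  qed
  then show "zariski_open Q \<alpha> \<beta> (S \<inter> T)"
    using S unfolding zariski_open_def by blast
next
  fix \<K> :: "(('v \<Rightarrow> 'k vec set) \<times> ('e \<Rightarrow> 'k mat)) set set"
  assume K: "\<forall>U\<in>\<K>. zariski_open Q \<alpha> \<beta> U"
  have "openin (zariski_affine (chart_coords Q \<alpha> J))
      {p \<in> affine_space (chart_coords Q \<alpha> J). chart Q \<alpha> J p \<in> \<Union>\<K>}"
    if J: "J \<in> chart_indices Q \<alpha> \<beta>" for J
  proof -
    have "{p \<in> affine_space (chart_coords Q \<alpha> J). chart Q \<alpha> J p \<in> \<Union>\<K>} =
        (\<Union>U\<in>\<K>. {p \<in> affine_space (chart_coords Q \<alpha> J). chart Q \<alpha> J p \<in> U})"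
      by blast
    then show ?thesis
      using K J by (simp only:) (auto intro!: openin_Union simp: zariski_open_def)
  qed
  then show "zariski_open Q \<alpha> \<beta> (\<Union>\<K>)"
    using K unfolding zariski_open_def by blast
qed

lemma openin_zariski_product: "openin (zariski_product Q \<alpha> \<beta>) U \<longleftrightarrow> zariski_open Q \<alpha> \<beta> U"
  by (simp add: zariski_product_def topology_inverse' istopology_zariski_open)


section \<open>The bundle of subrepresentations and its rank loci\<close>

definition matrix_rep ::
  "('v \<Rightarrow> nat) \<Rightarrow> ('e \<Rightarrow> 'k::field mat) \<Rightarrow> ('v, 'e, 'k, 'k vec) rep" where
  "matrix_rep \<alpha> \<phi> = \<lparr>space = (\<lambda>x. module_vec TYPE('k) (\<alpha> x)), maps = (\<lambda>a v. \<phi> a *\<^sub>v v)\<rparr>"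

definition subrep_bundle ::
  "('v, 'e) pre_digraph \<Rightarrow> ('v \<Rightarrow> nat) \<Rightarrow> ('v \<Rightarrow> nat) \<Rightarrow>
   (('v \<Rightarrow> 'k::field vec set) \<times> ('e \<Rightarrow> 'k mat)) set" where
  "subrep_bundle Q \<alpha> \<beta> =
     {(W, \<phi>) \<in> grassmannian Q \<alpha> \<beta> \<times> rep_space Q \<alpha>.
        \<forall>a\<in>arcs Q. (\<lambda>v. \<phi> a *\<^sub>v v) ` W (tail Q a) \<subseteq> W (head Q a)}"

definition subrep_bundle_topology ::
  "('v, 'e) pre_digraph \<Rightarrow> ('v \<Rightarrow> nat) \<Rightarrow> ('v \<Rightarrow> nat) \<Rightarrow>
   (('v \<Rightarrow> 'k::field vec set) \<times> ('e \<Rightarrow> 'k mat)) topology" where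
  "subrep_bundle_topology Q \<alpha> \<beta> = subtopology (zariski_product Q \<alpha> \<beta>) (subrep_bundle Q \<alpha> \<beta>)"

inductive constructible :: "'p topology \<Rightarrow> 'p set \<Rightarrow> bool" for X :: "'p topology" where
  "openin X S \<Longrightarrow> constructible X S"
| "closedin X S \<Longrightarrow> constructible X S"
| "constructible X S \<Longrightarrow> constructible X T \<Longrightarrow> constructible X (S \<union> T)"
| "constructible X S \<Longrightarrow> constructible X T \<Longrightarrow> constructible X (S \<inter> T)"

definition bundle_rank_functions ::
  "('v, 'e) pre_digraph \<Rightarrow> ('v \<Rightarrow> nat) \<Rightarrow>
   (('v \<Rightarrow> 'k::field vec set) \<times> ('e \<Rightarrow> 'k mat) \<Rightarrow> nat) set" where
  "bundle_rank_functions Q \<alpha> =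
     {(\<lambda>(W, \<phi>). rank_function Q ss (sub_rep (matrix_rep \<alpha> \<phi>) W)) | ss. step_sequence Q ss} \<union>
     {(\<lambda>(W, \<phi>). rank_function Q ss (quotient_rep Q (matrix_rep \<alpha> \<phi>) W)) | ss. step_sequence Q ss}"

text \<open>Inequalities may be strict or not, with real coefficients and a constant term.\<close>

definition rank_inequalities ::
  "('v, 'e) pre_digraph \<Rightarrow> ('v \<Rightarrow> nat) \<Rightarrow>
   (('v \<Rightarrow> 'k::field vec set) \<times> ('e \<Rightarrow> 'k mat) \<Rightarrow> bool) set" where
  "rank_inequalities Q \<alpha> =
     {(\<lambda>p. (\<Sum>(c, r)\<leftarrow>ts. c * real (r p)) \<le> d) | ts d. snd ` set ts \<subseteq> bundle_rank_functions Q \<alpha>} \<union>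
     {(\<lambda>p. (\<Sum>(c, r)\<leftarrow>ts. c * real (r p)) < d) | ts d. snd ` set ts \<subseteq> bundle_rank_functions Q \<alpha>}"

definition rank_locus ::
  "('v, 'e) pre_digraph \<Rightarrow> ('v \<Rightarrow> nat) \<Rightarrow> ('v \<Rightarrow> nat) \<Rightarrow>
   (('v \<Rightarrow> 'k::field vec set) \<times> ('e \<Rightarrow> 'k mat)) set \<Rightarrow> bool" where
  "rank_locus Q \<alpha> \<beta> S \<longleftrightarrow>
     (\<exists>Ps. set Ps \<subseteq> rank_inequalities Q \<alpha> \<and>
           S = {p \<in> subrep_bundle Q \<alpha> \<beta>. \<forall>P\<in>set Ps. P p})"

end

theory Submission
  imports Defs "HOL-Library.Function_Algebras"
begin

text \<open>Linear algebra over an arbitrary field can be done uniformly in parameters: kernels, images and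
  preimages of subspaces spanned by finitely many vectors with piecewise polynomial entries are again
  of this kind, with pieces given by the vanishing or nonvanishing of the entries met during
  elimination. In an affine chart of the bundle both the subrepresentation and the quotient are
  presented by matrices whose entries are piecewise polynomial in the coordinates, and pushforward and
  pullback preserve such presentations. The global rank is the dimension of the limit of a
  decreasing chain modulo the limit of an increasing chain, both reached after a bounded number of
  image and preimage steps, so its level sets in a chart are constructible. The charts are open
  embeddings, since two of them are related by a chain of exchanges of one coordinate, which are
  rational maps; hence constructibility can be checked on charts.\<close>

section \<open>Spaces of functions with values in a field\<close>

text \<open>Over an arbitrary field a polynomial image of a constructible set need not be
  constructible (the squares in the reals are not), so quantifiers over vectors have to be removed
  by explicit linear algebra. The elimination used here needs only sums, products and zero tests, so
  no denominators arise. The vectors met along a rank function change their type: columns, cosets,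
  families of families. Every space is therefore written as the image of a subspace \<open>U\<close>
  of one fixed function space under a linear surjection \<open>s\<close>, possibly with a kernel.
  Passing to a subspace shrinks \<open>U\<close>, passing to a quotient enlarges the kernel, and all
  computation happens among subspaces of functions. The number of iteration steps must not depend on
  the point; generating sets of fixed size bound all dimensions, and with them the number of steps.
  Finally, ranks are natural numbers and cannot be values in the field, whose characteristic might
  identify them; they enter through finitely many possible choices of irredundant
  generators.\<close>

definition fscale :: "'k::field \<Rightarrow> ('i \<Rightarrow> 'k) \<Rightarrow> 'i \<Rightarrow> 'k" where
  "fscale c f = (\<lambda>i. c * f i)"

lemma fscale_apply [simp]: "fscale c f i = c * f i"
  by (simp add: fscale_def)

interpretation fvs: vector_space "fscale :: 'k::field \<Rightarrow> ('i \<Rightarrow> 'k) \<Rightarrow> 'i \<Rightarrow> 'k"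
  by unfold_locales (simp_all add: fun_eq_iff algebra_simps)

interpretation fvp: vector_space_pair
  "fscale :: 'k::field \<Rightarrow> ('i \<Rightarrow> 'k) \<Rightarrow> 'i \<Rightarrow> 'k" "fscale :: 'k::field \<Rightarrow> ('j \<Rightarrow> 'k) \<Rightarrow> 'j \<Rightarrow> 'k"
  by unfold_locales

abbreviation fun_linear :: "(('i \<Rightarrow> 'k::field) \<Rightarrow> 'j \<Rightarrow> 'k) \<Rightarrow> bool" where
  "fun_linear \<equiv> Vector_Spaces.linear fscale fscale"

lemma fun_linearI:
  fixes F :: "('i \<Rightarrow> 'k::field) \<Rightarrow> 'j \<Rightarrow> 'k"
  assumes "\<And>f g. F (f + g) = F f + F g" and "\<And>c f. F (fscale c f) = fscale c (F f)"
  shows "fun_linear F"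
  using assms by (simp add: Vector_Spaces.linear_iff fvs.vector_space_axioms)

lemma fun_linear_reindex:
  fixes r :: "'j \<Rightarrow> 'i"
  shows "fun_linear (\<lambda>(f :: 'i \<Rightarrow> 'k::field) i. if P i then f (r i) else 0)"
  by (rule fun_linearI) (auto simp: fun_eq_iff)

section \<open>Definable families of vectors and subspaces\<close>

text \<open>The elements of \<open>D\<close> play the role of functions of the parameter \<open>p \<in> X\<close> which can be computed
  from the coordinates by field operations and case distinctions. Linear algebra is done uniformly
  in \<open>p\<close>: a definable family of subspaces is given by finitely many generators that depend
  on \<open>p\<close>.\<close>

locale definable_functions =
  fixes X :: "'x set" and D :: "('x \<Rightarrow> 'k::field) set"
  assumes const: "(\<lambda>_. c) \<in> D"
    and add: "f \<in> D \<Longrightarrow> g \<in> D \<Longrightarrow> (\<lambda>p. f p + g p) \<in> D"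
    and mult: "f \<in> D \<Longrightarrow> g \<in> D \<Longrightarrow> (\<lambda>p. f p * g p) \<in> D"
    and is_zero: "f \<in> D \<Longrightarrow> (\<lambda>p. of_bool (f p = 0)) \<in> D"
    and cong: "f \<in> D \<Longrightarrow> (\<And>p. p \<in> X \<Longrightarrow> f p = g p) \<Longrightarrow> g \<in> D"
begin

lemma sum: "(\<And>a. a \<in> A \<Longrightarrow> f a \<in> D) \<Longrightarrow> (\<lambda>p. \<Sum>a\<in>A. f a p) \<in> D"
  by (induction A rule: infinite_finite_induct) (simp_all add: const add)

text \<open>Truth values are coded by 0 and 1 in the field, so that conjunction is a product and
  negation is the zero test.\<close>

definition dpred :: "('x \<Rightarrow> bool) \<Rightarrow> bool" where
  "dpred P \<longleftrightarrow> (\<lambda>p. of_bool (P p)) \<in> D"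

lemma dpred_zero: "f \<in> D \<Longrightarrow> dpred (\<lambda>p. f p = 0)"
  by (simp add: dpred_def is_zero)

lemma dpred_const [simp]: "dpred (\<lambda>_. P)"
  by (simp add: dpred_def const)

lemma dpred_not: "dpred P \<Longrightarrow> dpred (\<lambda>p. \<not> P p)"
  using is_zero[of "\<lambda>p. of_bool (P p)"] by (simp add: dpred_def)

lemma dpred_conj: "dpred P \<Longrightarrow> dpred P' \<Longrightarrow> dpred (\<lambda>p. P p \<and> P' p)"
  using mult[of "\<lambda>p. of_bool (P p)" "\<lambda>p. of_bool (P' p)"] by (simp add: dpred_def of_bool_conj)

lemma dpred_cong: "dpred P \<Longrightarrow> (\<And>p. p \<in> X \<Longrightarrow> P p \<longleftrightarrow> P' p) \<Longrightarrow> dpred P'"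
  unfolding dpred_def by (erule cong) simp

lemma dpred_disj: "dpred P \<Longrightarrow> dpred P' \<Longrightarrow> dpred (\<lambda>p. P p \<or> P' p)"
  using dpred_not[OF dpred_conj[OF dpred_not dpred_not], of P P'] by simp

lemma dpred_ball:
  assumes "finite A" and "\<And>a. a \<in> A \<Longrightarrow> dpred (P a)"
  shows "dpred (\<lambda>p. \<forall>a\<in>A. P a p)"
  using assms by (induction A rule: finite_induct) (simp_all add: dpred_conj)

lemma dpred_bex:
  assumes "finite A" and "\<And>a. a \<in> A \<Longrightarrow> dpred (P a)"
  shows "dpred (\<lambda>p. \<exists>a\<in>A. P a p)"
  using assms by (induction A rule: finite_induct) (simp_all add: dpred_disj)

text \<open>Index types may be infinite. The finite support \<open>C\<close> is common to all
  \<open>p\<close> in \<open>X\<close>, which later lets the kernel of a vector-valued map be cut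
  out by finitely many coordinate conditions.\<close>

definition dvec :: "('x \<Rightarrow> 'i \<Rightarrow> 'k) \<Rightarrow> bool" where
  "dvec v \<longleftrightarrow> (\<forall>i. (\<lambda>p. v p i) \<in> D) \<and> (\<exists>C. finite C \<and> (\<forall>p\<in>X. \<forall>i. i \<notin> C \<longrightarrow> v p i = 0))"

lemma dvecI:
  assumes "\<And>i. (\<lambda>p. v p i) \<in> D" and "finite C" and "\<And>p i. p \<in> X \<Longrightarrow> i \<notin> C \<Longrightarrow> v p i = 0"
  shows "dvec v"
  using assms unfolding dvec_def by blast

lemma dvec_component: "dvec v \<Longrightarrow> (\<lambda>p. v p i) \<in> D"
  by (simp add: dvec_def)

lemma dvec_zero: "dvec (\<lambda>_. 0)"
  by (rule dvecI[of _ "{}"]) (simp_all add: const)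

lemma dvec_add:
  assumes "dvec v" and "dvec w"
  shows "dvec (\<lambda>p. v p + w p)"
proof -
  obtain C C' where "finite C" "\<forall>p\<in>X. \<forall>i. i \<notin> C \<longrightarrow> v p i = 0"
    and "finite C'" "\<forall>p\<in>X. \<forall>i. i \<notin> C' \<longrightarrow> w p i = 0"
    using assms unfolding dvec_def by blast
  then show ?thesis
    using assms by (intro dvecI[of _ "C \<union> C'"]) (auto simp: dvec_component add)
qed

lemma dvec_scale: "f \<in> D \<Longrightarrow> dvec v \<Longrightarrow> dvec (\<lambda>p. fscale (f p) (v p))"
  unfolding dvec_def by (auto intro: mult)

lemma dvec_diff: "dvec v \<Longrightarrow> dvec w \<Longrightarrow> dvec (\<lambda>p. v p - w p)"
  using dvec_add[OF _ dvec_scale[OF const[of "-1"]], of v w] by (simp add: fvs.scale_minus_left)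

text \<open>Given by its effect on definable vectors instead of by a matrix, which might be
  infinite; the images of generators are all that \<open>dsub_image\<close> asks for.\<close>

definition dmap :: "('x \<Rightarrow> ('i \<Rightarrow> 'k) \<Rightarrow> 'j \<Rightarrow> 'k) \<Rightarrow> bool" where
  "dmap F \<longleftrightarrow> (\<forall>p\<in>X. fun_linear (F p)) \<and> (\<forall>v. dvec v \<longrightarrow> dvec (\<lambda>p. F p (v p)))"

lemma dmapI:
  assumes "\<And>p. p \<in> X \<Longrightarrow> fun_linear (F p)" and "\<And>v. dvec v \<Longrightarrow> dvec (\<lambda>p. F p (v p))"
  shows "dmap F"
  using assms by (simp add: dmap_def)

lemma dmap_linear: "dmap F \<Longrightarrow> p \<in> X \<Longrightarrow> fun_linear (F p)"
  and dmap_dvec: "dmap F \<Longrightarrow> dvec v \<Longrightarrow> dvec (\<lambda>p. F p (v p))"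
  by (simp_all add: dmap_def)

lemma dmap_id: "dmap (\<lambda>_ f. f)"
  by (intro dmapI) (auto intro: fun_linearI)

lemma dmap_zero: "dmap (\<lambda>_ _. 0)"
  by (intro dmapI) (auto intro!: fun_linearI dvec_zero simp: fun_eq_iff)

lemma dmap_comp:
  assumes "dmap F" and "dmap G"
  shows "dmap (\<lambda>p f. G p (F p f))"
proof (rule dmapI)
  show "fun_linear (\<lambda>f. G p (F p f))" if "p \<in> X" for p
    using Vector_Spaces.linear_compose[OF dmap_linear[OF assms(1) that] dmap_linear[OF assms(2) that]]
    by (simp add: comp_def)
  show "dvec (\<lambda>p. G p (F p (v p)))" if "dvec v" for v
    by (rule dmap_dvec[OF assms(2) dmap_dvec[OF assms(1) that]])
qed

lemma dmap_add: "dmap F \<Longrightarrow> dmap G \<Longrightarrow> dmap (\<lambda>p f. F p f + G p f)"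
  by (intro dmapI) (auto simp: dmap_dvec dvec_add intro!: fun_linearI
      simp: fvp.linear_add[OF dmap_linear] fvp.linear_scale[OF dmap_linear] fvs.scale_right_distrib)

lemma dmap_diff: "dmap F \<Longrightarrow> dmap G \<Longrightarrow> dmap (\<lambda>p f. F p f - G p f)"
  by (intro dmapI) (auto simp: dmap_dvec dvec_diff intro!: fun_linearI
      simp: fvp.linear_add[OF dmap_linear] fvp.linear_scale[OF dmap_linear] fvs.scale_right_diff_distrib)

lemma dmap_sum:
  assumes "\<And>a. a \<in> A \<Longrightarrow> dmap (F a)"
  shows "dmap (\<lambda>p f. \<Sum>a\<in>A. F a p f)"
  using assms
  by (induction A rule: infinite_finite_induct) (auto simp: dmap_add dmap_zero)

text \<open>Projections, extensions by zero, \<open>summand\<close> and \<open>inject\<close> are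
  all instances. Injectivity of \<open>r\<close> where \<open>P\<close> holds keeps the preimage of
  a finite support finite.\<close>

lemma dmap_reindex:
  fixes r :: "'j \<Rightarrow> 'i"
  assumes "inj_on r {i. P i}"
  shows "dmap (\<lambda>_ f i. if P i then f (r i) else 0)"
proof (rule dmapI)
  show "fun_linear (\<lambda>f i. if P i then f (r i) else 0 :: 'k)"
    by (rule fun_linear_reindex)
next
  fix v :: "'x \<Rightarrow> 'i \<Rightarrow> 'k"
  assume v: "dvec v"
  then obtain C where C: "finite C" "\<forall>p\<in>X. \<forall>i. i \<notin> C \<longrightarrow> v p i = 0"
    unfolding dvec_def by blast
  show "dvec (\<lambda>p i. if P i then v p (r i) else 0)"
  proof (rule dvecI)
    show "(\<lambda>p. if P i then v p (r i) else 0) \<in> D" for i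
      using dvec_component[OF v, of "r i"] const[of 0] by (cases "P i") simp_all
    show "finite (r -` C \<inter> {i. P i})"
      using C(1) assms by (rule finite_vimage_IntI)
  qed (use C(2) in auto)
qed

text \<open>One finite set of generators serves all parameters. They may become dependent, so the
  dimension can jump with \<open>p\<close>, but the size of \<open>G\<close> bounds it
  throughout.\<close>

definition dsub :: "('x \<Rightarrow> ('i \<Rightarrow> 'k) set) \<Rightarrow> bool" where
  "dsub U \<longleftrightarrow>
     (\<exists>G. finite G \<and> (\<forall>v\<in>G. dvec v) \<and> (\<forall>p\<in>X. U p = fvs.span ((\<lambda>v. v p) ` G)))"

lemma dsubI:
  assumes "finite G" and "\<And>v. v \<in> G \<Longrightarrow> dvec v" and "\<And>p. p \<in> X \<Longrightarrow> U p = fvs.span ((\<lambda>v. v p) ` G)"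
  shows "dsub U"
  using assms unfolding dsub_def by blast

lemma dsubE:
  assumes "dsub U"
  obtains G where "finite G" "\<And>v. v \<in> G \<Longrightarrow> dvec v" "\<And>p. p \<in> X \<Longrightarrow> U p = fvs.span ((\<lambda>v. v p) ` G)"
  using assms unfolding dsub_def by blast

lemma dsub_cong: "dsub U \<Longrightarrow> (\<And>p. p \<in> X \<Longrightarrow> U p = V p) \<Longrightarrow> dsub V"
  unfolding dsub_def by force

lemma dsub_subspace: "dsub U \<Longrightarrow> p \<in> X \<Longrightarrow> fvs.subspace (U p)"
  by (erule dsubE) simp

lemma dsub_zero: "dsub (\<lambda>_. {0})"
  by (rule dsubI[of "{}"]) simp_all

lemma dsub_sum:
  assumes "dsub U" and "dsub V"
  shows "dsub (\<lambda>p. {f + g | f g. f \<in> U p \<and> g \<in> V p})"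
proof -
  obtain G where G: "finite G" "\<And>v. v \<in> G \<Longrightarrow> dvec v" "\<And>p. p \<in> X \<Longrightarrow> U p = fvs.span ((\<lambda>v. v p) ` G)"
    using assms(1) by (rule dsubE) auto
  obtain H where H: "finite H" "\<And>v. v \<in> H \<Longrightarrow> dvec v" "\<And>p. p \<in> X \<Longrightarrow> V p = fvs.span ((\<lambda>v. v p) ` H)"
    using assms(2) by (rule dsubE) auto
  show ?thesis
    using G H by (intro dsubI[of "G \<union> H"]) (auto simp: image_Un fvs.span_Un)
qed

lemma dsub_image:
  assumes "dmap F" and "dsub U"
  shows "dsub (\<lambda>p. F p ` U p)"
proof -
  obtain G where G: "finite G" "\<And>v. v \<in> G \<Longrightarrow> dvec v" "\<And>p. p \<in> X \<Longrightarrow> U p = fvs.span ((\<lambda>v. v p) ` G)"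
    using assms(2) by (rule dsubE) auto
  show ?thesis
    using G assms(1)
    by (intro dsubI[of "(\<lambda>v p. F p (v p)) ` G"])
      (auto simp: dmap_dvec image_image simp flip: fvp.linear_span_image[OF dmap_linear])
qed

text \<open>The supports of the finitely many generators unite to one finite set, and vanishing
  outside it passes to the span.\<close>

lemma dsub_support:
  assumes "dsub U"
  obtains C where "finite C" "\<And>p f i. p \<in> X \<Longrightarrow> f \<in> U p \<Longrightarrow> i \<notin> C \<Longrightarrow> f i = 0"
proof -
  obtain G where G: "finite G" "\<And>v. v \<in> G \<Longrightarrow> dvec v" "\<And>p. p \<in> X \<Longrightarrow> U p = fvs.span ((\<lambda>v. v p) ` G)"
    using assms by (rule dsubE) auto
  have "\<exists>C. \<forall>v\<in>G. finite (C v) \<and> (\<forall>p\<in>X. \<forall>i. i \<notin> C v \<longrightarrow> v p i = 0)"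
    using G(2) unfolding dvec_def by (intro bchoice) blast
  then obtain C where C: "\<And>v. v \<in> G \<Longrightarrow> finite (C v)"
      "\<And>v p i. v \<in> G \<Longrightarrow> p \<in> X \<Longrightarrow> i \<notin> C v \<Longrightarrow> v p i = 0"
    by metis
  show ?thesis
  proof
    show "finite (\<Union>v\<in>G. C v)"
      using G(1) C(1) by blast
    fix p f i
    assume p: "p \<in> X" and f: "f \<in> U p" and i: "i \<notin> (\<Union>v\<in>G. C v)"
    have "fvs.subspace {f. f i = (0 :: 'k)}"
      by (rule fvs.subspaceI) auto
    moreover have "(\<lambda>v. v p) ` G \<subseteq> {f. f i = 0}"
      using C(2)[OF _ p] i by auto
    ultimately have "fvs.span ((\<lambda>v. v p) ` G) \<subseteq> {f. f i = 0}"
      by (intro fvs.span_minimal)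
    then show "f i = 0"
      using f G(3)[OF p] by blast
  qed
qed

text \<open>If some generator \<open>v\<close> has \<open>v k \<noteq> 0\<close>, then the kernel of the \<open>k\<close>-th coordinate is spanned by
  the combinations \<open>v k \<cdot> w - w k \<cdot> v\<close> of pairs of generators; otherwise it is everything.\<close>

lemma dsub_coordinate_kernel:
  fixes U :: "'x \<Rightarrow> ('i \<Rightarrow> 'k) set"
  assumes "dsub U"
  shows "dsub (\<lambda>p. {f \<in> U p. f k = 0})"
proof -
  obtain G where G: "finite G" "\<And>v. v \<in> G \<Longrightarrow> dvec v" "\<And>p. p \<in> X \<Longrightarrow> U p = fvs.span ((\<lambda>v. v p) ` G)"
    using assms by (rule dsubE) auto
  define comb where "comb = (\<lambda>(v, w) (p :: 'x). fscale (v p k) (w p) - fscale (w p k) (v p) :: 'i \<Rightarrow> 'k)"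
  \<comment> \<open>The factor is 1 where the coordinate vanishes on all generators and 0 elsewhere.
    Hence one set \<open>H\<close> of generators covers both cases without a choice depending on
    \<open>p\<close>.\<close>
  define whole where "whole = (\<lambda>v (p :: 'x). fscale (of_bool (\<forall>w\<in>G. w p k = 0)) (v p) :: 'i \<Rightarrow> 'k)"
  define H where "H = comb ` (G \<times> G) \<union> whole ` G"
  have dH: "dvec v" if "v \<in> H" for v
  proof -
    have "(\<lambda>p. of_bool (\<forall>w\<in>G. w p k = 0)) \<in> D"
      using G by (auto simp flip: dpred_def intro!: dpred_ball dpred_zero dvec_component)
    then show ?thesis
      using that G(2) unfolding H_def comb_def whole_def
      by (auto intro!: dvec_diff dvec_scale dvec_component)
  qed
  have "{f \<in> U p. f k = 0} = fvs.span ((\<lambda>v. v p) ` H)" if p: "p \<in> X" for p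
  proof
    let ?G = "(\<lambda>v. v p) ` G" and ?H = "(\<lambda>v. v p) ` H"
    have sub: "fvs.subspace {f \<in> U p. f k = 0}"
      using fvs.subspace_add fvs.subspace_scale fvs.subspace_0 dsub_subspace[OF assms p]
      by (intro fvs.subspaceI) auto
    have "v p \<in> U p" if "v \<in> G" for v
      using that G(3)[OF p] by (auto intro: fvs.span_base)
    then have "comb (v, w) p \<in> {f \<in> U p. f k = 0}" "whole v p \<in> {f \<in> U p. f k = 0}"
      if "v \<in> G" "w \<in> G" for v w
      using that dsub_subspace[OF assms p] unfolding comb_def whole_def
      by (auto intro!: fvs.subspace_diff fvs.subspace_scale fvs.subspace_0)
    then have "?H \<subseteq> {f \<in> U p. f k = 0}"
      unfolding H_def by auto
    then show "fvs.span ?H \<subseteq> {f \<in> U p. f k = 0}"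
      using sub by (rule fvs.span_minimal)
    show "{f \<in> U p. f k = 0} \<subseteq> fvs.span ?H"
    proof (cases "\<forall>w\<in>G. w p k = 0")
      case True
      then have "whole v p = v p" if "v \<in> G" for v
        using that by (simp add: whole_def)
      moreover have "whole v p \<in> fvs.span ?H" if "v \<in> G" for v
        using that unfolding H_def by (intro fvs.span_base imageI) simp
      ultimately have "?G \<subseteq> fvs.span ?H"
        by auto
      then show ?thesis
        using G(3)[OF p] by (auto dest: fvs.span_minimal)
    next
      case False
      then obtain v where v: "v \<in> G" "v p k \<noteq> 0"
        by blast
      \<comment> \<open>Linear in \<open>f\<close>, this sends generators to members of
        \<open>H\<close>, hence all of \<open>U p\<close> into the span of \<open>H\<close>. On
        vectors with vanishing coordinate \<open>k\<close> it is multiplication by the nonzero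
        scalar \<open>v p k\<close>, so it can be undone.\<close>
      let ?L = "\<lambda>f. fscale (v p k) f - fscale (f k) (v p)"
      have "fvs.subspace {f. ?L f \<in> fvs.span ?H}"
      proof (rule fvs.subspaceI)
        show "0 \<in> {f. ?L f \<in> fvs.span ?H}"
          using fvs.span_zero[of ?H] by (simp add: zero_fun_def fscale_def fun_diff_def)
      next
        fix f g
        assume "f \<in> {f. ?L f \<in> fvs.span ?H}" "g \<in> {f. ?L f \<in> fvs.span ?H}"
        moreover have "?L (f + g) = ?L f + ?L g"
          by (simp add: fun_eq_iff algebra_simps)
        ultimately show "f + g \<in> {f. ?L f \<in> fvs.span ?H}"
          by (metis (mono_tags, lifting) mem_Collect_eq fvs.span_add)
      next
        fix c f
        assume "f \<in> {f. ?L f \<in> fvs.span ?H}"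
        moreover have "?L (fscale c f) = fscale c (?L f)"
          by (simp add: fun_eq_iff algebra_simps)
        ultimately show "fscale c f \<in> {f. ?L f \<in> fvs.span ?H}"
          by (metis (mono_tags, lifting) mem_Collect_eq fvs.span_scale)
      qed
      moreover have "?G \<subseteq> {f. ?L f \<in> fvs.span ?H}"
      proof
        fix f
        assume "f \<in> ?G"
        then obtain w where "w \<in> G" "f = w p"
          by blast
        then have "?L f = comb (v, w) p" "comb (v, w) \<in> H"
          using v(1) by (auto simp: comb_def H_def)
        then show "f \<in> {f. ?L f \<in> fvs.span ?H}"
          by (metis (mono_tags, lifting) mem_Collect_eq fvs.span_base imageI)
      qed
      ultimately have L: "?L f \<in> fvs.span ?H" if "f \<in> U p" for f
        using that G(3)[OF p] fvs.span_minimal by blast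
      show ?thesis
      proof
        fix f
        assume f: "f \<in> {f \<in> U p. f k = 0}"
        then have "fscale (inverse (v p k)) (?L f) \<in> fvs.span ?H"
          by (intro fvs.span_scale L) simp
        moreover have "fscale (inverse (v p k)) (?L f) = f"
          using f v(2) by (simp add: fun_eq_iff)
        ultimately show "f \<in> fvs.span ?H"
          by simp
      qed
    qed
  qed
  then show ?thesis
    using dH G(1) by (intro dsubI[of H]) (auto simp: H_def)
qed

lemma dsub_coordinates_kernel:
  assumes "finite C" and "dsub U"
  shows "dsub (\<lambda>p. {f \<in> U p. \<forall>k\<in>C. f k = 0})"
  using assms(1)
proof induction
  case empty
  then show ?case
    using assms(2) by simp
next
  case (insert k C)
  show ?case
    by (rule dsub_cong[OF dsub_coordinate_kernel[OF insert.IH, of k]]) auto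
qed

section \<open>Pairs of vectors, kernels and preimages\<close>

lemma dmap_Inl: "dmap (\<lambda>_ f i. f (Inl i))"
  using dmap_reindex[of Inl "\<lambda>_. True"] by (simp add: inj_on_def)

lemma dmap_Inr: "dmap (\<lambda>_ f i. f (Inr i))"
  using dmap_reindex[of Inr "\<lambda>_. True"] by (simp add: inj_on_def)

lemma dmap_case_sum_left: "dmap (\<lambda>_ (f :: 'i \<Rightarrow> 'k). case_sum f (\<lambda>_ :: 'j. 0))"
proof -
  have "case_sum f (\<lambda>_ :: 'j. 0) = (\<lambda>i. if isl i then f (projl i) else 0)" for f :: "'i \<Rightarrow> 'k"
    by (auto simp: fun_eq_iff split: sum.splits)
  then show ?thesis
    using dmap_reindex[of projl "isl :: 'i + 'j \<Rightarrow> bool"] by (auto simp: inj_on_def intro: sum.expand)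
qed

lemma dmap_case_sum_right: "dmap (\<lambda>_ (f :: 'j \<Rightarrow> 'k). case_sum (\<lambda>_ :: 'i. 0) f)"
proof -
  have "case_sum (\<lambda>_ :: 'i. 0) f = (\<lambda>i. if \<not> isl i then f (projr i) else 0)" for f :: "'j \<Rightarrow> 'k"
    by (auto simp: fun_eq_iff split: sum.splits)
  then show ?thesis
    using dmap_reindex[of projr "\<lambda>i :: 'i + 'j. \<not> isl i"] by (auto simp: inj_on_def intro: sum.expand)
qed

lemma case_sum_eq_add: "case_sum f g = case_sum f (\<lambda>_. 0) + case_sum (\<lambda>_. 0 :: 'k) g"
  by (auto simp: fun_eq_iff split: sum.splits)

text \<open>A pair of vectors is a function on a disjoint union of index types, and pairing is the
  sum of two extensions by zero.\<close>

lemma dmap_case_sum: "dmap F \<Longrightarrow> dmap G \<Longrightarrow> dmap (\<lambda>p f. case_sum (F p f) (G p f))"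
  by (subst case_sum_eq_add)
    (intro dmap_add dmap_comp[OF _ dmap_case_sum_left] dmap_comp[OF _ dmap_case_sum_right])

text \<open>The kernel is the first projection of those points of the graph of \<open>F p\<close>
  whose second component vanishes. The common finite support of the graph reduces this vanishing to
  finitely many coordinates.\<close>

lemma dsub_kernel:
  assumes "dmap F" and "dsub U"
  shows "dsub (\<lambda>p. {f \<in> U p. F p f = 0})"
proof -
  let ?graph = "\<lambda>p. (\<lambda>f. case_sum f (F p f)) ` U p"
  have graph: "dsub ?graph"
    by (intro dsub_image dmap_case_sum dmap_id assms)
  then obtain C where C: "finite C" "\<And>p h i. p \<in> X \<Longrightarrow> h \<in> ?graph p \<Longrightarrow> i \<notin> C \<Longrightarrow> h i = 0"
    by (rule dsub_support) auto
  have "dsub (\<lambda>p. (\<lambda>h i. h (Inl i)) ` {h \<in> ?graph p. \<forall>k\<in>C \<inter> range Inr. h k = 0})"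
    using C(1) graph by (intro dsub_image[OF dmap_Inl] dsub_coordinates_kernel) simp_all
  then show ?thesis
  proof (rule dsub_cong)
    fix p
    assume p: "p \<in> X"
    have "F p f = 0" if "f \<in> U p" "\<forall>k\<in>C \<inter> range Inr. case_sum f (F p f) k = 0" for f
    proof
      fix i
      show "F p f i = 0 i"
        using C(2)[OF p, of "case_sum f (F p f)" "Inr i"] that(1) bspec[OF that(2), of "Inr i"]
        by (cases "Inr i \<in> C") auto
    qed
    then show "(\<lambda>h i. h (Inl i)) ` {h \<in> ?graph p. \<forall>k\<in>C \<inter> range Inr. h k = 0} = {f \<in> U p. F p f = 0}"
      by (force simp: image_iff)
  qed
qed

text \<open>The preimage is the first projection of the kernel of the map taking
  \<open>(f, g)\<close> to \<open>F p f - g\<close> on the direct sum of \<open>U p\<close> and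
  \<open>V p\<close>. With the identity as \<open>F\<close> this gives intersections.\<close>

lemma dsub_preimage:
  assumes "dmap F" and "dsub U" and "dsub V"
  shows "dsub (\<lambda>p. {f \<in> U p. F p f \<in> V p})"
proof -
  let ?W = "\<lambda>p. {f + g | f g. f \<in> (\<lambda>f. case_sum f (\<lambda>_. 0)) ` U p \<and> g \<in> (\<lambda>g. case_sum (\<lambda>_. 0) g) ` V p}"
  let ?H = "\<lambda>p h. F p (\<lambda>i. h (Inl i)) - (\<lambda>i. h (Inr i))"
  have W: "?W p = {case_sum f g | f g. f \<in> U p \<and> g \<in> V p}" for p
    by (subst case_sum_eq_add) blast
  have "dsub (\<lambda>p. (\<lambda>h i. h (Inl i)) ` {h \<in> ?W p. ?H p h = 0})"
    by (intro dsub_image[OF dmap_Inl] dsub_kernel dmap_diff dmap_comp[OF dmap_Inl assms(1)] dmap_Inr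
        dsub_sum dsub_image[OF dmap_case_sum_left] dsub_image[OF dmap_case_sum_right] assms)
  then show ?thesis
  proof (rule dsub_cong)
    fix p
    show "(\<lambda>h i. h (Inl i)) ` {h \<in> ?W p. ?H p h = 0} = {f \<in> U p. F p f \<in> V p}"
      unfolding W by (force simp: image_iff)
  qed
qed

text \<open>The vector \<open>v\<close> is tagged with an additional coordinate \<open>1\<close>. It lies in \<open>U\<close> if and only if
  this coordinate does not vanish on the preimage of \<open>U\<close> in the line spanned by the tagged
  vector.\<close>

lemma dpred_mem:
  fixes v :: "'x \<Rightarrow> 'i \<Rightarrow> 'k"
  assumes "dvec v" and "dsub U"
  shows "dpred (\<lambda>p. v p \<in> U p)"
proof -
  let ?t = "\<lambda>p. case_sum (v p) (\<lambda>_. 1) :: 'i + unit \<Rightarrow> 'k"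
  have t: "dvec ?t"
  proof -
    obtain C where "finite C" "\<forall>p\<in>X. \<forall>i. i \<notin> C \<longrightarrow> v p i = 0"
      using assms(1) unfolding dvec_def by blast
    moreover have "(\<lambda>p. ?t p i) \<in> D" for i
      using dvec_component[OF assms(1)] const[of 1] by (cases i) simp_all
    ultimately show ?thesis
      by (intro dvecI[of _ "Inl ` C \<union> {Inr ()}"]) (auto split: sum.splits)
  qed
  \<comment> \<open>The tag keeps the line nonzero even where \<open>v p\<close> vanishes, so this
    preimage is the whole line or zero according to whether \<open>v p\<close> lies in
    \<open>U p\<close>.\<close>
  let ?L = "\<lambda>p. {h \<in> fvs.span {?t p}. (\<lambda>i. h (Inl i)) \<in> U p}"
  have L: "dsub ?L"
    using t by (intro dsub_preimage dmap_Inl assms dsubI[of "{?t}"]) auto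
  then obtain G where G: "finite G" "\<And>h. h \<in> G \<Longrightarrow> dvec h"
      "\<And>p. p \<in> X \<Longrightarrow> ?L p = fvs.span ((\<lambda>h. h p) ` G)"
    by (rule dsubE) auto
  have "dpred (\<lambda>p. \<exists>h\<in>G. \<not> h p (Inr ()) = 0)"
    using G by (intro dpred_bex dpred_not dpred_zero dvec_component)
  then show ?thesis
  proof (rule dpred_cong)
    fix p
    assume p: "p \<in> X"
    show "(\<exists>h\<in>G. \<not> h p (Inr ()) = 0) \<longleftrightarrow> v p \<in> U p"
    proof
      assume "\<exists>h\<in>G. \<not> h p (Inr ()) = 0"
      then obtain h where h: "h \<in> G" "h p (Inr ()) \<noteq> 0"
        by blast
      then have "h p \<in> ?L p"
        using G(3)[OF p] by (auto intro: fvs.span_base)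
      then obtain c where c: "h p = fscale c (?t p)" "(\<lambda>i. h p (Inl i)) \<in> U p"
        unfolding fvs.span_singleton by (simp only: mem_Collect_eq image_iff) metis
      have "c \<noteq> 0"
        using h(2) unfolding c(1) by simp
      then have "v p = fscale (inverse c) (\<lambda>i. h p (Inl i))"
        unfolding c(1) by (simp add: fun_eq_iff)
      then show "v p \<in> U p"
        using fvs.subspace_scale[OF dsub_subspace[OF assms(2) p] c(2)] by metis
    next
      assume "v p \<in> U p"
      then have "?t p \<in> ?L p"
        by (simp add: fvs.span_base)
      then have mem: "?t p \<in> fvs.span ((\<lambda>h. h p) ` G)"
        unfolding G(3)[OF p] .
      show "\<exists>h\<in>G. \<not> h p (Inr ()) = 0"
      proof (rule ccontr)
        assume "\<not> (\<exists>h\<in>G. \<not> h p (Inr ()) = 0)"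
        then have "(\<lambda>h. h p) ` G \<subseteq> {h. h (Inr ()) = 0}"
          by auto
        moreover have "fvs.subspace {h :: 'i + unit \<Rightarrow> 'k. h (Inr ()) = 0}"
          by (rule fvs.subspaceI) auto
        ultimately have "fvs.span ((\<lambda>h. h p) ` G) \<subseteq> {h. h (Inr ()) = 0}"
          by (rule fvs.span_minimal)
        then show False
          using mem by auto
      qed
    qed
  qed
qed

lemma dpred_subset:
  assumes "dsub U" and "dsub V"
  shows "dpred (\<lambda>p. U p \<subseteq> V p)"
proof -
  obtain G where G: "finite G" "\<And>v. v \<in> G \<Longrightarrow> dvec v" "\<And>p. p \<in> X \<Longrightarrow> U p = fvs.span ((\<lambda>v. v p) ` G)"
    using assms(1) by (rule dsubE) auto
  have "dpred (\<lambda>p. \<forall>v\<in>G. v p \<in> V p)"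
    using G(1,2) assms(2) by (intro dpred_ball dpred_mem)
  then show ?thesis
  proof (rule dpred_cong)
    fix p
    assume p: "p \<in> X"
    show "(\<forall>v\<in>G. v p \<in> V p) \<longleftrightarrow> U p \<subseteq> V p"
      using fvs.span_minimal[OF _ dsub_subspace[OF assms(2) p], of "(\<lambda>v. v p) ` G"]
      by (auto simp: G(3)[OF p] intro: fvs.span_base)
  qed
qed

text \<open>The number of generators is the same at every point; this is the origin of the uniform
  bound on the number of iteration steps.\<close>

lemma dsub_span_bound:
  assumes "dsub U"
  obtains n where "\<And>p. p \<in> X \<Longrightarrow> \<exists>T. finite T \<and> card T \<le> n \<and> U p \<subseteq> fvs.span T"
proof -
  obtain G where G: "finite G" "\<And>p. p \<in> X \<Longrightarrow> U p = fvs.span ((\<lambda>v. v p) ` G)"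
    using assms by (rule dsubE) auto
  show ?thesis
  proof
    fix p
    assume "p \<in> X"
    then show "\<exists>T. finite T \<and> card T \<le> card G \<and> U p \<subseteq> fvs.span T"
      using G card_image_le[OF G(1)] by (intro exI[of _ "(\<lambda>v. v p) ` G"]) auto
  qed
qed

end

section \<open>Module records as images of spaces of functions\<close>

lemma field_class_ring: "field (class_ring :: 'k::field ring)"
  by (rule class_field.field_axioms)

text \<open>The elements of \<open>V\<close> may be of any type, for example cosets;
  \<open>s\<close> need not be injective. Different \<open>U\<close> for one index type can thus
  present a space, its subspaces and its quotients alike.\<close>

locale presented =
  fixes V :: "('k::field, 'u) module" and U :: "('i \<Rightarrow> 'k) set" and s :: "('i \<Rightarrow> 'k) \<Rightarrow> 'u"
  assumes subspace_U: "fvs.subspace U"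
    and carrier_eq: "carrier V = s ` U"
    and s_zero: "s 0 = \<zero>\<^bsub>V\<^esub>"
    and s_add: "f \<in> U \<Longrightarrow> g \<in> U \<Longrightarrow> s (f + g) = s f \<oplus>\<^bsub>V\<^esub> s g"
    and s_scale: "f \<in> U \<Longrightarrow> s (fscale c f) = c \<odot>\<^bsub>V\<^esub> s f"
begin

lemma s_carrier: "f \<in> U \<Longrightarrow> s f \<in> carrier V"
  by (simp add: carrier_eq)

text \<open>All axioms are transported from functions along \<open>s\<close>, which reaches every
  element of the carrier.\<close>

lemma vectorspace: "vectorspace class_ring V"
proof (rule vs_criteria[OF field_class_ring])
  have add': "s f \<oplus>\<^bsub>V\<^esub> s g = s (f + g)" and scale': "c \<odot>\<^bsub>V\<^esub> s f = s (fscale c f)"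
    if "f \<in> U" "g \<in> U" for f g c
    using that by (simp_all add: s_add s_scale)
  note U = subspace_U fvs.subspace_add[OF subspace_U] fvs.subspace_scale[OF subspace_U]
    fvs.subspace_0[OF subspace_U] fvs.subspace_neg[OF subspace_U]
  note eqs = carrier_eq add' scale' U
  show "\<zero>\<^bsub>V\<^esub> \<in> carrier V"
    using U s_zero carrier_eq by (metis imageI)
  show "\<forall>v w. v \<in> carrier V \<and> w \<in> carrier V \<longrightarrow> v \<oplus>\<^bsub>V\<^esub> w \<in> carrier V"
    by (auto simp: eqs)
  show "\<forall>v\<in>carrier V. \<exists>w\<in>carrier V. v \<oplus>\<^bsub>V\<^esub> w = \<zero>\<^bsub>V\<^esub>"
  proof
    fix v
    assume "v \<in> carrier V"
    then obtain f where "f \<in> U" "v = s f"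
      by (auto simp: carrier_eq)
    then show "\<exists>w\<in>carrier V. v \<oplus>\<^bsub>V\<^esub> w = \<zero>\<^bsub>V\<^esub>"
      by (intro bexI[of _ "s (- f)"]) (auto simp: eqs s_zero)
  qed
  show "\<forall>c v. c \<in> carrier class_ring \<and> v \<in> carrier V \<longrightarrow> c \<odot>\<^bsub>V\<^esub> v \<in> carrier V"
    by (auto simp: eqs)
  show "\<forall>v w. v \<in> carrier V \<and> w \<in> carrier V \<longrightarrow> v \<oplus>\<^bsub>V\<^esub> w = w \<oplus>\<^bsub>V\<^esub> v"
    by (auto simp: eqs add.commute)
  show "\<forall>v w x. v \<in> carrier V \<and> w \<in> carrier V \<and> x \<in> carrier V \<longrightarrow>
      (v \<oplus>\<^bsub>V\<^esub> w) \<oplus>\<^bsub>V\<^esub> x = v \<oplus>\<^bsub>V\<^esub> (w \<oplus>\<^bsub>V\<^esub> x)"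
    by (auto simp: eqs add.assoc)
  show "\<forall>v\<in>carrier V. v \<oplus>\<^bsub>V\<^esub> \<zero>\<^bsub>V\<^esub> = v"
    by (auto simp: eqs simp flip: s_zero)
  show "\<forall>a b v. a \<in> carrier class_ring \<and> b \<in> carrier class_ring \<and> v \<in> carrier V \<longrightarrow>
      (a \<otimes>\<^bsub>class_ring\<^esub> b) \<odot>\<^bsub>V\<^esub> v = a \<odot>\<^bsub>V\<^esub> (b \<odot>\<^bsub>V\<^esub> v)"
    by (auto simp: eqs)
  show "\<forall>v\<in>carrier V. \<one>\<^bsub>class_ring\<^esub> \<odot>\<^bsub>V\<^esub> v = v"
    by (auto simp: eqs)
  show "\<forall>a b v. a \<in> carrier class_ring \<and> b \<in> carrier class_ring \<and> v \<in> carrier V \<longrightarrow>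
      (a \<oplus>\<^bsub>class_ring\<^esub> b) \<odot>\<^bsub>V\<^esub> v = (a \<odot>\<^bsub>V\<^esub> v) \<oplus>\<^bsub>V\<^esub> (b \<odot>\<^bsub>V\<^esub> v)"
    by (auto simp: eqs fvs.scale_left_distrib)
  show "\<forall>a v w. a \<in> carrier class_ring \<and> v \<in> carrier V \<and> w \<in> carrier V \<longrightarrow>
      a \<odot>\<^bsub>V\<^esub> (v \<oplus>\<^bsub>V\<^esub> w) = (a \<odot>\<^bsub>V\<^esub> v) \<oplus>\<^bsub>V\<^esub> (a \<odot>\<^bsub>V\<^esub> w)"
    by (auto simp: eqs fvs.scale_right_distrib)
qed

interpretation vectorspace class_ring V
  by (rule vectorspace)

lemma s_diff: "f \<in> U \<Longrightarrow> g \<in> U \<Longrightarrow> s f = s g \<longleftrightarrow> s (f - g) = \<zero>\<^bsub>V\<^esub>"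
proof -
  assume fg: "f \<in> U" "g \<in> U"
  then have d: "f - g \<in> U"
    using fvs.subspace_diff[OF subspace_U] by simp
  have "s f = s (f - g) \<oplus>\<^bsub>V\<^esub> s g"
    using s_add[OF d fg(2)] by simp
  then show ?thesis
    using s_carrier[OF d] s_carrier[OF fg(2)]
    by (metis M.add.l_cancel_one M.add.r_cancel_one)
qed

lemma s_sum: "finite A \<Longrightarrow> (\<And>a. a \<in> A \<Longrightarrow> f a \<in> U) \<Longrightarrow> s (\<Sum>a\<in>A. f a) = (\<Oplus>\<^bsub>V\<^esub>a\<in>A. s (f a))"
proof (induction A rule: finite_induct)
  case empty
  then show ?case
    by (simp only: sum.empty s_zero M.finsum_empty)
next
  case (insert a A)
  have "(\<Sum>a\<in>A. f a) \<in> U"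
    using fvs.subspace_sum[OF subspace_U] insert.prems by blast
  then have "s (\<Sum>a\<in>insert a A. f a) = s (f a) \<oplus>\<^bsub>V\<^esub> s (\<Sum>a\<in>A. f a)"
    unfolding sum.insert[OF insert.hyps] by (intro s_add insert.prems) simp_all
  moreover have "(\<Oplus>\<^bsub>V\<^esub>b\<in>insert a A. s (f b)) = s (f a) \<oplus>\<^bsub>V\<^esub> (\<Oplus>\<^bsub>V\<^esub>b\<in>A. s (f b))"
    using insert.hyps insert.prems by (intro M.finsum_insert) (auto simp: s_carrier)
  ultimately show ?case
    using insert.IH insert.prems by simp
qed

section \<open>Subspaces, dimension and quotients of presented spaces\<close>

lemma subspace_image:
  assumes "fvs.subspace U'" and "U' \<subseteq> U"
  shows "VectorSpace.subspace class_ring (s ` U') V"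
proof -
  have "s ` U' \<subseteq> carrier V"
    using assms(2) by (auto simp: carrier_eq)
  moreover have "\<zero>\<^bsub>V\<^esub> \<in> s ` U'"
    using fvs.subspace_0[OF assms(1)] s_zero by (metis imageI)
  moreover have "s f \<oplus>\<^bsub>V\<^esub> s g \<in> s ` U'" "c \<odot>\<^bsub>V\<^esub> s f \<in> s ` U'" if "f \<in> U'" "g \<in> U'" for f g c
    using that assms fvs.subspace_add[OF assms(1)] fvs.subspace_scale[OF assms(1)]
      s_add[of f g] s_scale[of f c]
    by (metis imageI subsetD)+
  ultimately show ?thesis
    unfolding VectorSpace.subspace_def submodule_def
    using vectorspace module_axioms by auto
qed

lemma subspace_preimage:
  assumes "VectorSpace.subspace class_ring W V"
  shows "fvs.subspace {f \<in> U. s f \<in> W}"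
proof -
  have W: "submodule class_ring W V"
    using assms by (simp add: VectorSpace.subspace_def)
  show ?thesis
    using submodule.m_closed[OF W] submodule.smult_closed[OF W] submodule.zero_closed[OF W]
    by (intro fvs.subspaceI)
      (auto simp: s_zero s_add s_scale fvs.subspace_0[OF subspace_U] fvs.subspace_add[OF subspace_U]
        fvs.subspace_scale[OF subspace_U])
qed

lemma image_preimage: "W \<subseteq> carrier V \<Longrightarrow> s ` {f \<in> U. s f \<in> W} = W"
  by (auto simp: carrier_eq)

lemma presented_sub:
  assumes "fvs.subspace U'" and "U' \<subseteq> U"
  shows "presented (V\<lparr>carrier := s ` U'\<rparr>) U' s"
  using assms by unfold_locales (auto simp: s_zero s_add s_scale subsetD)

lemma span_image:
  assumes "A \<subseteq> U"
  shows "span (s ` A) = s ` fvs.span A"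
proof
  have sub: "fvs.span A \<subseteq> U"
    using assms subspace_U by (rule fvs.span_minimal)
  then show "span (s ` A) \<subseteq> s ` fvs.span A"
    using subspace_image[OF fvs.subspace_span sub]
    by (intro span_is_subset) (auto simp: VectorSpace.subspace_def intro: fvs.span_base)
  have A: "s ` A \<subseteq> carrier V"
    using assms by (auto simp: s_carrier)
  have "A \<subseteq> {f \<in> U. s f \<in> span (s ` A)}"
    using assms in_own_span[OF A] by auto
  then have "fvs.span A \<subseteq> {f \<in> U. s f \<in> span (s ` A)}"
    using subspace_preimage[OF span_is_subspace[OF A]] by (rule fvs.span_minimal)
  then show "s ` fvs.span A \<subseteq> span (s ` A)"
    by blast
qed

text \<open>As \<open>N\<close> cuts out the kernel of \<open>s\<close>, the space is
  \<open>U\<close> modulo \<open>N\<close>, and irredundant generators modulo \<open>N\<close>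
  become a basis. Both hypotheses on the generators are statements about spans of functions, hence
  definable. Irredundance also shows that different indices give different basis vectors.\<close>

lemma dim_eq_card:
  fixes v :: "'a \<Rightarrow> 'i \<Rightarrow> 'k"
  assumes "finite S" and N: "fvs.subspace N" "\<And>f. f \<in> U \<Longrightarrow> s f = \<zero>\<^bsub>V\<^esub> \<longleftrightarrow> f \<in> N"
    and S: "v ` S \<subseteq> U" "U \<subseteq> fvs.span (v ` S \<union> N)"
    and indep: "\<And>a. a \<in> S \<Longrightarrow> v a \<notin> fvs.span (v ` (S - {a}) \<union> N)"
  shows "dim = card S"
proof -
  \<comment> \<open>Membership in a span inside \<open>V\<close> is pulled back to membership in a
    span of functions, at the price of adding the kernel.\<close>
  have mem: "s f \<in> span (s ` A) \<longleftrightarrow> f \<in> fvs.span (A \<union> N)" if "A \<subseteq> U" "f \<in> U" for A f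
  proof -
    have AU: "fvs.span A \<subseteq> U"
      using that(1) subspace_U by (rule fvs.span_minimal)
    have "s f = s g \<longleftrightarrow> f - g \<in> N" if "g \<in> U" for g
      using s_diff[OF \<open>f \<in> U\<close> that] N(2) fvs.subspace_diff[OF subspace_U \<open>f \<in> U\<close> that] by simp
    then have "s f \<in> span (s ` A) \<longleftrightarrow> (\<exists>g\<in>fvs.span A. f - g \<in> N)"
      using AU unfolding span_image[OF that(1)] by (auto simp: image_iff)
    also have "\<dots> \<longleftrightarrow> f \<in> fvs.span (A \<union> N)"
    proof
      assume "\<exists>g\<in>fvs.span A. f - g \<in> N"
      then obtain g where g: "g \<in> fvs.span A" "f - g \<in> N"
        by blast
      then have "g + (f - g) \<in> {x + y | x y. x \<in> fvs.span A \<and> y \<in> fvs.span N}"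
        using fvs.span_base by blast
      then show "f \<in> fvs.span (A \<union> N)"
        by (simp add: fvs.span_Un)
    next
      assume "f \<in> fvs.span (A \<union> N)"
      then obtain x y where "f = x + y" "x \<in> fvs.span A" "y \<in> N"
        using N(1) by (auto simp: fvs.span_Un fvs.span_eq_iff[THEN iffD2])
      then show "\<exists>g\<in>fvs.span A. f - g \<in> N"
        by (intro bexI[of _ x]) simp_all
    qed
    finally show ?thesis .
  qed
  have vU: "v a \<in> U" if "a \<in> S" for a
    using S(1) that by blast
  let ?B = "(\<lambda>a. s (v a)) ` S"
  have B: "?B \<subseteq> carrier V"
    using vU by (auto simp: s_carrier)
  have notin: "s (v a) \<notin> span ((\<lambda>a. s (v a)) ` (S - {a}))" if "a \<in> S" for a
    using mem[of "v ` (S - {a})" "v a"] indep[OF that] vU that by (auto simp: image_image)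
  have inj: "inj_on (\<lambda>a. s (v a)) S"
  proof (rule inj_onI, rule ccontr)
    fix a b
    assume ab: "a \<in> S" "b \<in> S" "s (v a) = s (v b)" "a \<noteq> b"
    have sub: "(\<lambda>a. s (v a)) ` (S - {a}) \<subseteq> carrier V"
      using B by blast
    have "s (v b) \<in> (\<lambda>a. s (v a)) ` (S - {a})"
      using ab by blast
    then show False
      using in_own_span[OF sub] notin[OF ab(1)] ab(3) by auto
  qed
  have "lin_indpt T" if "T \<subseteq> ?B" for T
    using finite_subset[OF that finite_imageI[OF assms(1)]] that
  proof (induction T rule: finite_induct)
    case empty
    then show ?case
      by (simp add: lin_dep_def)
  next
    case (insert b T)
    then obtain a where a: "a \<in> S" "b = s (v a)"
      by blast
    have "T \<subseteq> (\<lambda>a. s (v a)) ` (S - {a})"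
      using insert.prems insert.hyps(2) a by blast
    then have "b \<notin> span T"
      using notin[OF a(1)] a(2) span_is_monotone by blast
    moreover have "T \<subseteq> carrier V" "b \<in> carrier V"
      using insert.prems B by auto
    ultimately show ?case
      using lin_dep_iff_in_span[of T b] insert by auto
  qed
  moreover have "span ?B = carrier V"
  proof -
    have "s f \<in> span (s ` v ` S)" if "f \<in> U" for f
      using mem[OF S(1) that] S(2) that by blast
    then show ?thesis
      using span_is_subset2[OF B] by (auto simp: carrier_eq image_image)
  qed
  ultimately have "basis ?B"
    using B by (auto simp: basis_def)
  then have "dim = card ?B"
    using assms(1) by (intro dim_basis) auto
  then show ?thesis
    using inj by (simp add: card_image)
qed

text \<open>The quotient is presented by the same \<open>U\<close>; the coset map is composed with
  \<open>s\<close>, and only the kernel grows.\<close>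

lemma presented_quotient:
  assumes "fvs.subspace N" and "N \<subseteq> U"
  shows "presented (quotient_space V (s ` N)) U (\<lambda>f. s ` N +>\<^bsub>V\<^esub> s f)"
    and "f \<in> U \<Longrightarrow> s ` N +>\<^bsub>V\<^esub> s f = \<zero>\<^bsub>quotient_space V (s ` N)\<^esub> \<longleftrightarrow> s f \<in> s ` N"
proof -
  have sub: "submodule class_ring (s ` N) V"
    using subspace_image[OF assms] by (simp add: VectorSpace.subspace_def)
  interpret N: abelian_subgroup "s ` N" V
  proof (rule abelian_subgroupI3)
    show "additive_subgroup (s ` N) V"
    proof (rule additive_subgroupI, rule group.subgroupI)
      show "group (add_monoid V)"
        by (rule M.a_group)
      show "s ` N \<subseteq> carrier (add_monoid V)"
        using submodule.subset[OF sub] by simp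
      show "s ` N \<noteq> {}"
        using submodule.zero_closed[OF sub] by blast
      show "inv\<^bsub>add_monoid V\<^esub> x \<in> s ` N" if x: "x \<in> s ` N" for x
      proof -
        have "x \<in> carrier V"
          using submodule.subset[OF sub] x by (rule subsetD)
        then have minus: "(\<ominus>\<^bsub>class_ring\<^esub> \<one>\<^bsub>class_ring\<^esub>) \<odot>\<^bsub>V\<^esub> x = \<ominus>\<^bsub>V\<^esub> x"
          by (rule smult_minus_1)
        have "(\<ominus>\<^bsub>class_ring\<^esub> \<one>\<^bsub>class_ring\<^esub>) \<odot>\<^bsub>V\<^esub> x \<in> s ` N"
          by (rule submodule.smult_closed[OF sub _ x]) simp
        then have "\<ominus>\<^bsub>V\<^esub> x \<in> s ` N"
          unfolding minus .
        then show ?thesis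
          unfolding a_inv_def .
      qed
      show "x \<otimes>\<^bsub>add_monoid V\<^esub> y \<in> s ` N" if "x \<in> s ` N" "y \<in> s ` N" for x y
        using submodule.m_closed[OF sub that] by simp
    qed
  qed (rule M.abelian_group_axioms)
  let ?c = "\<lambda>f. s ` N +>\<^bsub>V\<^esub> s f"
  have zero: "?c f = s ` N \<longleftrightarrow> s f \<in> s ` N" if "f \<in> U" for f
    using N.a_rcos_const[of "s f"] N.a_rcos_self[OF s_carrier[OF that]] by metis
  then show "f \<in> U \<Longrightarrow> s ` N +>\<^bsub>V\<^esub> s f = \<zero>\<^bsub>quotient_space V (s ` N)\<^esub> \<longleftrightarrow> s f \<in> s ` N"
    by (simp add: quotient_space_def)
  show "presented (quotient_space V (s ` N)) U ?c"
  proof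
    show "fvs.subspace U"
      by (rule subspace_U)
    show "carrier (quotient_space V (s ` N)) = ?c ` U"
      by (auto simp: quotient_space_def A_RCOSETS_def' carrier_eq)
    show "?c 0 = \<zero>\<^bsub>quotient_space V (s ` N)\<^esub>"
      using zero[OF fvs.subspace_0[OF subspace_U]] fvs.subspace_0[OF assms(1)]
      by (simp add: quotient_space_def)
    show "?c (f + g) = ?c f \<oplus>\<^bsub>quotient_space V (s ` N)\<^esub> ?c g" if "f \<in> U" "g \<in> U" for f g
      using that by (simp add: quotient_space_def s_add N.a_rcos_sum s_carrier)
    fix f c
    assume f: "f \<in> U"
    \<comment> \<open>All members of one coset lead to the same coset after scaling, so the union in
      \<open>quotient_space\<close> is a union of equal sets.\<close>
    have "s ` N +>\<^bsub>V\<^esub> (c \<odot>\<^bsub>V\<^esub> v) = s ` N +>\<^bsub>V\<^esub> (c \<odot>\<^bsub>V\<^esub> s f)" if v: "v \<in> ?c f" for v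
    proof -
      obtain n where n: "n \<in> s ` N" "v = n \<oplus>\<^bsub>V\<^esub> s f"
        using v by (auto simp: a_r_coset_def')
      then have nV: "n \<in> carrier V"
        using submodule.subset[OF sub] by blast
      have "c \<odot>\<^bsub>V\<^esub> v = c \<odot>\<^bsub>V\<^esub> n \<oplus>\<^bsub>V\<^esub> c \<odot>\<^bsub>V\<^esub> s f"
        using nV s_carrier[OF f] by (simp add: n(2) smult_r_distr)
      moreover have "c \<odot>\<^bsub>V\<^esub> n \<in> s ` N"
        by (rule submodule.smult_closed[OF sub _ n(1)]) simp
      ultimately have "c \<odot>\<^bsub>V\<^esub> v \<in> s ` N +>\<^bsub>V\<^esub> (c \<odot>\<^bsub>V\<^esub> s f)"
        unfolding a_r_coset_def' by (intro UN_I[of "c \<odot>\<^bsub>V\<^esub> n"]) simp_all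
      then show ?thesis
        using N.a_repr_independence' s_carrier[OF f] by simp
    qed
    moreover have "s f \<in> ?c f"
      by (rule N.a_rcos_self[OF s_carrier[OF f]])
    ultimately have "(\<Union>v\<in>?c f. s ` N +>\<^bsub>V\<^esub> (c \<odot>\<^bsub>V\<^esub> v)) = s ` N +>\<^bsub>V\<^esub> (c \<odot>\<^bsub>V\<^esub> s f)"
      by blast
    then show "?c (fscale c f) = c \<odot>\<^bsub>quotient_space V (s ` N)\<^esub> ?c f"
      by (simp add: quotient_space_def s_scale[OF f])
  qed
qed

end

text \<open>A minimal subset among those generating the space modulo \<open>N\<close> has no redundant member.\<close>

lemma irredundant_generators_exist:
  fixes v :: "'a \<Rightarrow> 'i \<Rightarrow> 'k::field"
  assumes "finite G"
  obtains S where "S \<subseteq> G" "\<And>a. a \<in> G \<Longrightarrow> v a \<in> fvs.span (v ` S \<union> N)"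
    "\<And>a. a \<in> S \<Longrightarrow> v a \<notin> fvs.span (v ` (S - {a}) \<union> N)"
proof -
  define P where "P = (\<lambda>S. S \<subseteq> G \<and> v ` G \<subseteq> fvs.span (v ` S \<union> N))"
  have PG: "P G"
    by (auto simp: P_def intro: fvs.span_base)
  define S where "S = arg_min card P"
  have PS: "P S" and least: "\<And>S'. P S' \<Longrightarrow> card S \<le> card S'"
    unfolding S_def using arg_min_nat_lemma[of P G card, OF PG] by blast+
  have S: "S \<subseteq> G" "v ` G \<subseteq> fvs.span (v ` S \<union> N)"
    using PS by (simp_all add: P_def)
  have "v a \<notin> fvs.span (v ` (S - {a}) \<union> N)" if a: "a \<in> S" for a
  proof
    assume mem: "v a \<in> fvs.span (v ` (S - {a}) \<union> N)"
    have "x \<in> fvs.span (v ` (S - {a}) \<union> N)" if "x \<in> v ` S \<union> N" for x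
    proof (cases "x = v a")
      case False
      then show ?thesis
        using that by (intro fvs.span_base) auto
    qed (use mem in simp)
    then have "fvs.span (v ` S \<union> N) \<subseteq> fvs.span (v ` (S - {a}) \<union> N)"
      by (intro fvs.span_minimal subsetI fvs.subspace_span)
    then have "P (S - {a})"
      using S unfolding P_def by (intro conjI order.trans[OF S(2)]) auto
    moreover have "finite S"
      using S(1) assms by (rule finite_subset)
    ultimately show False
      using least[of "S - {a}"] card_Diff1_less[of S a] a by simp
  qed
  with S show ?thesis
    by (intro that[of S]) (simp_all add: image_subset_iff)
qed

section \<open>Chains of subspaces\<close>

text \<open>As a simplification rule it would also rewrite the eta-expanded \<open>fscale\<close> inside \<open>fvs.span\<close>
  and \<open>fvs.subspace\<close>.\<close>

declare fscale_apply [simp del]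

text \<open>The ambient function space may have infinite dimension; the finite spanning set
  \<open>T\<close> makes the bases of \<open>A\<close> and \<open>B\<close> finite, so that a basis
  of \<open>A\<close> enlarged by one vector and then extended to \<open>B\<close> can be
  counted.\<close>

lemma fun_dim_less:
  fixes A B :: "('i \<Rightarrow> 'k::field) set"
  assumes "fvs.subspace A" and "A \<subset> B" and "finite T" and "B \<subseteq> fvs.span T"
  shows "fvs.dim A < fvs.dim B"
proof -
  obtain C where C: "C \<subseteq> A" "fvs.independent C" "A \<subseteq> fvs.span C" "card C = fvs.dim A"
    by (rule fvs.basis_exists)
  obtain v where v: "v \<in> B" "v \<notin> A"
    using assms(2) by blast
  have "v \<notin> fvs.span C"
    using fvs.span_minimal[OF C(1) assms(1)] v(2) by blast
  then have "fvs.independent (insert v C)" "v \<notin> C"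
    using C(2) by (auto simp: fvs.independent_insert intro: fvs.span_base)
  moreover have "insert v C \<subseteq> B"
    using v C(1) assms(2) by blast
  ultimately obtain D where D: "insert v C \<subseteq> D" "D \<subseteq> B" "fvs.independent D" "B \<subseteq> fvs.span D"
    by (metis fvs.maximal_independent_subset_extend)
  have "D \<subseteq> fvs.span T"
    using D(2) assms(4) by (rule order.trans)
  then have "finite D"
    using fvs.independent_span_bound[OF assms(3) D(3)] by blast
  then have "card (insert v C) \<le> card D" "finite C"
    using D(1) by (auto intro: card_mono finite_subset)
  moreover have "card D = fvs.dim B"
    using D by (intro fvs.basis_card_eq_dim)
  ultimately show ?thesis
    using C(4) \<open>v \<notin> C\<close> by simp
qed

lemma fun_dim_mono:
  fixes A B :: "('i \<Rightarrow> 'k::field) set"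
  assumes "fvs.subspace A" and "A \<subseteq> B" and "finite T" and "B \<subseteq> fvs.span T"
  shows "fvs.dim A \<le> fvs.dim B"
  using fun_dim_less[OF assms(1) _ assms(3,4)] assms(2) by (cases "A = B") (auto simp: less_imp_le)

text \<open>Failure at all indices up to \<open>M\<close> would push the measure to at least
  \<open>M + 1\<close>. Since \<open>P\<close> persists once it holds, it holds at the fixed index
  \<open>M\<close> and not only at some index that varies with the sequence.\<close>

lemma bounded_progress_stops:
  fixes \<mu> :: "nat \<Rightarrow> nat"
  assumes "\<And>k. \<not> P k \<Longrightarrow> \<mu> k < \<mu> (Suc k)" and "\<And>k. \<mu> k \<le> M" and "\<And>k. P k \<Longrightarrow> P (Suc k)"
  shows "P M"
proof (rule ccontr)
  assume "\<not> P M"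
  have "P l" if "k \<le> l" "P k" for k l
    using that by (induction rule: dec_induct) (simp_all add: assms(3))
  then have not: "\<not> P k" if "k \<le> M" for k
    using that \<open>\<not> P M\<close> by metis
  have "k \<le> \<mu> k" if "k \<le> Suc M" for k
    using that
  proof (induction k)
    case (Suc k)
    then show ?case
      using assms(1)[OF not, of k] by simp
  qed simp
  from this[of "Suc M"] show False
    using assms(2)[of "Suc M"] by simp
qed

context
  fixes W :: "nat \<Rightarrow> 'v \<Rightarrow> ('i \<Rightarrow> 'k::field) set" and X :: "'v set" and n :: nat
  assumes finite_X: "finite X"
    and subspaces: "\<And>k x. x \<in> X \<Longrightarrow> fvs.subspace (W k x)"
    and bound: "\<And>k x. x \<in> X \<Longrightarrow> \<exists>T. finite T \<and> card T \<le> n \<and> W k x \<subseteq> fvs.span T"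
    and stable: "\<And>k. (\<And>x. x \<in> X \<Longrightarrow> W (Suc k) x = W k x) \<Longrightarrow> (\<And>x. x \<in> X \<Longrightarrow> W (Suc (Suc k)) x = W (Suc k) x)"
begin

lemma sum_dim_le: "(\<Sum>x\<in>X. fvs.dim (W k x)) \<le> card X * n"
proof -
  have "fvs.dim (W k x) \<le> n" if "x \<in> X" for x
    using bound[OF that, of k] fvs.dim_le_card by (meson order.trans)
  then show ?thesis
    using sum_bounded_above[of X "\<lambda>x. fvs.dim (W k x)" n] by simp
qed

lemma sum_dim_less:
  assumes le: "\<And>x. x \<in> X \<Longrightarrow> W k x \<subseteq> W l x" and "y \<in> X" "W k y \<noteq> W l y"
  shows "(\<Sum>x\<in>X. fvs.dim (W k x)) < (\<Sum>x\<in>X. fvs.dim (W l x))"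
proof (rule sum_strict_mono_ex1[OF finite_X])
  show "\<forall>x\<in>X. fvs.dim (W k x) \<le> fvs.dim (W l x)"
    using fun_dim_mono[OF subspaces le] bound by blast
  have "W k y \<subset> W l y"
    using assms by blast
  then show "\<exists>x\<in>X. fvs.dim (W k x) < fvs.dim (W l x)"
    using fun_dim_less[OF subspaces[OF assms(2)]] bound[OF assms(2), of l] assms(2) by blast
qed

text \<open>The sum of the dimensions over all vertices is at most \<open>card X * n\<close> and
  grows until the whole family repeats. The stopping index therefore depends only on the number of
  vertices and the dimension bound.\<close>

lemma increasing_chain_stops:
  assumes "\<And>k x. x \<in> X \<Longrightarrow> W k x \<subseteq> W (Suc k) x" and "x \<in> X"
  shows "W (Suc (card X * n)) x = W (card X * n) x"
proof -
  have "\<forall>x\<in>X. W (Suc (card X * n)) x = W (card X * n) x"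
  proof (rule bounded_progress_stops[where P = "\<lambda>k. \<forall>x\<in>X. W (Suc k) x = W k x"])
    show "\<not> (\<forall>x\<in>X. W (Suc k) x = W k x) \<Longrightarrow>
        (\<Sum>x\<in>X. fvs.dim (W k x)) < (\<Sum>x\<in>X. fvs.dim (W (Suc k) x))" for k
      using sum_dim_less[of k "Suc k"] assms(1) by metis
    show "\<forall>x\<in>X. W (Suc (Suc k)) x = W (Suc k) x" if "\<forall>x\<in>X. W (Suc k) x = W k x" for k
      using stable[of k] that by blast
  qed (rule sum_dim_le)
  then show ?thesis
    using assms(2) by blast
qed

lemma decreasing_chain_stops:
  assumes "\<And>k x. x \<in> X \<Longrightarrow> W (Suc k) x \<subseteq> W k x" and "x \<in> X"
  shows "W (Suc (card X * n)) x = W (card X * n) x"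
proof -
  have "\<forall>x\<in>X. W (Suc (card X * n)) x = W (card X * n) x"
  proof (rule bounded_progress_stops[where P = "\<lambda>k. \<forall>x\<in>X. W (Suc k) x = W k x"])
    fix k
    assume "\<not> (\<forall>x\<in>X. W (Suc k) x = W k x)"
    then have "(\<Sum>x\<in>X. fvs.dim (W (Suc k) x)) < (\<Sum>x\<in>X. fvs.dim (W k x))"
      using sum_dim_less[of "Suc k" k] assms(1) by metis
    \<comment> \<open>The measure is the distance to the upper bound. The truncated difference
      decreases properly in its second argument here because the sum at \<open>k\<close> does not
      exceed the bound.\<close>
    then show "card X * n - (\<Sum>x\<in>X. fvs.dim (W k x)) < card X * n - (\<Sum>x\<in>X. fvs.dim (W (Suc k) x))"
      using sum_dim_le[of k] by linarith
  next
    show "\<forall>x\<in>X. W (Suc (Suc k)) x = W (Suc k) x" if "\<forall>x\<in>X. W (Suc k) x = W k x" for k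
      using stable[of k] that by blast
  qed (rule diff_le_self)
  then show ?thesis
    using assms(2) by blast
qed

end

section \<open>The global rank through iterated images and preimages\<close>

text \<open>The largest subrepresentation with surjective maps is the limit of the decreasing iterates
  of \<open>shrink\<close>, and the kernel of the largest quotient with injective maps is the limit of the
  increasing iterates of \<open>grow\<close>. Here \<open>U x\<close> presents the space at \<open>x\<close>, the kernel of the
  presentation is \<open>R x\<close>, and \<open>F a\<close> lifts the map over \<open>a\<close>.\<close>

definition shrink ::
  "('v, 'e) pre_digraph \<Rightarrow> ('e \<Rightarrow> ('i \<Rightarrow> 'k::field) \<Rightarrow> 'i \<Rightarrow> 'k) \<Rightarrow> ('v \<Rightarrow> ('i \<Rightarrow> 'k) set) \<Rightarrow>
   ('v \<Rightarrow> ('i \<Rightarrow> 'k) set) \<Rightarrow> 'v \<Rightarrow> ('i \<Rightarrow> 'k) set" where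
  "shrink Q F R W x =
     {f \<in> W x. (\<forall>a\<in>{a \<in> arcs Q. tail Q a = x}. F a f \<in> W (head Q a)) \<and>
       (\<forall>a\<in>{a \<in> arcs Q. head Q a = x}. f \<in> {g + h | g h. g \<in> F a ` W (tail Q a) \<and> h \<in> R x})}"

definition grow ::
  "('v, 'e) pre_digraph \<Rightarrow> ('e \<Rightarrow> ('i \<Rightarrow> 'k::field) \<Rightarrow> 'i \<Rightarrow> 'k) \<Rightarrow> ('v \<Rightarrow> ('i \<Rightarrow> 'k) set) \<Rightarrow>
   ('v \<Rightarrow> ('i \<Rightarrow> 'k) set) \<Rightarrow> 'v \<Rightarrow> ('i \<Rightarrow> 'k) set" where
  "grow Q F U N x =
     {h + h' | h h'. h \<in> {f + g | f g. f \<in> N x \<and>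
         g \<in> fvs.span (\<Union>a\<in>{a \<in> arcs Q. head Q a = x}. F a ` N (tail Q a))} \<and>
       h' \<in> fvs.span (\<Union>a\<in>{a \<in> arcs Q. tail Q a = x}. {f \<in> U x. F a f \<in> N (head Q a)})}"

lemma grow_eq_span:
  assumes "fvs.subspace (N x)"
  shows "grow Q F U N x =
    fvs.span (N x \<union> (\<Union>a\<in>{a \<in> arcs Q. head Q a = x}. F a ` N (tail Q a)) \<union>
      (\<Union>a\<in>{a \<in> arcs Q. tail Q a = x}. {f \<in> U x. F a f \<in> N (head Q a)}))"
proof -
  have "fvs.span (N x) = N x"
    using assms by simp
  then show ?thesis
    by (simp only: grow_def fvs.span_Un)
qed

locale presented_rep = fin_digraph Q
  for Q :: "('v, 'e) pre_digraph" +
  fixes \<rho> :: "('v, 'e, 'k::field, 'u) rep"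
    and U :: "'v \<Rightarrow> ('i \<Rightarrow> 'k) set" and s :: "'v \<Rightarrow> ('i \<Rightarrow> 'k) \<Rightarrow> 'u"
    and F :: "'e \<Rightarrow> ('i \<Rightarrow> 'k) \<Rightarrow> 'i \<Rightarrow> 'k"
  assumes presented: "x \<in> verts Q \<Longrightarrow> presented (space \<rho> x) (U x) (s x)"
    and F_linear: "a \<in> arcs Q \<Longrightarrow> fun_linear (F a)"
    and F_U: "a \<in> arcs Q \<Longrightarrow> f \<in> U (tail Q a) \<Longrightarrow> F a f \<in> U (head Q a)"
    and maps_s: "a \<in> arcs Q \<Longrightarrow> f \<in> U (tail Q a) \<Longrightarrow>
      maps \<rho> a (s (tail Q a) f) = s (head Q a) (F a f)"
begin

definition R :: "'v \<Rightarrow> ('i \<Rightarrow> 'k) set" where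
  "R x = {f \<in> U x. s x f = \<zero>\<^bsub>space \<rho> x\<^esub>}"

lemma subspace_U: "x \<in> verts Q \<Longrightarrow> fvs.subspace (U x)"
  using presented presented.subspace_U by blast

lemma R_subset: "R x \<subseteq> U x"
  by (auto simp: R_def)

lemma s_eq_iff: "x \<in> verts Q \<Longrightarrow> f \<in> U x \<Longrightarrow> g \<in> U x \<Longrightarrow> s x f = s x g \<longleftrightarrow> f - g \<in> R x"
  using presented.s_diff[OF presented] fvs.subspace_diff[OF subspace_U, of x f g]
  by (simp add: R_def)

lemma subspace_R:
  assumes "x \<in> verts Q"
  shows "fvs.subspace (R x)"
proof -
  interpret presented "space \<rho> x" "U x" "s x"
    by (rule presented[OF assms])
  interpret V: vectorspace class_ring "space \<rho> x"
    by (rule vectorspace)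
  show ?thesis
    unfolding R_def
    by (rule fvs.subspaceI)
      (auto simp: s_zero s_add s_scale fvs.subspace_0[OF subspace_U] fvs.subspace_add[OF subspace_U]
        fvs.subspace_scale[OF subspace_U])
qed

lemma F_0: "a \<in> arcs Q \<Longrightarrow> F a 0 = 0"
  by (rule fvp.linear_0[OF F_linear])

lemma F_add: "a \<in> arcs Q \<Longrightarrow> F a (f + g) = F a f + F a g"
  by (rule fvp.linear_add[OF F_linear])

lemma F_diff: "a \<in> arcs Q \<Longrightarrow> F a (f - g) = F a f - F a g"
  by (rule fvp.linear_diff[OF F_linear])

text \<open>The functions \<open>f\<close> and 0 present the same vector at the tail, so
  \<open>F a f\<close> and \<open>F a 0 = 0\<close> present the same vector at the head.\<close>

lemma F_R:
  assumes "a \<in> arcs Q" and "f \<in> R (tail Q a)"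
  shows "F a f \<in> R (head Q a)"
proof -
  have t: "tail Q a \<in> verts Q" and h: "head Q a \<in> verts Q"
    using assms(1) by simp_all
  have f: "f \<in> U (tail Q a)" "s (tail Q a) f = s (tail Q a) 0"
    using assms(2) presented.s_zero[OF presented[OF t]] by (simp_all add: R_def)
  have "s (head Q a) (F a f) = s (head Q a) (F a 0)"
    using maps_s[OF assms(1) f(1)] maps_s[OF assms(1) fvs.subspace_0[OF subspace_U[OF t]]] f(2) by simp
  then show ?thesis
    using presented.s_zero[OF presented[OF h]] F_U[OF assms(1) f(1)] F_0[OF assms(1)]
    by (simp add: R_def)
qed

text \<open>A subspace containing the kernel \<open>R x\<close> is a union of fibres of
  \<open>s x\<close>, so it can be recovered from its image.\<close>

lemma mem_image_iff:
  assumes "x \<in> verts Q" and "fvs.subspace W" and "R x \<subseteq> W" "W \<subseteq> U x" and "f \<in> U x"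
  shows "s x f \<in> s x ` W \<longleftrightarrow> f \<in> W"
proof
  assume "s x f \<in> s x ` W"
  then obtain g where g: "g \<in> W" "s x f = s x g"
    by blast
  then have "f - g \<in> W"
    using s_eq_iff[OF assms(1,5), of g] assms(3,4) by blast
  then show "f \<in> W"
    using fvs.subspace_add[OF assms(2) _ g(1), of "f - g"] by simp
qed blast

abbreviation E :: "nat \<Rightarrow> 'v \<Rightarrow> ('i \<Rightarrow> 'k) set" where
  "E k \<equiv> (shrink Q F R ^^ k) U"

abbreviation N :: "nat \<Rightarrow> 'v \<Rightarrow> ('i \<Rightarrow> 'k) set" where
  "N k \<equiv> (grow Q F U ^^ k) R"

text \<open>The kernel stays inside every iterate because \<open>shrink\<close> adds
  \<open>R x\<close> to each image and the maps \<open>F a\<close> carry kernel to kernel. So the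
  iterates correspond to subspaces of the presented spaces.\<close>

lemma E_invariant:
  "x \<in> verts Q \<Longrightarrow> fvs.subspace (E k x) \<and> R x \<subseteq> E k x \<and> E k x \<subseteq> U x"
proof (induction k arbitrary: x)
  case 0
  then show ?case
    using subspace_U R_subset by simp
next
  case (Suc k)
  have IH: "fvs.subspace (E k y)" "R y \<subseteq> E k y" "E k y \<subseteq> U y" if "y \<in> verts Q" for y
    using Suc.IH[OF that] by blast+
  note x = Suc.prems
  let ?S = "\<lambda>a. {g + h | g h. g \<in> F a ` E k (tail Q a) \<and> h \<in> R x}"
  have eq: "E (Suc k) x = E k x \<inter> (\<Inter>a\<in>{a \<in> arcs Q. tail Q a = x}. {f. F a f \<in> E k (head Q a)}) \<inter>
      (\<Inter>a\<in>{a \<in> arcs Q. head Q a = x}. ?S a)"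
    by (simp add: shrink_def Int_def)
  have "fvs.subspace (?S a)" if "a \<in> arcs Q" for a
    by (intro fvs.subspace_sums fvp.linear_subspace_image[OF F_linear] IH(1) subspace_R x that tail_in_verts)
  moreover have "fvs.subspace {f. F a f \<in> E k (head Q a)}" if "a \<in> arcs Q" for a
    by (intro fvp.linear_subspace_linear_preimage[OF F_linear] IH(1) that head_in_verts)
  ultimately have "fvs.subspace (E (Suc k) x)"
    unfolding eq by (intro fvs.subspace_inter fvs.subspace_Int IH(1)[OF x]) simp_all
  moreover have "R x \<subseteq> E (Suc k) x"
  proof
    fix h
    assume h: "h \<in> R x"
    have "h \<in> ?S a" if "a \<in> arcs Q" for a
    proof -
      have "0 \<in> E k (tail Q a)"
        using that by (intro fvs.subspace_0 IH(1) tail_in_verts)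
      then have "F a 0 \<in> F a ` E k (tail Q a)"
        by (rule imageI)
      then have "F a 0 + h \<in> ?S a"
        using h by blast
      then show ?thesis
        by (simp only: F_0[OF that] add_0)
    qed
    moreover have "F a h \<in> E k (head Q a)" if "a \<in> arcs Q" "tail Q a = x" for a
      using F_R[OF that(1)] h that(2) IH(2)[OF head_in_verts[OF that(1)]] by blast
    moreover have "h \<in> E k x"
      using h IH(2)[OF x] by blast
    ultimately show "h \<in> E (Suc k) x"
      unfolding eq by (intro IntI INT_I CollectI) simp_all
  qed
  moreover have "E (Suc k) x \<subseteq> U x"
    unfolding eq using IH(3)[OF x] by (intro Int_lower1[THEN order.trans])
  ultimately show ?case
    by blast
qed

lemma E_subspace: "x \<in> verts Q \<Longrightarrow> fvs.subspace (E k x)"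
  and E_bounds: "x \<in> verts Q \<Longrightarrow> R x \<subseteq> E k x" "x \<in> verts Q \<Longrightarrow> E k x \<subseteq> U x"
  using E_invariant by blast+

lemma N_invariant:
  "x \<in> verts Q \<Longrightarrow> fvs.subspace (N k x) \<and> R x \<subseteq> N k x \<and> N k x \<subseteq> U x"
proof (induction k arbitrary: x)
  case 0
  then show ?case
    using subspace_R R_subset by simp
next
  case (Suc k)
  have IH: "fvs.subspace (N k y)" "R y \<subseteq> N k y" "N k y \<subseteq> U y" if "y \<in> verts Q" for y
    using Suc.IH[OF that] by blast+
  note x = Suc.prems
  have eq: "N (Suc k) x = fvs.span (N k x \<union> (\<Union>a\<in>{a \<in> arcs Q. head Q a = x}. F a ` N k (tail Q a)) \<union>
      (\<Union>a\<in>{a \<in> arcs Q. tail Q a = x}. {f \<in> U x. F a f \<in> N k (head Q a)}))"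
    by (simp add: grow_eq_span[where N = "N k", OF IH(1)[OF x]])
  have "F a ` N k (tail Q a) \<subseteq> U x" if "a \<in> arcs Q" "head Q a = x" for a
    using IH(3)[OF tail_in_verts[OF that(1)]] F_U[OF that(1)] that(2) by blast
  then have "N (Suc k) x \<subseteq> U x"
    unfolding eq by (intro fvs.span_minimal subspace_U[OF x] Un_least UN_least IH(3)[OF x]) auto
  moreover have "R x \<subseteq> N (Suc k) x"
    unfolding eq using IH(2)[OF x] fvs.span_superset by (meson Un_upper1 order.trans)
  ultimately show ?case
    unfolding eq by simp
qed

lemma N_subspace: "x \<in> verts Q \<Longrightarrow> fvs.subspace (N k x)"
  and N_bounds: "x \<in> verts Q \<Longrightarrow> R x \<subseteq> N k x" "x \<in> verts Q \<Longrightarrow> N k x \<subseteq> U x"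
  using N_invariant by blast+

lemma N_Suc:
  "x \<in> verts Q \<Longrightarrow> N (Suc k) x =
    fvs.span (N k x \<union> (\<Union>a\<in>{a \<in> arcs Q. head Q a = x}. F a ` N k (tail Q a)) \<union>
      (\<Union>a\<in>{a \<in> arcs Q. tail Q a = x}. {f \<in> U x. F a f \<in> N k (head Q a)}))"
  by (simp add: grow_eq_span N_subspace)

section \<open>Comparison with subrepresentations of the presented representation\<close>

lemma subrepresentation_subspace:
  "subrepresentation Q \<rho> W \<Longrightarrow> x \<in> verts Q \<Longrightarrow> VectorSpace.subspace class_ring (W x) (space \<rho> x)"
  by (auto simp: subrepresentation_def)

lemma subrepresentation_carrier:
  "subrepresentation Q \<rho> W \<Longrightarrow> x \<in> verts Q \<Longrightarrow> W x \<subseteq> s x ` U x"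
  using subrepresentation_subspace presented.carrier_eq[OF presented]
  by (metis VectorSpace.subspace_def submodule.subset)

lemma subrepresentation_eqI:
  assumes "subrepresentation Q \<rho> W"
  shows "W = (\<lambda>x\<in>verts Q. s x ` {f \<in> U x. s x f \<in> W x})"
proof
  fix x
  show "W x = (\<lambda>x\<in>verts Q. s x ` {f \<in> U x. s x f \<in> W x}) x"
  proof (cases "x \<in> verts Q")
    case True
    then show ?thesis
      using subrepresentation_carrier[OF assms True] by auto
  next
    case False
    then show ?thesis
      using assms by (auto simp: subrepresentation_def PiE_def extensional_def)
  qed
qed

lemma subrepresentation_image:
  assumes "\<And>x. x \<in> verts Q \<Longrightarrow> fvs.subspace (W x)" and "\<And>x. x \<in> verts Q \<Longrightarrow> W x \<subseteq> U x"
    and "\<And>a f. a \<in> arcs Q \<Longrightarrow> f \<in> W (tail Q a) \<Longrightarrow> F a f \<in> W (head Q a)"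
  shows "subrepresentation Q \<rho> (\<lambda>x\<in>verts Q. s x ` W x)"
  unfolding subrepresentation_def
proof (intro conjI ballI)
  show "(\<lambda>x\<in>verts Q. s x ` W x) \<in> (\<Pi>\<^sub>E x\<in>verts Q. {U. VectorSpace.subspace class_ring U (space \<rho> x)})"
    using presented.subspace_image[OF presented] assms(1,2) by simp
  fix a
  assume a: "a \<in> arcs Q"
  have "maps \<rho> a (s (tail Q a) f) \<in> s (head Q a) ` W (head Q a)" if "f \<in> W (tail Q a)" for f
    using maps_s[OF a] assms(2)[of "tail Q a"] assms(3)[OF a that] a that by auto
  then show "maps \<rho> a ` (\<lambda>x\<in>verts Q. s x ` W x) (tail Q a) \<subseteq> (\<lambda>x\<in>verts Q. s x ` W x) (head Q a)"
    using a by auto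
qed

text \<open>A subrepresentation with surjective maps survives each shrinking step: its vectors are
  mapped into it, and each has a preimage in it, whose lift hits the given lift up to
  \<open>R x\<close>.\<close>

lemma surjective_sub_le_E:
  assumes W: "subrepresentation Q \<rho> W" and surj: "all_surjective Q (sub_rep \<rho> W)"
    and "x \<in> verts Q"
  shows "{f \<in> U x. s x f \<in> W x} \<subseteq> E k x"
  using assms(3)
proof (induction k arbitrary: x)
  case 0
  then show ?case
    by auto
next
  case (Suc k)
  show ?case
  proof
    fix f
    assume f: "f \<in> {f \<in> U x. s x f \<in> W x}"
    have "F a f \<in> E k (head Q a)" if a: "a \<in> arcs Q" "tail Q a = x" for a
    proof -
      have "maps \<rho> a (s x f) \<in> W (head Q a)"
        using W a f by (auto simp: subrepresentation_def image_subset_iff)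
      then show ?thesis
        using maps_s[OF a(1)] F_U[OF a(1)] a f Suc.IH[of "head Q a"] by auto
    qed
    moreover have "f \<in> {g + h | g h. g \<in> F a ` E k (tail Q a) \<and> h \<in> R x}"
      if a: "a \<in> arcs Q" "head Q a = x" for a
    proof -
      have "s x f \<in> maps \<rho> a ` W (tail Q a)"
        using surj a f by (auto simp: all_surjective_def sub_rep_def)
      then obtain w where w: "w \<in> W (tail Q a)" "s x f = maps \<rho> a w"
        by blast
      then obtain g where g: "g \<in> U (tail Q a)" "w = s (tail Q a) g"
        using subrepresentation_carrier[OF W, of "tail Q a"] a(1) by auto
      have "g \<in> E k (tail Q a)"
        using Suc.IH[of "tail Q a"] a(1) g w(1) by auto
      moreover have "f - F a g \<in> R x"
        using s_eq_iff[OF Suc.prems, of f "F a g"] F_U[OF a(1) g(1)] maps_s[OF a(1) g(1)] w g f a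
        by simp
      moreover have "f = F a g + (f - F a g)"
        by simp
      ultimately show ?thesis
        by blast
    qed
    moreover have "f \<in> E k x"
      using Suc.IH[OF Suc.prems] f by blast
    ultimately show "f \<in> E (Suc k) x"
      by (simp add: shrink_def)
  qed
qed

text \<open>At a fixed point the first condition of \<open>shrink\<close> says subrepresentation and
  the second says surjectivity modulo the kernel. The order compares total functions; outside the
  vertices all families in question are \<open>undefined\<close>, so only vertices matter.\<close>

lemma largest_surjective_sub_eq:
  assumes stop: "\<And>x. x \<in> verts Q \<Longrightarrow> E (Suc k) x = E k x"
  shows "largest_surjective_sub Q \<rho> = (\<lambda>x\<in>verts Q. s x ` E k x)"
  unfolding largest_surjective_sub_def
proof (rule Greatest_equality)
  have stopD: "f \<in> shrink Q F R (E k) x" if "f \<in> E k x" "x \<in> verts Q" for f x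
    using stop[OF that(2)] that(1) by simp
  have "F a f \<in> E k (head Q a)" if "a \<in> arcs Q" "f \<in> E k (tail Q a)" for a f
    using stopD[OF that(2)] that(1) by (auto simp: shrink_def)
  then have "subrepresentation Q \<rho> (\<lambda>x\<in>verts Q. s x ` E k x)"
    by (intro subrepresentation_image E_subspace E_bounds)
  moreover have "s (head Q a) f \<in> maps \<rho> a ` s (tail Q a) ` E k (tail Q a)"
    if a: "a \<in> arcs Q" and f: "f \<in> E k (head Q a)" for a f
  proof -
    have t: "tail Q a \<in> verts Q" and h: "head Q a \<in> verts Q"
      using a by simp_all
    obtain g g' where g: "f = F a g + g'" "g \<in> E k (tail Q a)" "g' \<in> R (head Q a)"
      using stopD[OF f h] a by (auto simp: shrink_def)
    have gU: "g \<in> U (tail Q a)"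
      using g(2) E_bounds(2)[OF t] by blast
    have "f - F a g \<in> R (head Q a)"
      using g by simp
    then have "s (head Q a) f = maps \<rho> a (s (tail Q a) g)"
      using s_eq_iff[OF h _ F_U[OF a gU]] E_bounds(2)[OF h] f maps_s[OF a gU] by auto
    then show ?thesis
      using g(2) by blast
  qed
  ultimately show "subrepresentation Q \<rho> (\<lambda>x\<in>verts Q. s x ` E k x) \<and>
      all_surjective Q (sub_rep \<rho> (\<lambda>x\<in>verts Q. s x ` E k x))"
    by (auto simp: all_surjective_def sub_rep_def subrepresentation_def image_subset_iff)
next
  fix W
  assume W: "subrepresentation Q \<rho> W \<and> all_surjective Q (sub_rep \<rho> W)"
  have "W x \<subseteq> (\<lambda>x\<in>verts Q. s x ` E k x) x" for x
  proof (cases "x \<in> verts Q")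
    case True
    then have "s x ` {f \<in> U x. s x f \<in> W x} \<subseteq> s x ` E k x"
      using surjective_sub_le_E W by (intro image_mono) blast
    moreover have "s x ` {f \<in> U x. s x f \<in> W x} = W x"
      using subrepresentation_carrier[of W x] W True by blast
    ultimately show ?thesis
      using True by simp
  next
    case False
    then show ?thesis
      using W by (auto simp: subrepresentation_def PiE_def extensional_def)
  qed
  then show "W \<le> (\<lambda>x\<in>verts Q. s x ` E k x)"
    by (rule le_funI)
qed

text \<open>The map of \<open>quotient_rep\<close> is a union over the members of a coset. Since
  \<open>F a\<close> maps \<open>M\<close> to \<open>M\<close>, every member contributes the same
  coset, that of \<open>F a f\<close>.\<close>

lemma quotient_map:
  assumes sub: "\<And>x. x \<in> verts Q \<Longrightarrow> fvs.subspace (M x)" "\<And>x. x \<in> verts Q \<Longrightarrow> M x \<subseteq> U x"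
    and F_M: "\<And>a f. a \<in> arcs Q \<Longrightarrow> f \<in> M (tail Q a) \<Longrightarrow> F a f \<in> M (head Q a)"
    and a: "a \<in> arcs Q" and f: "f \<in> U (tail Q a)"
  shows "maps (quotient_rep Q \<rho> (\<lambda>x\<in>verts Q. s x ` M x)) a
      (s (tail Q a) ` M (tail Q a) +>\<^bsub>space \<rho> (tail Q a)\<^esub> s (tail Q a) f) =
    s (head Q a) ` M (head Q a) +>\<^bsub>space \<rho> (head Q a)\<^esub> s (head Q a) (F a f)"
proof -
  let ?t = "tail Q a" and ?h = "head Q a"
  have t: "?t \<in> verts Q" and h: "?h \<in> verts Q"
    using a by simp_all
  interpret T: presented "space \<rho> ?t" "U ?t" "s ?t"
    by (rule presented[OF t])
  interpret H: presented "space \<rho> ?h" "U ?h" "s ?h"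
    by (rule presented[OF h])
  interpret HQ: presented "quotient_space (space \<rho> ?h) (s ?h ` M ?h)" "U ?h"
      "\<lambda>f. s ?h ` M ?h +>\<^bsub>space \<rho> ?h\<^esub> s ?h f"
    by (rule H.presented_quotient(1)[OF sub[OF h]])
  have coset: "s ?t ` M ?t +>\<^bsub>space \<rho> ?t\<^esub> s ?t f = (\<lambda>g. s ?t (g + f)) ` M ?t"
    using sub(2)[OF t] f by (auto simp: a_r_coset_def' T.s_add subset_iff image_iff)
  have "s ?h ` M ?h +>\<^bsub>space \<rho> ?h\<^esub> maps \<rho> a (s ?t (g + f)) =
      s ?h ` M ?h +>\<^bsub>space \<rho> ?h\<^esub> s ?h (F a f)" if g: "g \<in> M ?t" for g
  proof -
    have gU: "g \<in> U ?t"
      using g sub(2)[OF t] by blast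
    have gf: "g + f \<in> U ?t"
      using fvs.subspace_add[OF subspace_U[OF t] gU f] .
    have "s ?h (F a (g + f) - F a f) \<in> s ?h ` M ?h"
      using F_M[OF a g] by (simp add: F_add[OF a])
    moreover have "F a (g + f) - F a f \<in> U ?h"
      by (intro fvs.subspace_diff[OF subspace_U[OF h]] F_U[OF a] gf f)
    ultimately show ?thesis
      using HQ.s_diff[OF F_U[OF a gf] F_U[OF a f]] H.presented_quotient(2)[OF sub[OF h]]
        maps_s[OF a gf] by simp
  qed
  moreover have "0 \<in> M ?t"
    by (rule fvs.subspace_0[OF sub(1)[OF t]])
  ultimately have "(\<Union>v\<in>(\<lambda>g. s ?t (g + f)) ` M ?t. s ?h ` M ?h +>\<^bsub>space \<rho> ?h\<^esub> maps \<rho> a v) =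
      s ?h ` M ?h +>\<^bsub>space \<rho> ?h\<^esub> s ?h (F a f)"
    by blast
  then show ?thesis
    using h by (simp add: quotient_rep_def coset)
qed

text \<open>Two cosets agree exactly when the lifts differ by an element of \<open>M\<close>, which
  uses that \<open>M\<close> contains the kernel. Applied to differences, injectivity turns into
  closure of \<open>M\<close> under preimages.\<close>

lemma all_injective_quotient_iff:
  assumes sub: "\<And>x. x \<in> verts Q \<Longrightarrow> fvs.subspace (M x)" "\<And>x. x \<in> verts Q \<Longrightarrow> M x \<subseteq> U x"
    "\<And>x. x \<in> verts Q \<Longrightarrow> R x \<subseteq> M x"
    and F_M: "\<And>a f. a \<in> arcs Q \<Longrightarrow> f \<in> M (tail Q a) \<Longrightarrow> F a f \<in> M (head Q a)"
  shows "all_injective Q (quotient_rep Q \<rho> (\<lambda>x\<in>verts Q. s x ` M x)) \<longleftrightarrow>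
    (\<forall>a\<in>arcs Q. \<forall>f\<in>U (tail Q a). F a f \<in> M (head Q a) \<longrightarrow> f \<in> M (tail Q a))"
proof -
  let ?\<phi> = "quotient_rep Q \<rho> (\<lambda>x\<in>verts Q. s x ` M x)"
  let ?c = "\<lambda>x f. s x ` M x +>\<^bsub>space \<rho> x\<^esub> s x f"
  have "inj_on (maps ?\<phi> a) (carrier (space ?\<phi> (tail Q a))) \<longleftrightarrow>
      (\<forall>f\<in>U (tail Q a). F a f \<in> M (head Q a) \<longrightarrow> f \<in> M (tail Q a))" if a: "a \<in> arcs Q" for a
  proof -
    let ?t = "tail Q a" and ?h = "head Q a"
    have c_eq: "?c x f = ?c x g \<longleftrightarrow> f - g \<in> M x" if "x \<in> verts Q" "f \<in> U x" "g \<in> U x" for x f g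
    proof -
      note pr = presented[OF that(1)]
      note fg = fvs.subspace_diff[OF subspace_U[OF that(1)] that(2,3)]
      show ?thesis
        using presented.s_diff[OF presented.presented_quotient(1)[OF pr sub(1,2)[OF that(1)]] that(2,3)]
          presented.presented_quotient(2)[OF pr sub(1,2)[OF that(1)] fg]
          mem_image_iff[OF that(1) sub(1)[OF that(1)] sub(3,2)[OF that(1)] fg] by simp
    qed
    have t: "?t \<in> verts Q" and h: "?h \<in> verts Q"
      using a by simp_all
    have carr: "carrier (space ?\<phi> ?t) = ?c ?t ` U ?t"
      using presented.carrier_eq[OF presented.presented_quotient(1)[OF presented[OF t] sub(1,2)[OF t]]] t
      by (simp add: quotient_rep_def)
    have "inj_on (maps ?\<phi> a) (carrier (space ?\<phi> ?t)) \<longleftrightarrow>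
        (\<forall>f\<in>U ?t. \<forall>g\<in>U ?t. maps ?\<phi> a (?c ?t f) = maps ?\<phi> a (?c ?t g) \<longrightarrow> ?c ?t f = ?c ?t g)"
      unfolding carr inj_on_def by blast
    also have "\<dots> \<longleftrightarrow> (\<forall>f\<in>U ?t. \<forall>g\<in>U ?t. F a (f - g) \<in> M ?h \<longrightarrow> f - g \<in> M ?t)"
      using quotient_map[of M, OF sub(1,2) F_M a] c_eq[OF t] c_eq[OF h] F_U[OF a] F_diff[OF a] by simp
    also have "\<dots> \<longleftrightarrow> (\<forall>f\<in>U ?t. F a f \<in> M ?h \<longrightarrow> f \<in> M ?t)"
      using fvs.subspace_diff[OF subspace_U[OF t]] fvs.subspace_0[OF subspace_U[OF t]]
      by (metis diff_zero)
    finally show ?thesis .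
  qed
  then show ?thesis
    by (simp add: all_injective_def)
qed

text \<open>The lift \<open>L\<close> of \<open>M\<close> contains the kernel and is closed under
  images and under preimages, the two ways in which \<open>grow\<close> enlarges a family; so it
  absorbs all iterates.\<close>

lemma N_le_injective_quotient_kernel:
  assumes M: "subrepresentation Q \<rho> M" and inj: "all_injective Q (quotient_rep Q \<rho> M)"
    and "x \<in> verts Q"
  shows "N k x \<subseteq> {f \<in> U x. s x f \<in> M x}"
proof -
  define L where "L = (\<lambda>x. {f \<in> U x. s x f \<in> M x})"
  have L: "fvs.subspace (L x)" "L x \<subseteq> U x" "R x \<subseteq> L x" if "x \<in> verts Q" for x
  proof -
    have sub: "VectorSpace.subspace class_ring (M x) (space \<rho> x)"
      by (rule subrepresentation_subspace[OF M that])
    then show "fvs.subspace (L x)"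
      unfolding L_def by (rule presented.subspace_preimage[OF presented[OF that]])
    show "L x \<subseteq> U x" "R x \<subseteq> L x"
      using sub submodule.zero_closed by (auto simp: L_def R_def VectorSpace.subspace_def)
  qed
  have F_L: "F a f \<in> L (head Q a)" if "a \<in> arcs Q" "f \<in> L (tail Q a)" for a f
    using M that F_U[OF that(1)] maps_s[OF that(1)]
    by (force simp: L_def subrepresentation_def)
  have "M = (\<lambda>x\<in>verts Q. s x ` L x)"
    unfolding L_def by (rule subrepresentation_eqI[OF M])
  then have "all_injective Q (quotient_rep Q \<rho> (\<lambda>x\<in>verts Q. s x ` L x))"
    using inj by simp
  then have preim: "f \<in> L (tail Q a)" if "a \<in> arcs Q" "f \<in> U (tail Q a)" "F a f \<in> L (head Q a)" for a f
    using all_injective_quotient_iff[of L, OF L F_L] that by blast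
  have "N k x \<subseteq> L x" if "x \<in> verts Q" for x
    using that
  proof (induction k arbitrary: x)
    case 0
    then show ?case
      using L(3) by simp
  next
    case (Suc k)
    have "F a ` N k (tail Q a) \<subseteq> L x" if "a \<in> arcs Q" "head Q a = x" for a
      using Suc.IH[of "tail Q a"] F_L[OF that(1)] that by auto
    moreover have "{f \<in> U x. F a f \<in> N k (head Q a)} \<subseteq> L x" if "a \<in> arcs Q" "tail Q a = x" for a
      using Suc.IH[of "head Q a"] preim[OF that(1)] that by auto
    ultimately show ?case
      unfolding N_Suc[OF Suc.prems] using Suc.IH[OF Suc.prems] L(1)[OF Suc.prems]
      by (intro fvs.span_minimal Un_least UN_least) auto
  qed
  then show ?thesis
    using assms(3) unfolding L_def by blast
qed

text \<open>A fixed point of \<open>grow\<close> is closed under images, hence a subrepresentation,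
  and under preimages, hence has injective maps on the quotient.\<close>

lemma injective_quotient_kernel_eq:
  assumes stop: "\<And>x. x \<in> verts Q \<Longrightarrow> N (Suc k) x = N k x"
  shows "injective_quotient_kernel Q \<rho> = (\<lambda>x\<in>verts Q. s x ` N k x)"
  unfolding injective_quotient_kernel_def
proof (rule Least_equality)
  have stopD: "fvs.span (N k x \<union> (\<Union>a\<in>{a \<in> arcs Q. head Q a = x}. F a ` N k (tail Q a)) \<union>
      (\<Union>a\<in>{a \<in> arcs Q. tail Q a = x}. {f \<in> U x. F a f \<in> N k (head Q a)})) = N k x"
    if "x \<in> verts Q" for x
    using stop[OF that] N_Suc[OF that] by metis
  have image: "F a f \<in> N k (head Q a)" if "a \<in> arcs Q" "f \<in> N k (tail Q a)" for a f
    using that by (subst stopD[symmetric]) (auto intro: fvs.span_base)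
  moreover have "f \<in> N k (tail Q a)" if "a \<in> arcs Q" "f \<in> U (tail Q a)" "F a f \<in> N k (head Q a)" for a f
    using that by (subst stopD[symmetric]) (auto intro: fvs.span_base)
  ultimately show "subrepresentation Q \<rho> (\<lambda>x\<in>verts Q. s x ` N k x) \<and>
      all_injective Q (quotient_rep Q \<rho> (\<lambda>x\<in>verts Q. s x ` N k x))"
    using all_injective_quotient_iff[of "N k", OF N_subspace N_bounds(2,1) image]
      subrepresentation_image[of "N k", OF N_subspace N_bounds(2) image] by blast
next
  fix M
  assume M: "subrepresentation Q \<rho> M \<and> all_injective Q (quotient_rep Q \<rho> M)"
  have "(\<lambda>x\<in>verts Q. s x ` N k x) x \<subseteq> M x" for x
  proof (cases "x \<in> verts Q")
    case True
    then show ?thesis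
      using N_le_injective_quotient_kernel[of M x k] M by auto
  next
    case False
    then show ?thesis
      using M by (auto simp: subrepresentation_def PiE_def extensional_def)
  qed
  then show "(\<lambda>x\<in>verts Q. s x ` N k x) \<le> M"
    by (rule le_funI)
qed

section \<open>Both chains stop after a bounded number of steps\<close>

lemma E_stable:
  assumes "\<And>x. x \<in> verts Q \<Longrightarrow> \<exists>T. finite T \<and> card T \<le> n \<and> U x \<subseteq> fvs.span T" and "x \<in> verts Q"
  shows "E (Suc (card (verts Q) * n)) x = E (card (verts Q) * n) x"
proof (rule decreasing_chain_stops)
  show "\<exists>T. finite T \<and> card T \<le> n \<and> E k x \<subseteq> fvs.span T" if "x \<in> verts Q" for k x
    using assms(1)[OF that] E_bounds(2)[OF that] by (meson order.trans)
  show "E (Suc (Suc k)) x = E (Suc k) x"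
    if "\<And>x. x \<in> verts Q \<Longrightarrow> E (Suc k) x = E k x" "x \<in> verts Q" for k x
  proof -
    \<comment> \<open>Equality of iterates is known at vertices only, and tails and heads of arrows
      are vertices.\<close>
    have "shrink Q F R W x = shrink Q F R W' x" if "\<And>x. x \<in> verts Q \<Longrightarrow> W x = W' x" for W W'
      using that \<open>x \<in> verts Q\<close> by (force simp: shrink_def)
    from this[of "E (Suc k)" "E k"] show ?thesis
      using that(1) by simp
  qed
  show "E (Suc k) x \<subseteq> E k x" for k x
    by (auto simp: shrink_def[of Q F R "E k"])
qed (use E_subspace assms(2) finite_verts in simp_all)

lemma N_stable:
  assumes "\<And>x. x \<in> verts Q \<Longrightarrow> \<exists>T. finite T \<and> card T \<le> n \<and> U x \<subseteq> fvs.span T" and "x \<in> verts Q"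
  shows "N (Suc (card (verts Q) * n)) x = N (card (verts Q) * n) x"
proof (rule increasing_chain_stops)
  show "\<exists>T. finite T \<and> card T \<le> n \<and> N k x \<subseteq> fvs.span T" if "x \<in> verts Q" for k x
    using assms(1)[OF that] N_bounds(2)[OF that] by (meson order.trans)
  show "N k x \<subseteq> N (Suc k) x" if "x \<in> verts Q" for k x
    unfolding N_Suc[OF that] by (auto intro: fvs.span_base)
  show "N (Suc (Suc k)) x = N (Suc k) x"
    if "\<And>x. x \<in> verts Q \<Longrightarrow> N (Suc k) x = N k x" "x \<in> verts Q" for k x
  proof -
    have "(\<Union>a\<in>{a \<in> arcs Q. head Q a = x}. F a ` N (Suc k) (tail Q a)) =
        (\<Union>a\<in>{a \<in> arcs Q. head Q a = x}. F a ` N k (tail Q a))"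
      using that by (intro SUP_cong) (auto simp del: funpow.simps)
    moreover have "(\<Union>a\<in>{a \<in> arcs Q. tail Q a = x}. {f \<in> U x. F a f \<in> N (Suc k) (head Q a)}) =
        (\<Union>a\<in>{a \<in> arcs Q. tail Q a = x}. {f \<in> U x. F a f \<in> N k (head Q a)})"
      using that by (intro SUP_cong) (auto simp del: funpow.simps)
    ultimately show ?thesis
      unfolding N_Suc[OF that(2)] using that(1)[OF that(2)] N_Suc[OF that(2), of k] by metis
  qed
qed (use N_subspace assms(2) finite_verts in simp_all)

text \<open>That the dimensions at all vertices coincide is never used: the value of \<open>THE\<close> is a function
  of them in any case.\<close>

lemma global_rank_eq:
  fixes v :: "'v \<Rightarrow> 'a \<Rightarrow> 'i \<Rightarrow> 'k"
  assumes fixE: "\<And>x. x \<in> verts Q \<Longrightarrow> E (Suc k) x = E k x"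
    and fixN: "\<And>x. x \<in> verts Q \<Longrightarrow> N (Suc k) x = N k x"
    and S: "\<And>x. x \<in> verts Q \<Longrightarrow> finite (S x)" "\<And>x. x \<in> verts Q \<Longrightarrow> v x ` S x \<subseteq> E k x"
      "\<And>x. x \<in> verts Q \<Longrightarrow> E k x \<subseteq> fvs.span (v x ` S x \<union> N k x)"
      "\<And>x a. x \<in> verts Q \<Longrightarrow> a \<in> S x \<Longrightarrow> v x a \<notin> fvs.span (v x ` (S x - {a}) \<union> N k x)"
  shows "global_rank Q \<rho> = (THE d. \<forall>x\<in>verts Q. d = card (S x))"
proof -
  have "vectorspace.dim class_ring ((quotient_space (space \<rho> x) (s x ` N k x))
      \<lparr>carrier := (\<lambda>v. s x ` N k x +>\<^bsub>space \<rho> x\<^esub> v) ` s x ` E k x\<rparr>) = card (S x)"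
    if x: "x \<in> verts Q" for x
  proof -
    interpret P: presented "space \<rho> x" "U x" "s x"
      by (rule presented[OF x])
    interpret PQ: presented "quotient_space (space \<rho> x) (s x ` N k x)" "U x"
        "\<lambda>f. s x ` N k x +>\<^bsub>space \<rho> x\<^esub> s x f"
      by (rule P.presented_quotient(1)[OF N_subspace[OF x] N_bounds(2)[OF x]])
    \<comment> \<open>The space whose dimension defines the global rank: it is presented by
      \<open>E k x\<close>, and the kernel consists of the elements of \<open>E k x\<close> that lie
      in \<open>N k x\<close>.\<close>
    interpret PI: presented "(quotient_space (space \<rho> x) (s x ` N k x))
        \<lparr>carrier := (\<lambda>f. s x ` N k x +>\<^bsub>space \<rho> x\<^esub> s x f) ` E k x\<rparr>" "E k x"
        "\<lambda>f. s x ` N k x +>\<^bsub>space \<rho> x\<^esub> s x f"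
      by (rule PQ.presented_sub[OF E_subspace[OF x] E_bounds(2)[OF x]])
    have "s x ` N k x +>\<^bsub>space \<rho> x\<^esub> s x f = \<zero>\<^bsub>quotient_space (space \<rho> x) (s x ` N k x)\<^esub> \<longleftrightarrow> f \<in> N k x"
      if "f \<in> E k x" for f
    proof -
      have f: "f \<in> U x"
        using that E_bounds(2)[OF x] by blast
      show ?thesis
        using P.presented_quotient(2)[OF N_subspace[OF x] N_bounds(2)[OF x] f]
          mem_image_iff[OF x N_subspace[OF x] N_bounds(1,2)[OF x] f] by blast
    qed
    then show ?thesis
      using PI.dim_eq_card[OF S(1)[OF x] N_subspace[OF x] _ S(2-4)[OF x]]
      by (simp add: image_image)
  qed
  moreover have "largest_surjective_sub Q \<rho> = (\<lambda>x\<in>verts Q. s x ` E k x)"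
    using fixE by (rule largest_surjective_sub_eq)
  moreover have "injective_quotient_kernel Q \<rho> = (\<lambda>x\<in>verts Q. s x ` N k x)"
    using fixN by (rule injective_quotient_kernel_eq)
  ultimately show ?thesis
    unfolding global_rank_def Let_def
    by (simp add: quotient_rep_def cong: ball_cong)
qed

end

section \<open>Definable families of representations\<close>

text \<open>Presenting spaces consist of functions on \<open>'v list \<times> nat\<close>. This index type absorbs direct
  sums over vertices, because the component at \<open>y\<close> can be stored at the indices whose list
  starts with \<open>y\<close>.\<close>

definition summand :: "'v \<Rightarrow> ('v list \<times> nat \<Rightarrow> 'k) \<Rightarrow> 'v list \<times> nat \<Rightarrow> 'k" where
  "summand y f = (\<lambda>j. f (y # fst j, snd j))"

definition inject :: "'v \<Rightarrow> ('v list \<times> nat \<Rightarrow> 'k::zero) \<Rightarrow> 'v list \<times> nat \<Rightarrow> 'k" where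
  "inject y f = (\<lambda>j. if fst j \<noteq> [] \<and> hd (fst j) = y then f (tl (fst j), snd j) else 0)"

text \<open>The last two conditions remove everything outside the summands at \<open>Y\<close>. In
  particular the sum over the empty set is zero, where the inductions over \<open>Y\<close>
  start.\<close>

definition direct_sum_functions ::
  "'v set \<Rightarrow> ('v \<Rightarrow> ('v list \<times> nat \<Rightarrow> 'k::zero) set) \<Rightarrow> ('v list \<times> nat \<Rightarrow> 'k) set" where
  "direct_sum_functions Y V =
     {f. (\<forall>y\<in>Y. summand y f \<in> V y) \<and> (\<forall>y. y \<notin> Y \<longrightarrow> summand y f = 0) \<and> (\<forall>i. f ([], i) = 0)}"

lemma summand_inject: "summand y (inject z f) = (if y = z then f else 0)"
  by (simp add: summand_def inject_def fun_eq_iff)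

lemma inject_Nil: "inject y f ([], i) = 0"
  by (simp add: inject_def)

lemma summand_add: "summand y (f + g) = summand y f + summand y g"
  and summand_diff: "summand y (f' - g') = summand y f' - summand y (g' :: _ \<Rightarrow> 'k::ab_group_add)"
  and summand_zero: "summand y 0 = 0"
  by (simp_all add: summand_def fun_eq_iff)

lemma summand_scale: "summand y (fscale c f) = fscale c (summand y f)"
  by (simp add: summand_def fun_eq_iff fscale_def)

lemma summand_sum: "summand y (\<Sum>a\<in>A. f a) = (\<Sum>a\<in>A. summand y (f a))"
proof (induction A rule: infinite_finite_induct)
  case (insert a A)
  show ?case
    unfolding sum.insert[OF insert.hyps] summand_add insert.IH ..
next
  case (infinite A)
  show ?case
    by (simp only: sum.infinite[OF infinite] summand_zero)
next
  case empty
  show ?case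
    by (simp only: sum.empty summand_zero)
qed

lemma sum_inject_Nil: "(\<Sum>a\<in>A. inject (y a) (f a)) ([], i) = 0"
  by (induction A rule: infinite_finite_induct) (simp_all add: inject_Nil)

lemma functions_eqI:
  assumes "\<And>y. summand y f = summand y g" and "\<And>i. f ([], i) = g ([], i)"
  shows "f = g"
proof
  fix j
  show "f j = g j"
  proof (cases j)
    case (Pair l i)
    then show ?thesis
      using assms(1)[of "hd l", THEN fun_cong, of "(tl l, i)"] assms(2)[of i]
      by (cases l) (simp_all add: summand_def)
  qed
qed

lemma direct_sum_functions_insert:
  fixes V :: "'v \<Rightarrow> ('v list \<times> nat \<Rightarrow> 'k::field) set"
  assumes "y \<notin> Y" and "0 \<in> V y"
  shows "direct_sum_functions (insert y Y) V =
    {f + g | f g. f \<in> inject y ` V y \<and> g \<in> direct_sum_functions Y V}"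
proof
  show "{f + g | f g. f \<in> inject y ` V y \<and> g \<in> direct_sum_functions Y V} \<subseteq> direct_sum_functions (insert y Y) V"
    using assms(1) by (auto simp: direct_sum_functions_def summand_add summand_inject inject_Nil)
  show "direct_sum_functions (insert y Y) V \<subseteq> {f + g | f g. f \<in> inject y ` V y \<and> g \<in> direct_sum_functions Y V}"
  proof
    fix f
    assume f: "f \<in> direct_sum_functions (insert y Y) V"
    have "f - inject y (summand y f) \<in> direct_sum_functions Y V"
      using f assms(1) by (auto simp: direct_sum_functions_def summand_diff summand_inject inject_Nil)
    moreover have "inject y (summand y f) \<in> inject y ` V y"
      using f by (auto simp: direct_sum_functions_def)
    moreover have "f = inject y (summand y f) + (f - inject y (summand y f))"
      by simp
    ultimately show "f \<in> {f + g | f g. f \<in> inject y ` V y \<and> g \<in> direct_sum_functions Y V}"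
      by blast
  qed
qed

lemma subspace_direct_sum_functions:
  fixes V :: "'v \<Rightarrow> ('v list \<times> nat \<Rightarrow> 'k::field) set"
  assumes "\<And>y. y \<in> Y \<Longrightarrow> fvs.subspace (V y)"
  shows "fvs.subspace (direct_sum_functions Y V)"
  using fvs.subspace_0[OF assms] fvs.subspace_add[OF assms] fvs.subspace_scale[OF assms]
  by (intro fvs.subspaceI)
    (simp_all add: direct_sum_functions_def summand_add summand_scale summand_zero fscale_apply)

lemma presented_direct_sum:
  fixes U :: "'v \<Rightarrow> ('v list \<times> nat \<Rightarrow> 'k::field) set"
  assumes "finite Y" and "\<And>y. y \<in> Y \<Longrightarrow> presented (V y) (U y) (s y)"
  shows "presented (direct_sum_space Y V) (direct_sum_functions Y U)
    (\<lambda>f. Family (\<lambda>y\<in>Y. s y (summand y f)))"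
proof
  let ?s = "\<lambda>f. Family (\<lambda>y\<in>Y. s y (summand y f))"
  show "fvs.subspace (direct_sum_functions Y U)"
    using assms(2) by (intro subspace_direct_sum_functions presented.subspace_U)
  have mem: "summand y f \<in> U y" if "f \<in> direct_sum_functions Y U" "y \<in> Y" for f y
    using that by (simp add: direct_sum_functions_def)
  show "carrier (direct_sum_space Y V) = ?s ` direct_sum_functions Y U"
  proof
    show "?s ` direct_sum_functions Y U \<subseteq> carrier (direct_sum_space Y V)"
      using mem presented.s_carrier[OF assms(2)] by (auto simp: direct_sum_space_def)
    show "carrier (direct_sum_space Y V) \<subseteq> ?s ` direct_sum_functions Y U"
    proof
      fix t
      assume "t \<in> carrier (direct_sum_space Y V)"
      then obtain u where u: "t = Family u" "u \<in> (\<Pi>\<^sub>E y\<in>Y. carrier (V y))"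
        by (auto simp: direct_sum_space_def)
      have "\<forall>y\<in>Y. \<exists>g. g \<in> U y \<and> u y = s y g"
        using u(2) presented.carrier_eq[OF assms(2)] by (auto simp: PiE_def Pi_def)
      then obtain g where g: "\<And>y. y \<in> Y \<Longrightarrow> g y \<in> U y \<and> u y = s y (g y)"
        by metis
      let ?f = "\<Sum>y\<in>Y. inject y (g y)"
      have summand_f: "summand y ?f = (if y \<in> Y then g y else 0)" for y
        using assms(1) by (simp add: summand_sum summand_inject sum.delta' eq_commute[of y] cong: if_cong)
      then have "?f \<in> direct_sum_functions Y U"
        using g by (simp add: direct_sum_functions_def sum_inject_Nil)
      moreover have "u = (\<lambda>y\<in>Y. s y (summand y ?f))"
        using u(2) g by (auto simp: summand_f fun_eq_iff PiE_def extensional_def)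
      ultimately show "t \<in> ?s ` direct_sum_functions Y U"
        using u(1) by blast
    qed
  qed
  show "?s 0 = \<zero>\<^bsub>direct_sum_space Y V\<^esub>"
    using presented.s_zero[OF assms(2)]
    by (simp add: direct_sum_space_def summand_zero cong: restrict_cong)
  show "?s (f + g) = ?s f \<oplus>\<^bsub>direct_sum_space Y V\<^esub> ?s g"
    if "f \<in> direct_sum_functions Y U" "g \<in> direct_sum_functions Y U" for f g
    using presented.s_add[OF assms(2)] mem that
    by (simp add: direct_sum_space_def summand_add cong: restrict_cong)
  show "?s (fscale c f) = c \<odot>\<^bsub>direct_sum_space Y V\<^esub> ?s f" if "f \<in> direct_sum_functions Y U" for f c
    using presented.s_scale[OF assms(2)] mem that
    by (simp add: direct_sum_space_def summand_scale cong: restrict_cong)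
qed

lemma presented_base_space:
  assumes "presented V U s"
  shows "presented (base_space V) U (\<lambda>f. Base (s f))"
proof -
  interpret presented V U s
    by (rule assms)
  show ?thesis
    by unfold_locales
      (auto simp: base_space_def subspace_U s_zero s_add s_scale carrier_eq image_image)
qed

context definable_functions
begin

text \<open>Values are natural numbers, so definability is expressed through the level sets.
  Finiteness of the range lets any condition on the values be split into finitely many of
  them.\<close>

definition dfin :: "('x \<Rightarrow> nat) \<Rightarrow> bool" where
  "dfin r \<longleftrightarrow> finite (r ` X) \<and> (\<forall>n. dpred (\<lambda>p. r p = n))"

text \<open>The cases may overlap: whichever case holds at a point gives the value there.\<close>

lemma dfinI:
  assumes "finite \<Sigma>" and "\<And>\<sigma>. \<sigma> \<in> \<Sigma> \<Longrightarrow> dpred (P \<sigma>)"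
    and "\<And>p \<sigma>. p \<in> X \<Longrightarrow> \<sigma> \<in> \<Sigma> \<Longrightarrow> P \<sigma> p \<Longrightarrow> r p = h \<sigma>"
    and "\<And>p. p \<in> X \<Longrightarrow> \<exists>\<sigma>\<in>\<Sigma>. P \<sigma> p"
  shows "dfin r"
  unfolding dfin_def
proof (intro conjI allI)
  have "r ` X \<subseteq> h ` \<Sigma>"
    using assms(3,4) by blast
  then show "finite (r ` X)"
    using assms(1) finite_surj by blast
  fix n
  have "dpred (\<lambda>p. \<exists>\<sigma>\<in>{\<sigma> \<in> \<Sigma>. h \<sigma> = n}. P \<sigma> p)"
    using assms(1,2) by (intro dpred_bex) auto
  then show "dpred (\<lambda>p. r p = n)"
  proof (rule dpred_cong)
    fix p
    assume "p \<in> X"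
    then show "(\<exists>\<sigma>\<in>{\<sigma> \<in> \<Sigma>. h \<sigma> = n}. P \<sigma> p) \<longleftrightarrow> r p = n"
      using assms(3)[of p] assms(4)[of p] by auto
  qed
qed

lemma dsub_ball:
  assumes "finite A" and "dsub U"
    and "\<And>a U. a \<in> A \<Longrightarrow> dsub U \<Longrightarrow> dsub (\<lambda>p. {f \<in> U p. P a p f})"
  shows "dsub (\<lambda>p. {f \<in> U p. \<forall>a\<in>A. P a p f})"
  using assms(1,3)
proof (induction A rule: finite_induct)
  case empty
  then show ?case
    using assms(2) by simp
next
  case (insert a A)
  have "dsub (\<lambda>p. {f \<in> {f \<in> U p. \<forall>a\<in>A. P a p f}. P a p f})"
    using insert by (intro insert.prems insert.IH) auto
  then show ?case
    by (rule dsub_cong) auto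
qed

lemma dsub_span_UN:
  assumes "finite A" and "\<And>a. a \<in> A \<Longrightarrow> dsub (V a)"
  shows "dsub (\<lambda>p. fvs.span (\<Union>a\<in>A. V a p))"
  using assms
proof (induction A rule: finite_induct)
  case empty
  then show ?case
    by (simp add: dsub_zero)
next
  case (insert a A)
  have "dsub (\<lambda>p. {f + g | f g. f \<in> V a p \<and> g \<in> fvs.span (\<Union>a\<in>A. V a p)})"
    using insert by (intro dsub_sum) simp_all
  then show ?case
  proof (rule dsub_cong)
    fix p
    assume "p \<in> X"
    then have "fvs.span (V a p) = V a p"
      using dsub_subspace[OF insert.prems[OF insertI1]] by simp
    then show "{f + g | f g. f \<in> V a p \<and> g \<in> fvs.span (\<Union>a\<in>A. V a p)} = fvs.span (\<Union>a\<in>insert a A. V a p)"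
      by (simp only: UN_insert fvs.span_Un)
  qed
qed

section \<open>Definability of the iteration steps and of presentations\<close>

lemma dsub_shrink:
  assumes "fin_digraph Q" and F: "\<And>a. a \<in> arcs Q \<Longrightarrow> dmap (F a)"
    and R: "\<And>x. x \<in> verts Q \<Longrightarrow> dsub (R x)" and W: "\<And>x. x \<in> verts Q \<Longrightarrow> dsub (W x)"
    and x: "x \<in> verts Q"
  shows "dsub (\<lambda>p. shrink Q (\<lambda>a. F a p) (\<lambda>x. R x p) (\<lambda>x. W x p) x)"
proof -
  interpret fin_digraph Q
    by fact
  let ?W = "\<lambda>p. {f \<in> W x p. \<forall>a\<in>{a \<in> arcs Q. tail Q a = x}. F a p f \<in> W (head Q a) p}"
  have 1: "dsub ?W"
    by (rule dsub_ball) (auto intro!: dsub_preimage F W x)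
  have "dsub (\<lambda>p. {g + h | g h. g \<in> F a p ` W (tail Q a) p \<and> h \<in> R x p})" if "a \<in> arcs Q" for a
    using that by (intro dsub_sum dsub_image F W R x tail_in_verts)
  then have "dsub (\<lambda>p. {f \<in> ?W p. \<forall>a\<in>{a \<in> arcs Q. head Q a = x}.
      f \<in> {g + h | g h. g \<in> F a p ` W (tail Q a) p \<and> h \<in> R x p}})"
    by (intro dsub_ball[OF _ 1] dsub_preimage[OF dmap_id]) auto
  then show ?thesis
    by (rule dsub_cong) (simp add: shrink_def conj_assoc)
qed

lemma dsub_grow:
  assumes "fin_digraph Q" and F: "\<And>a. a \<in> arcs Q \<Longrightarrow> dmap (F a)"
    and U: "\<And>x. x \<in> verts Q \<Longrightarrow> dsub (U x)" and N: "\<And>x. x \<in> verts Q \<Longrightarrow> dsub (N x)"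
    and x: "x \<in> verts Q"
  shows "dsub (\<lambda>p. grow Q (\<lambda>a. F a p) (\<lambda>x. U x p) (\<lambda>x. N x p) x)"
proof -
  interpret fin_digraph Q
    by fact
  show ?thesis
    unfolding grow_def
    by (intro dsub_sum dsub_span_UN N x)
      (auto intro!: dsub_image dsub_preimage F N U x)
qed

text \<open>The map \<open>s x p\<close> takes values in an arbitrary type, so definability is
  required of what it leaves behind among functions: the presenting space, the kernel and the lifted
  maps.\<close>

definition definable_presentation ::
  "('v, 'e) pre_digraph \<Rightarrow> ('x \<Rightarrow> ('v, 'e, 'k, 'u) rep) \<Rightarrow> ('v \<Rightarrow> 'x \<Rightarrow> ('v list \<times> nat \<Rightarrow> 'k) set) \<Rightarrow>
   ('v \<Rightarrow> 'x \<Rightarrow> ('v list \<times> nat \<Rightarrow> 'k) \<Rightarrow> 'u) \<Rightarrow>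
   ('e \<Rightarrow> 'x \<Rightarrow> ('v list \<times> nat \<Rightarrow> 'k) \<Rightarrow> 'v list \<times> nat \<Rightarrow> 'k) \<Rightarrow> bool" where
  "definable_presentation Q \<rho> U s F \<longleftrightarrow>
     (\<forall>x\<in>verts Q. dsub (U x) \<and> dsub (\<lambda>p. {f \<in> U x p. s x p f = \<zero>\<^bsub>space (\<rho> p) x\<^esub>}) \<and>
        (\<forall>p\<in>X. presented (space (\<rho> p) x) (U x p) (s x p))) \<and>
     (\<forall>a\<in>arcs Q. dmap (F a) \<and> (\<forall>p\<in>X. \<forall>f\<in>U (tail Q a) p. F a p f \<in> U (head Q a) p \<and>
        maps (\<rho> p) a (s (tail Q a) p f) = s (head Q a) p (F a p f)))"

lemma definable_presentationD:
  assumes "definable_presentation Q \<rho> U s F"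
  shows "x \<in> verts Q \<Longrightarrow> dsub (U x)"
    and "x \<in> verts Q \<Longrightarrow> dsub (\<lambda>p. {f \<in> U x p. s x p f = \<zero>\<^bsub>space (\<rho> p) x\<^esub>})"
    and "x \<in> verts Q \<Longrightarrow> p \<in> X \<Longrightarrow> presented (space (\<rho> p) x) (U x p) (s x p)"
    and "a \<in> arcs Q \<Longrightarrow> dmap (F a)"
    and "a \<in> arcs Q \<Longrightarrow> p \<in> X \<Longrightarrow> f \<in> U (tail Q a) p \<Longrightarrow> F a p f \<in> U (head Q a) p"
    and "a \<in> arcs Q \<Longrightarrow> p \<in> X \<Longrightarrow> f \<in> U (tail Q a) p \<Longrightarrow>
      maps (\<rho> p) a (s (tail Q a) p f) = s (head Q a) p (F a p f)"
  using assms unfolding definable_presentation_def by blast+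

definition definable_rep :: "('v, 'e) pre_digraph \<Rightarrow> ('x \<Rightarrow> ('v, 'e, 'k, 'u) rep) \<Rightarrow> bool" where
  "definable_rep Q \<rho> \<longleftrightarrow> (\<exists>U s F. definable_presentation Q \<rho> U s F)"

lemma definable_repI:
  fixes U :: "'v \<Rightarrow> 'x \<Rightarrow> ('v list \<times> nat \<Rightarrow> 'k) set"
  assumes "\<And>x. x \<in> verts Q \<Longrightarrow> dsub (U x)"
    and "\<And>x. x \<in> verts Q \<Longrightarrow> dsub (\<lambda>p. {f \<in> U x p. s x p f = \<zero>\<^bsub>space (\<rho> p) x\<^esub>})"
    and "\<And>x p. x \<in> verts Q \<Longrightarrow> p \<in> X \<Longrightarrow> presented (space (\<rho> p) x) (U x p) (s x p)"
    and "\<And>a. a \<in> arcs Q \<Longrightarrow> dmap (F a)"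
    and "\<And>a p f. a \<in> arcs Q \<Longrightarrow> p \<in> X \<Longrightarrow> f \<in> U (tail Q a) p \<Longrightarrow> F a p f \<in> U (head Q a) p"
    and "\<And>a p f. a \<in> arcs Q \<Longrightarrow> p \<in> X \<Longrightarrow> f \<in> U (tail Q a) p \<Longrightarrow>
      maps (\<rho> p) a (s (tail Q a) p f) = s (head Q a) p (F a p f)"
  shows "definable_rep Q \<rho>"
  unfolding definable_rep_def definable_presentation_def
  by (rule exI[of _ U], rule exI[of _ s], rule exI[of _ F]) (use assms in simp)

text \<open>Fix generators of the limit \<open>E\<close> at every vertex. At each point some subset
  of them is irredundant and generates \<open>E\<close> modulo \<open>N\<close>; whether a given
  subset does is a definable condition. The finitely many families \<open>\<sigma>\<close> of
  subsets are the cases, and each determines the rank by its cardinalities.\<close>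

lemma dfin_global_rank:
  fixes Q :: "('v, 'e) pre_digraph"
  assumes Q: "fin_digraph Q" and "definable_rep Q \<rho>"
  shows "dfin (\<lambda>p. global_rank Q (\<rho> p))"
proof -
  interpret fin_digraph Q
    by (rule Q)
  obtain U s F where "definable_presentation Q \<rho> U s F"
    using assms(2) unfolding definable_rep_def by blast
  note U = definable_presentationD(1)[OF this] and R = definable_presentationD(2)[OF this]
    and pres = definable_presentationD(3)[OF this] and F = definable_presentationD(4)[OF this]
    and F_U = definable_presentationD(5)[OF this] and maps = definable_presentationD(6)[OF this]
  have rep: "presented_rep Q (\<rho> p) (\<lambda>x. U x p) (\<lambda>x. s x p) (\<lambda>a. F a p)" if "p \<in> X" for p
    using pres F_U maps dmap_linear[OF F] that
    by (intro presented_rep.intro[OF Q] presented_rep_axioms.intro) auto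
  let ?R = "\<lambda>x p. {f \<in> U x p. s x p f = \<zero>\<^bsub>space (\<rho> p) x\<^esub>}"
  have R_eq: "presented_rep.R (\<rho> p) (\<lambda>x. U x p) (\<lambda>x. s x p) = (\<lambda>x. ?R x p)" if "p \<in> X" for p
    using presented_rep.R_def[OF rep[OF that]] by blast
  have "\<forall>x\<in>verts Q. \<exists>n. \<forall>p\<in>X. \<exists>T. finite T \<and> card T \<le> n \<and> U x p \<subseteq> fvs.span T"
    using dsub_span_bound[OF U] by metis
  then obtain m where m: "\<And>x p. x \<in> verts Q \<Longrightarrow> p \<in> X \<Longrightarrow> \<exists>T. finite T \<and> card T \<le> m x \<and> U x p \<subseteq> fvs.span T"
    by metis
  define n where "n = Max (m ` verts Q)"
  have n: "\<exists>T. finite T \<and> card T \<le> n \<and> U x p \<subseteq> fvs.span T" if "x \<in> verts Q" "p \<in> X" for x p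
  proof -
    have "m x \<le> n"
      unfolding n_def using that(1) by (intro Max_ge) auto
    then show ?thesis
      using m[OF that] by (meson order.trans)
  qed
  \<comment> \<open>Enough steps for both chains at every point, since \<open>n\<close> bounds the
    spanning sets of all \<open>U x p\<close> at once.\<close>
  define k where "k = card (verts Q) * n"
  define E where "E = (\<lambda>x p. (shrink Q (\<lambda>a. F a p) (\<lambda>x. ?R x p) ^^ k) (\<lambda>x. U x p) x)"
  define N where "N = (\<lambda>x p. (grow Q (\<lambda>a. F a p) (\<lambda>x. U x p) ^^ k) (\<lambda>x. ?R x p) x)"
  have dE: "dsub (E x)" if "x \<in> verts Q" for x
    unfolding E_def using that
  proof (induction k arbitrary: x)
    case (Suc k)
    then show ?case
      using dsub_shrink[OF Q F R Suc.IH Suc.prems] by simp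
  qed (simp add: U)
  have dN: "dsub (N x)" if "x \<in> verts Q" for x
    unfolding N_def using that
  proof (induction k arbitrary: x)
    case (Suc k)
    then show ?case
      using dsub_grow[OF Q F U Suc.IH Suc.prems] by simp
  qed (simp add: R)
  have "\<exists>G. finite G \<and> (\<forall>v\<in>G. dvec v) \<and> (\<forall>p\<in>X. E x p = fvs.span ((\<lambda>v. v p) ` G))"
    if "x \<in> verts Q" for x
    using dE[OF that] unfolding dsub_def .
  then obtain G where G: "\<And>x. x \<in> verts Q \<Longrightarrow> finite (G x)"
      "\<And>x v. x \<in> verts Q \<Longrightarrow> v \<in> G x \<Longrightarrow> dvec v"
      "\<And>x p. x \<in> verts Q \<Longrightarrow> p \<in> X \<Longrightarrow> E x p = fvs.span ((\<lambda>v. v p) ` G x)"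
    by metis
  define P where "P = (\<lambda>x S p. (\<forall>v\<in>G x. v p \<in> fvs.span ((\<lambda>v. v p) ` S \<union> N x p)) \<and>
    (\<forall>v\<in>S. v p \<notin> fvs.span ((\<lambda>v. v p) ` (S - {v}) \<union> N x p)))"
  have dspan: "dsub (\<lambda>p. fvs.span ((\<lambda>v. v p) ` S \<union> N x p))" if "x \<in> verts Q" "S \<subseteq> G x" for x S
  proof -
    have "dsub (\<lambda>p. fvs.span ((\<lambda>v. v p) ` S))"
      using that G(1,2) finite_subset by (intro dsubI[of S]) blast+
    then have "dsub (\<lambda>p. {f + g | f g. f \<in> fvs.span ((\<lambda>v. v p) ` S) \<and> g \<in> N x p})"
      by (intro dsub_sum dN that)
    then show ?thesis
    proof (rule dsub_cong)
      fix p
      assume "p \<in> X"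
      then have "fvs.span (N x p) = N x p"
        using dsub_subspace[OF dN[OF that(1)]] by simp
      then show "{f + g | f g. f \<in> fvs.span ((\<lambda>v. v p) ` S) \<and> g \<in> N x p} =
          fvs.span ((\<lambda>v. v p) ` S \<union> N x p)"
        by (simp only: fvs.span_Un)
    qed
  qed
  have dP: "dpred (P x S)" if "x \<in> verts Q" "S \<subseteq> G x" for x S
  proof -
    have "finite S"
      using that G(1) finite_subset by blast
    then show ?thesis
      unfolding P_def using that G(1,2)
      by (intro dpred_conj dpred_ball dpred_not dpred_mem dspan) auto
  qed
  show ?thesis
  proof (rule dfinI[where P = "\<lambda>\<sigma> p. \<forall>x\<in>verts Q. P x (\<sigma> x) p"
        and h = "\<lambda>\<sigma>. THE d. \<forall>x\<in>verts Q. d = card (\<sigma> x)"])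
    show "finite (\<Pi>\<^sub>E x\<in>verts Q. Pow (G x))"
      using G(1) by (intro finite_PiE) simp_all
    show "dpred (\<lambda>p. \<forall>x\<in>verts Q. P x (\<sigma> x) p)" if "\<sigma> \<in> (\<Pi>\<^sub>E x\<in>verts Q. Pow (G x))" for \<sigma>
      using that by (intro dpred_ball dP finite_verts) auto
  next
    fix p
    assume p: "p \<in> X"
    have "\<exists>S. S \<subseteq> G x \<and> P x S p" if "x \<in> verts Q" for x
      using irredundant_generators_exist[OF G(1)[OF that], of "\<lambda>v. v p" "N x p"]
      unfolding P_def by metis
    then obtain \<sigma> where "\<And>x. x \<in> verts Q \<Longrightarrow> \<sigma> x \<subseteq> G x \<and> P x (\<sigma> x) p"
      by metis
    then show "\<exists>\<sigma>\<in>\<Pi>\<^sub>E x\<in>verts Q. Pow (G x). \<forall>x\<in>verts Q. P x (\<sigma> x) p"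
      by (intro bexI[of _ "restrict \<sigma> (verts Q)"]) auto
  next
    fix p \<sigma>
    assume p: "p \<in> X" and \<sigma>: "\<sigma> \<in> (\<Pi>\<^sub>E x\<in>verts Q. Pow (G x))"
      and P: "\<forall>x\<in>verts Q. P x (\<sigma> x) p"
    interpret rep: presented_rep Q "\<rho> p" "\<lambda>x. U x p" "\<lambda>x. s x p" "\<lambda>a. F a p"
      by (rule rep[OF p])
    have E: "rep.E k = (\<lambda>x. E x p)" and N: "rep.N k = (\<lambda>x. N x p)"
      unfolding E_def N_def R_eq[OF p] by (rule refl)+
    have \<sigma>: "\<sigma> x \<subseteq> G x" "finite (\<sigma> x)" if "x \<in> verts Q" for x
    proof -
      show "\<sigma> x \<subseteq> G x"
        using \<sigma> that by auto
      then show "finite (\<sigma> x)"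
        using G(1)[OF that] by (rule finite_subset)
    qed
    show "global_rank Q (\<rho> p) = (THE d. \<forall>x\<in>verts Q. d = card (\<sigma> x))"
    proof (rule rep.global_rank_eq[where k = k and v = "\<lambda>x v. v p"])
      fix x
      assume x: "x \<in> verts Q"
      show "rep.E (Suc k) x = rep.E k x" "rep.N (Suc k) x = rep.N k x"
        unfolding k_def using rep.E_stable[OF n[OF _ p] x] rep.N_stable[OF n[OF _ p] x] by blast+
      show "finite (\<sigma> x)"
        by (rule \<sigma>(2)[OF x])
      show "(\<lambda>v. v p) ` \<sigma> x \<subseteq> rep.E k x"
        unfolding E G(3)[OF x p] using \<sigma>(1)[OF x] fvs.span_superset by (meson image_mono order.trans)
      show "rep.E k x \<subseteq> fvs.span ((\<lambda>v. v p) ` \<sigma> x \<union> rep.N k x)"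
        unfolding E N G(3)[OF x p] using P x
        by (intro fvs.span_minimal fvs.subspace_span) (auto simp: P_def)
      show "v p \<notin> fvs.span ((\<lambda>v. v p) ` (\<sigma> x - {v}) \<union> rep.N k x)" if "v \<in> \<sigma> x" for v
        unfolding N using P x that by (simp add: P_def)
    qed
  qed
qed

lemma definable_rep_base:
  fixes Q :: "('v, 'e) pre_digraph"
  assumes "definable_rep Q \<rho>"
  shows "definable_rep Q (\<lambda>p. base_rep (\<rho> p))"
proof -
  obtain U s F where "definable_presentation Q \<rho> U s F"
    using assms unfolding definable_rep_def by blast
  note U = definable_presentationD(1)[OF this] and R = definable_presentationD(2)[OF this]
    and pres = definable_presentationD(3)[OF this] and F = definable_presentationD(4)[OF this]
    and F_U = definable_presentationD(5)[OF this] and maps = definable_presentationD(6)[OF this]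
  show ?thesis
    by (rule definable_repI[of Q U "\<lambda>x p f. Base (s x p f)" _ F])
      (use U R F F_U maps in \<open>simp_all add: base_rep_def presented_base_space pres, simp_all add: base_space_def\<close>)
qed

lemma definable_rep_pullback:
  fixes Q Q' :: "('v, 'e) pre_digraph"
  assumes hom: "quiver_hom Q' Q fv fe" and "definable_rep Q \<rho>"
  shows "definable_rep Q' (\<lambda>p. pullback fv fe (\<rho> p))"
proof -
  obtain U s F where "definable_presentation Q \<rho> U s F"
    using assms(2) unfolding definable_rep_def by blast
  note U = definable_presentationD(1)[OF this] and R = definable_presentationD(2)[OF this]
    and pres = definable_presentationD(3)[OF this] and F = definable_presentationD(4)[OF this]
    and F_U = definable_presentationD(5)[OF this] and maps = definable_presentationD(6)[OF this]
  have "fe a \<in> arcs Q" "fv (tail Q' a) = tail Q (fe a)" "fv (head Q' a) = head Q (fe a)"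
    if "a \<in> arcs Q'" for a
    using hom that by (simp_all add: quiver_hom_def)
  moreover have "fv x \<in> verts Q" if "x \<in> verts Q'" for x
    using hom that by (simp add: quiver_hom_def)
  ultimately show ?thesis
    by (intro definable_repI[of Q' "\<lambda>x. U (fv x)" "\<lambda>x. s (fv x)" _ "\<lambda>a. F (fe a)"])
      (simp_all add: pullback_def U R pres F F_U maps)
qed

section \<open>Direct sums and pushforward\<close>

lemma dmap_summand: "dmap (\<lambda>_. summand y)"
  using dmap_reindex[of "\<lambda>j. (y # fst j, snd j)" "\<lambda>_. True"]
  by (simp add: summand_def[abs_def] inj_on_def prod_eq_iff)

lemma dmap_inject: "dmap (\<lambda>_. inject y)"
proof -
  have "inj_on (\<lambda>j. (tl (fst j), snd j)) {j. fst j \<noteq> [] \<and> hd (fst j) = y}"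
    by (auto simp: inj_on_def neq_Nil_conv)
  then show ?thesis
    using dmap_reindex[of "\<lambda>j. (tl (fst j), snd j)" "\<lambda>j. fst j \<noteq> [] \<and> hd (fst j) = y"]
    by (simp add: inject_def[abs_def])
qed

lemma dsub_direct_sum_functions:
  assumes "finite Y" and "\<And>y. y \<in> Y \<Longrightarrow> dsub (V y)"
  shows "dsub (\<lambda>p. direct_sum_functions Y (\<lambda>y. V y p))"
  using assms
proof (induction Y rule: finite_induct)
  case empty
  have "direct_sum_functions {} (\<lambda>y. V y p) = {0}" for p
    by (auto simp: direct_sum_functions_def summand_zero intro: functions_eqI)
  then show ?case
    by (simp add: dsub_zero)
next
  case (insert y Y)
  have "dsub (\<lambda>p. {f + g | f g. f \<in> inject y ` V y p \<and> g \<in> direct_sum_functions Y (\<lambda>y. V y p)})"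
    using insert by (intro dsub_sum dsub_image[OF dmap_inject]) auto
  then show ?case
  proof (rule dsub_cong)
    fix p
    assume "p \<in> X"
    then have "0 \<in> V y p"
      using insert.prems by (intro fvs.subspace_0 dsub_subspace) auto
    then show "{f + g | f g. f \<in> inject y ` V y p \<and> g \<in> direct_sum_functions Y (\<lambda>y. V y p)} =
        direct_sum_functions (insert y Y) (\<lambda>y. V y p)"
      using direct_sum_functions_insert[OF insert.hyps(2), of "\<lambda>y. V y p"] by simp
  qed
qed

text \<open>The lift \<open>F'\<close> over \<open>a\<close> adds up, over the arrows
  \<open>b\<close> above \<open>a\<close>, the map \<open>F b\<close> from the summand at the tail
  to the summand at the head of \<open>b\<close>. Its summand at \<open>z\<close> collects the
  arrows ending in \<open>z\<close>, which is the sum in \<open>pushforward\<close> before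
  \<open>s\<close> is applied.\<close>

lemma definable_rep_pushforward:
  fixes Q R :: "('v, 'e) pre_digraph"
  assumes Q: "fin_digraph Q" and hom: "quiver_hom Q R fv fe" and "definable_rep Q \<rho>"
  shows "definable_rep R (\<lambda>p. pushforward Q R fv fe (\<rho> p))"
proof -
  interpret fin_digraph Q
    by (rule Q)
  obtain U s F where "definable_presentation Q \<rho> U s F"
    using assms(3) unfolding definable_rep_def by blast
  note U = definable_presentationD(1)[OF this] and Ker = definable_presentationD(2)[OF this]
    and pres = definable_presentationD(3)[OF this] and F = definable_presentationD(4)[OF this]
    and F_U = definable_presentationD(5)[OF this] and maps = definable_presentationD(6)[OF this]
  define Y where "Y = (\<lambda>x. {y \<in> verts Q. fv y = x})"
  have Y_eq: "{y \<in> verts Q. fv y = x} = Y x" for x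
    by (simp add: Y_def)
  have Y: "finite (Y x)" "y \<in> Y x \<Longrightarrow> y \<in> verts Q" for x y
    by (simp_all add: Y_def)
  define U' where "U' = (\<lambda>x p. direct_sum_functions (Y x) (\<lambda>y. U y p))"
  define s' where "s' = (\<lambda>x p f. Family (\<lambda>y\<in>Y x. s y p (summand y f)))"
  define F' where "F' = (\<lambda>a p f. \<Sum>b\<in>{b \<in> arcs Q. fe b = a}.
    inject (head Q b) (F b p (summand (tail Q b) f)))"
  have fe: "tail Q b \<in> Y (tail R (fe b))" "head Q b \<in> Y (head R (fe b))" if "b \<in> arcs Q" for b
    using hom that by (simp_all add: quiver_hom_def Y_def)
  have summand_F': "summand z (F' a p f) =
      (\<Sum>b\<in>{b \<in> arcs Q. fe b = a \<and> head Q b = z}. F b p (summand (tail Q b) f))" for z a p f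
  proof -
    have "summand z (F' a p f) = (\<Sum>b\<in>{b \<in> arcs Q. fe b = a}.
        if head Q b = z then F b p (summand (tail Q b) f) else 0)"
      unfolding F'_def summand_sum by (intro sum.cong) (auto simp: summand_inject)
    also have "\<dots> = (\<Sum>b\<in>{b \<in> {b \<in> arcs Q. fe b = a}. head Q b = z}. F b p (summand (tail Q b) f))"
      by (intro sum.inter_filter[symmetric]) simp
    finally show ?thesis
      by (simp add: conj_assoc)
  qed
  have F_summand: "F b p (summand (tail Q b) f) \<in> U (head Q b) p"
    if "b \<in> arcs Q" "p \<in> X" "f \<in> U' (tail R (fe b)) p" for b p f
    using that fe[OF that(1)] by (intro F_U) (auto simp: U'_def direct_sum_functions_def)
  show ?thesis
  proof (rule definable_repI[of R U' s' _ F'])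
    fix x
    assume "x \<in> verts R"
    show "dsub (U' x)"
      unfolding U'_def using Y U by (intro dsub_direct_sum_functions) auto
    have "dsub (\<lambda>p. direct_sum_functions (Y x) (\<lambda>y. {f \<in> U y p. s y p f = \<zero>\<^bsub>space (\<rho> p) y\<^esub>}))"
      using Y Ker by (intro dsub_direct_sum_functions) auto
    then show "dsub (\<lambda>p. {f \<in> U' x p. s' x p f = \<zero>\<^bsub>space (pushforward Q R fv fe (\<rho> p)) x\<^esub>})"
    proof (rule dsub_cong)
      fix p
      have zero: "\<zero>\<^bsub>space (pushforward Q R fv fe (\<rho> p)) x\<^esub> = Family (\<lambda>y\<in>Y x. \<zero>\<^bsub>space (\<rho> p) y\<^esub>)"
        by (simp add: pushforward_def direct_sum_space_def Y_def)
      have "s' x p f = \<zero>\<^bsub>space (pushforward Q R fv fe (\<rho> p)) x\<^esub> \<longleftrightarrow>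
          (\<forall>y\<in>Y x. s y p (summand y f) = \<zero>\<^bsub>space (\<rho> p) y\<^esub>)" for f
        unfolding zero s'_def by (auto simp: restrict_def fun_eq_iff)
      then show "direct_sum_functions (Y x) (\<lambda>y. {f \<in> U y p. s y p f = \<zero>\<^bsub>space (\<rho> p) y\<^esub>}) =
          {f \<in> U' x p. s' x p f = \<zero>\<^bsub>space (pushforward Q R fv fe (\<rho> p)) x\<^esub>}"
        by (auto simp: U'_def direct_sum_functions_def)
    qed
    show "presented (space (pushforward Q R fv fe (\<rho> p)) x) (U' x p) (s' x p)" if "p \<in> X" for p
      using presented_direct_sum[of "Y x" "space (\<rho> p)" "\<lambda>y. U y p" "\<lambda>y. s y p"] Y pres that
      by (simp add: U'_def s'_def pushforward_def Y_eq)
  next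
    fix a
    assume a: "a \<in> arcs R"
    show "dmap (F' a)"
      unfolding F'_def
      by (intro dmap_sum dmap_comp[OF dmap_comp[OF dmap_summand F] dmap_inject]) simp
    fix p f
    assume p: "p \<in> X" and f: "f \<in> U' (tail R a) p"
    have sum_mem: "(\<Sum>b\<in>{b \<in> arcs Q. fe b = a \<and> head Q b = z}. F b p (summand (tail Q b) f)) \<in> U z p"
      if "z \<in> verts Q" for z
      using F_summand[OF _ p] f presented.subspace_U[OF pres[OF that p]]
      by (intro fvs.subspace_sum) auto
    \<comment> \<open>No arrow above \<open>a\<close> ends at such a \<open>z\<close>, because heads
      lie over heads.\<close>
    have "(\<Sum>b\<in>{b \<in> arcs Q. fe b = a \<and> head Q b = z}. F b p (summand (tail Q b) f)) = 0"
      if "z \<notin> Y (head R a)" for z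
      using fe that by (intro sum.neutral) auto
    then show "F' a p f \<in> U' (head R a) p"
      using sum_mem Y(2) unfolding U'_def direct_sum_functions_def mem_Collect_eq summand_F'
      by (auto simp: F'_def sum_inject_Nil)
    have "(\<Oplus>\<^bsub>space (\<rho> p) z\<^esub>b\<in>{b \<in> arcs Q. fe b = a \<and> head Q b = z}.
          maps (\<rho> p) b (component (s' (tail R a) p f) (tail Q b))) =
        s z p (summand z (F' a p f))" if z: "z \<in> Y (head R a)" for z
    proof -
      interpret Z: presented "space (\<rho> p) z" "U z p" "s z p"
        by (rule pres[OF Y(2)[OF z] p])
      interpret V: vectorspace class_ring "space (\<rho> p) z"
        by (rule Z.vectorspace)
      let ?B = "{b \<in> arcs Q. fe b = a \<and> head Q b = z}"
      have mem: "F b p (summand (tail Q b) f) \<in> U z p"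
        and eq: "maps (\<rho> p) b (component (s' (tail R a) p f) (tail Q b)) =
          s z p (F b p (summand (tail Q b) f))" if b: "b \<in> ?B" for b
      proof -
        have "tail Q b \<in> Y (tail R a)"
          using fe(1)[of b] b by auto
        then show "maps (\<rho> p) b (component (s' (tail R a) p f) (tail Q b)) =
            s z p (F b p (summand (tail Q b) f))"
          using maps[of b p] b p f by (auto simp: s'_def U'_def direct_sum_functions_def)
        show "F b p (summand (tail Q b) f) \<in> U z p"
          using F_summand[of b p f] p f b by auto
      qed
      have "(\<Oplus>\<^bsub>space (\<rho> p) z\<^esub>b\<in>?B. maps (\<rho> p) b (component (s' (tail R a) p f) (tail Q b))) =
          (\<Oplus>\<^bsub>space (\<rho> p) z\<^esub>b\<in>?B. s z p (F b p (summand (tail Q b) f)))"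
        using mem eq Z.s_carrier by (intro V.M.finsum_cong') auto
      also have "\<dots> = s z p (summand z (F' a p f))"
        unfolding summand_F' using mem by (intro Z.s_sum[symmetric]) simp_all
      finally show ?thesis .
    qed
    then show "maps (pushforward Q R fv fe (\<rho> p)) a (s' (tail R a) p f) = s' (head R a) p (F' a p f)"
      by (simp add: pushforward_def s'_def Y_eq cong: restrict_cong)
  qed
qed

lemma dfin_rank_after_steps:
  fixes Q :: "('v, 'e) pre_digraph"
  assumes "fin_digraph Q" and "step_sequence Q ss" and "definable_rep Q \<rho>"
  shows "dfin (\<lambda>p. rank_after_steps Q ss (\<rho> p))"
  using assms
proof (induction ss arbitrary: Q \<rho>)
  case Nil
  then show ?case
    by (simp add: dfin_global_rank)
next
  case (Cons st ss)
  show ?case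
  proof (cases st)
    case (Push R fv fe)
    then have "definable_rep R (\<lambda>p. pushforward Q R fv fe (\<rho> p))"
      using Cons.prems by (intro definable_rep_pushforward) simp_all
    then show ?thesis
      using Cons.IH[of R "\<lambda>p. pushforward Q R fv fe (\<rho> p)"] Cons.prems Push by (simp add: quiver_def)
  next
    case (Pull R fv fe)
    then have "definable_rep R (\<lambda>p. pullback fv fe (\<rho> p))"
      using Cons.prems by (intro definable_rep_pullback) simp_all
    then show ?thesis
      using Cons.IH[of R "\<lambda>p. pullback fv fe (\<rho> p)"] Cons.prems Pull by (simp add: quiver_def)
  qed
qed

lemma dfin_rank_function:
  assumes "quiver Q" and "step_sequence Q ss" and "definable_rep Q \<rho>"
  shows "dfin (\<lambda>p. rank_function Q ss (\<rho> p))"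
  unfolding rank_function_def using assms
  by (intro dfin_rank_after_steps definable_rep_base) (simp_all add: quiver_def)

end

section \<open>The Zariski topology on affine space\<close>

lemma polynomial_uminus: "f \<in> polynomial_functions I \<Longrightarrow> (\<lambda>p. - f p) \<in> polynomial_functions I"
  using polynomial_functions.mult[OF polynomial_functions.const[of "-1"]] by simp

lemma polynomial_diff:
  "f \<in> polynomial_functions I \<Longrightarrow> g \<in> polynomial_functions I \<Longrightarrow>
    (\<lambda>p. f p - g p) \<in> polynomial_functions I"
  using polynomial_functions.add[OF _ polynomial_uminus, of f I g] by simp

lemma polynomial_power: "f \<in> polynomial_functions I \<Longrightarrow> (\<lambda>p. f p ^ n) \<in> polynomial_functions I"
  by (induction n) (simp_all add: polynomial_functions.const polynomial_functions.mult)

text \<open>The nonvanishing sets of polynomials form a base and not just a subbase: intersections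
  correspond to products. So one polynomial per point suffices.\<close>

lemma openin_zariski_affine:
  "openin (zariski_affine I) S \<longleftrightarrow> S \<subseteq> affine_space I \<and>
    (\<forall>p\<in>S. \<exists>f\<in>polynomial_functions I. f p \<noteq> 0 \<and> (\<forall>q\<in>affine_space I. f q \<noteq> 0 \<longrightarrow> q \<in> S))"
    (is "?L \<longleftrightarrow> ?R S")
proof
  let ?B = "{{p \<in> affine_space I. f p \<noteq> 0} | f. f \<in> polynomial_functions I}"
  assume ?L
  then have "generate_topology_on ?B S"
    unfolding zariski_affine_def openin_topology_generated_by_iff .
  then show "?R S"
  proof induction
    case Empty
    show ?case
      by simp
  next
    case (Int a b)
    show ?case
    proof (intro conjI ballI)
      show "a \<inter> b \<subseteq> affine_space I"
        using Int by blast
      fix p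
      assume "p \<in> a \<inter> b"
      then obtain f g where
        f: "f \<in> polynomial_functions I" "f p \<noteq> 0" "\<forall>q\<in>affine_space I. f q \<noteq> 0 \<longrightarrow> q \<in> a"
        and g: "g \<in> polynomial_functions I" "g p \<noteq> 0" "\<forall>q\<in>affine_space I. g q \<noteq> 0 \<longrightarrow> q \<in> b"
        using Int.IH by blast
      then show "\<exists>f\<in>polynomial_functions I. f p \<noteq> 0 \<and> (\<forall>q\<in>affine_space I. f q \<noteq> 0 \<longrightarrow> q \<in> a \<inter> b)"
        by (intro bexI[of _ "\<lambda>p. f p * g p"]) (simp_all add: polynomial_functions.mult)
    qed
  next
    case (UN K)
    show ?case
    proof (intro conjI ballI)
      show "\<Union>K \<subseteq> affine_space I"
        using UN by blast
      fix p
      assume "p \<in> \<Union>K"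
      then obtain a where "a \<in> K" "p \<in> a"
        by blast
      then show "\<exists>f\<in>polynomial_functions I. f p \<noteq> 0 \<and> (\<forall>q\<in>affine_space I. f q \<noteq> 0 \<longrightarrow> q \<in> \<Union>K)"
        using UN.IH[of a] by blast
    qed
  next
    case (Basis s)
    then show ?case
      by auto
  qed
next
  assume R: "?R S"
  have "openin (zariski_affine I) {p \<in> affine_space I. f p \<noteq> 0}" if "f \<in> polynomial_functions I" for f
    unfolding zariski_affine_def using that by (intro topology_generated_by_Basis) blast
  then have "openin (zariski_affine I)
      (\<Union>f\<in>{f \<in> polynomial_functions I. \<forall>q\<in>affine_space I. f q \<noteq> 0 \<longrightarrow> q \<in> S}. {p \<in> affine_space I. f p \<noteq> 0})"
    by (intro openin_Union) auto
  moreover have "(\<Union>f\<in>{f \<in> polynomial_functions I. \<forall>q\<in>affine_space I. f q \<noteq> 0 \<longrightarrow> q \<in> S}.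
      {p \<in> affine_space I. f p \<noteq> 0}) = S"
    using R by blast
  ultimately show ?L
    by simp
qed

lemma openin_nonzero:
  "f \<in> polynomial_functions I \<Longrightarrow> openin (zariski_affine I) {p \<in> affine_space I. f p \<noteq> 0}"
  by (auto simp: openin_zariski_affine)

lemma topspace_zariski_affine:
  fixes I :: "'i set"
  shows "topspace (zariski_affine I :: ('i \<Rightarrow> 'k::field) topology) = affine_space I"
proof
  show "topspace (zariski_affine I :: ('i \<Rightarrow> 'k) topology) \<subseteq> affine_space I"
    using openin_topspace[of "zariski_affine I :: ('i \<Rightarrow> 'k) topology"]
    unfolding openin_zariski_affine by (rule conjunct1)
  have "openin (zariski_affine I :: ('i \<Rightarrow> 'k) topology) (affine_space I)"
    using openin_nonzero[OF polynomial_functions.const[of "1 :: 'k" I]] by simp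
  then show "affine_space I \<subseteq> topspace (zariski_affine I :: ('i \<Rightarrow> 'k) topology)"
    by (rule openin_subset)
qed

section \<open>Constructible sets\<close>

lemma constructible_subset: "constructible X S \<Longrightarrow> S \<subseteq> topspace X"
  by (induction rule: constructible.induct) (auto dest: openin_subset closedin_subset)

lemma constructible_empty: "constructible X {}"
  by (simp add: constructible.intros(1))

text \<open>Complements are not among the generating operations; they exchange open with closed sets
  and unions with intersections.\<close>

lemma constructible_complement: "constructible X S \<Longrightarrow> constructible X (topspace X - S)"
proof (induction rule: constructible.induct)
  case (3 S T)
  then show ?case
    by (simp add: Diff_Un constructible.intros(4))
next
  case (4 S T)
  then show ?case
    by (simp add: Diff_Int constructible.intros(3))
qed (auto intro: constructible.intros(1,2))

lemma constructible_diff: "constructible X S \<Longrightarrow> constructible X T \<Longrightarrow> constructible X (S - T)"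
  using constructible.intros(4)[OF _ constructible_complement, of X S T] constructible_subset[of X S]
  by (metis Diff_Int_distrib Diff_Int_distrib2 Int_Diff inf.absorb1)

lemma constructible_UN:
  "finite A \<Longrightarrow> (\<And>a. a \<in> A \<Longrightarrow> constructible X (S a)) \<Longrightarrow> constructible X (\<Union>a\<in>A. S a)"
  by (induction A rule: finite_induct) (simp_all add: constructible_empty constructible.intros(3))

lemma constructible_subtopology:
  "constructible X S \<Longrightarrow> constructible (subtopology X Y) (S \<inter> Y)"
proof (induction rule: constructible.induct)
  case (1 S)
  then show ?case
    by (intro constructible.intros(1)) (auto simp: openin_subtopology)
next
  case (2 S)
  then show ?case
    by (intro constructible.intros(2)) (auto simp: closedin_subtopology)
next
  case (3 S T)
  then show ?case
    by (simp add: Int_Un_distrib2 constructible.intros(3))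
next
  case (4 S T)
  then show ?case
    using constructible.intros(4)[OF 4(3,4)] by (simp add: Int_assoc Int_left_commute Int_absorb)
qed

section \<open>Piecewise polynomial functions\<close>

text \<open>Pieces are cut out by constructible sets of the whole affine space, while
  \<open>restrict\<close> forgets all values off \<open>X\<close>. Denominators do not occur because
  elimination works with ring operations and zero tests.\<close>

inductive_set piecewise_polynomials :: "'i set \<Rightarrow> ('i \<Rightarrow> 'k) set \<Rightarrow> (('i \<Rightarrow> 'k::field) \<Rightarrow> 'k) set"
  for I :: "'i set" and X :: "('i \<Rightarrow> 'k) set" where
  polynomial: "f \<in> polynomial_functions I \<Longrightarrow> f \<in> piecewise_polynomials I X"
| split: "constructible (zariski_affine I) C \<Longrightarrow> f \<in> piecewise_polynomials I X \<Longrightarrow>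
    g \<in> piecewise_polynomials I X \<Longrightarrow> (\<lambda>p. if p \<in> C then f p else g p) \<in> piecewise_polynomials I X"
| restrict: "f \<in> piecewise_polynomials I X \<Longrightarrow> (\<And>p. p \<in> X \<Longrightarrow> f p = g p) \<Longrightarrow>
    g \<in> piecewise_polynomials I X"

text \<open>Values off \<open>X\<close> are arbitrary, so \<open>C\<close> can be controlled only
  through its trace on \<open>X\<close>.\<close>

lemma piecewise_polynomials_zero_set:
  assumes "f \<in> piecewise_polynomials I X" and "X \<subseteq> affine_space I"
  obtains C where "constructible (zariski_affine I) C" "X \<inter> C = {p \<in> X. f p = 0}"
proof -
  have "\<exists>C. constructible (zariski_affine I) C \<and> X \<inter> C = {p \<in> X. f p = 0}"
    using assms(1)
  proof induction
    case (polynomial f)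
    have "constructible (zariski_affine I) (affine_space I - {p \<in> affine_space I. f p \<noteq> 0})"
      using constructible_complement[OF constructible.intros(1)[OF openin_nonzero[OF polynomial]]]
      by (simp add: topspace_zariski_affine)
    moreover have "X \<inter> (affine_space I - {p \<in> affine_space I. f p \<noteq> 0}) = {p \<in> X. f p = 0}"
      using assms(2) by auto
    ultimately show ?case
      by blast
  next
    case (split C f g)
    then obtain A B where A: "constructible (zariski_affine I) A" "X \<inter> A = {p \<in> X. f p = 0}"
      and B: "constructible (zariski_affine I) B" "X \<inter> B = {p \<in> X. g p = 0}"
      by blast
    have "constructible (zariski_affine I) ((A \<inter> C) \<union> (B - C))"
      by (intro constructible.intros(3,4) constructible_diff A(1) B(1) split.hyps(1))
    moreover have "X \<inter> ((A \<inter> C) \<union> (B - C)) = {p \<in> X. (if p \<in> C then f p else g p) = 0}"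
    proof (rule Set.set_eqI)
      fix p
      have "p \<in> X \<and> p \<in> A \<longleftrightarrow> p \<in> X \<and> f p = 0" "p \<in> X \<and> p \<in> B \<longleftrightarrow> p \<in> X \<and> g p = 0"
        using A(2) B(2) by blast+
      then show "p \<in> X \<inter> ((A \<inter> C) \<union> (B - C)) \<longleftrightarrow> p \<in> {p \<in> X. (if p \<in> C then f p else g p) = 0}"
        by (cases "p \<in> C") auto
    qed
    ultimately show ?case
      by blast
  next
    case (restrict f g)
    have "{p \<in> X. f p = 0} = {p \<in> X. g p = 0}"
      using restrict.hyps by auto
    then show ?case
      using restrict.IH by simp
  qed
  then show ?thesis
    using that by blast
qed

text \<open>Induction on \<open>f\<close> and then on \<open>g\<close> pushes the operation through
  all case distinctions until both arguments are polynomials.\<close>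

lemma piecewise_polynomials_binary:
  assumes "f \<in> piecewise_polynomials I X" and "g \<in> piecewise_polynomials I X"
    and op: "\<And>f g. f \<in> polynomial_functions I \<Longrightarrow> g \<in> polynomial_functions I \<Longrightarrow>
      (\<lambda>p. h (f p) (g p)) \<in> piecewise_polynomials I X"
  shows "(\<lambda>p. h (f p) (g p)) \<in> piecewise_polynomials I X"
  using assms(1)
proof induction
  case (polynomial f)
  show ?case
    using assms(2)
  proof induction
    case (polynomial g)
    then show ?case
      using op \<open>f \<in> polynomial_functions I\<close> by blast
  next
    case (split C g g')
    then have "(\<lambda>p. if p \<in> C then h (f p) (g p) else h (f p) (g' p)) \<in> piecewise_polynomials I X"
      by (intro piecewise_polynomials.split)
    then show ?case
      by (rule piecewise_polynomials.restrict) simp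
  next
    case (restrict g g')
    show ?case
      by (rule piecewise_polynomials.restrict[OF restrict.IH]) (simp add: restrict.hyps)
  qed
next
  case (split C f f')
  then have "(\<lambda>p. if p \<in> C then h (f p) (g p) else h (f' p) (g p)) \<in> piecewise_polynomials I X"
    by (intro piecewise_polynomials.split)
  then show ?case
    by (rule piecewise_polynomials.restrict) simp
next
  case (restrict f f')
  show ?case
    by (rule piecewise_polynomials.restrict[OF restrict.IH]) (simp add: restrict.hyps)
qed

lemma definable_piecewise_polynomials:
  assumes "X \<subseteq> affine_space I"
  shows "definable_functions X (piecewise_polynomials I X :: (('i \<Rightarrow> 'k::field) \<Rightarrow> 'k) set)"
proof
  fix f g :: "('i \<Rightarrow> 'k) \<Rightarrow> 'k" and c :: 'k
  show "(\<lambda>_. c) \<in> piecewise_polynomials I X"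
    by (intro piecewise_polynomials.polynomial polynomial_functions.const)
  assume f: "f \<in> piecewise_polynomials I X"
  show "(\<lambda>p. of_bool (f p = 0)) \<in> piecewise_polynomials I X"
  proof -
    obtain C where C: "constructible (zariski_affine I) C" "X \<inter> C = {p \<in> X. f p = 0}"
      using f assms by (rule piecewise_polynomials_zero_set)
    have "(\<lambda>p. if p \<in> C then 1 else 0 :: 'k) \<in> piecewise_polynomials I X"
      by (intro piecewise_polynomials.split C piecewise_polynomials.polynomial polynomial_functions.const)
    moreover have "p \<in> C \<longleftrightarrow> f p = 0" if "p \<in> X" for p
      using C(2) that by blast
    ultimately show ?thesis
      by (elim piecewise_polynomials.restrict) simp
  qed
  show "g \<in> piecewise_polynomials I X" if "\<And>p. p \<in> X \<Longrightarrow> f p = g p"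
    using f that by (rule piecewise_polynomials.restrict)
  assume g: "g \<in> piecewise_polynomials I X"
  show "(\<lambda>p. f p + g p) \<in> piecewise_polynomials I X"
    using f g by (rule piecewise_polynomials_binary)
      (intro piecewise_polynomials.polynomial polynomial_functions.add)
  show "(\<lambda>p. f p * g p) \<in> piecewise_polynomials I X"
    using f g by (rule piecewise_polynomials_binary)
      (intro piecewise_polynomials.polynomial polynomial_functions.mult)
qed

section \<open>Subspaces as graphs over coordinate subspaces\<close>

definition graph :: "nat \<Rightarrow> nat set \<Rightarrow> (nat \<Rightarrow> nat \<Rightarrow> 'k::field) \<Rightarrow> 'k vec set" where
  "graph n J q = {w \<in> carrier_vec n. \<forall>i\<in>{..<n} - J. w $ i = (\<Sum>j\<in>J. q i j * w $ j)}"

text \<open>Column vectors are presented by the functions supported on the indices \<open>([], i)\<close> with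
  \<open>i < n\<close>.\<close>

definition column :: "nat \<Rightarrow> ('v list \<times> nat \<Rightarrow> 'k) \<Rightarrow> 'k vec" where
  "column n f = vec n (\<lambda>i. f ([], i))"

definition column_functions :: "nat \<Rightarrow> ('v list \<times> nat \<Rightarrow> 'k::zero) set" where
  "column_functions n = {f. \<forall>j. \<not> (fst j = [] \<and> snd j < n) \<longrightarrow> f j = 0}"

definition graph_functions ::
  "nat \<Rightarrow> nat set \<Rightarrow> (nat \<Rightarrow> nat \<Rightarrow> 'k::field) \<Rightarrow> ('v list \<times> nat \<Rightarrow> 'k) set" where
  "graph_functions n J q =
     {f \<in> column_functions n. \<forall>i\<in>{..<n} - J. f ([], i) = (\<Sum>j\<in>J. q i j * f ([], j))}"

text \<open>Column \<open>j\<close> of the block matrix with the identity in the rows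
  \<open>J\<close> and \<open>q\<close> in the remaining rows.\<close>

definition graph_basis :: "nat \<Rightarrow> nat set \<Rightarrow> (nat \<Rightarrow> nat \<Rightarrow> 'k::field) \<Rightarrow> nat \<Rightarrow> 'v list \<times> nat \<Rightarrow> 'k" where
  "graph_basis n J q j =
     (\<lambda>(l, i). if l = [] \<and> i < n then if i \<in> J then of_bool (i = j) else q i j else 0)"

lemma sum_fun_apply: "(\<Sum>a\<in>A. f a) i = (\<Sum>a\<in>A. f a i)"
proof (induction A rule: infinite_finite_induct)
  case (insert a A)
  show ?case
    unfolding sum.insert[OF insert.hyps] plus_fun_apply insert.IH ..
qed simp_all

lemma column_index: "i < n \<Longrightarrow> column n f $ i = f ([], i)"
  by (simp add: column_def)

lemma column_functions_eqI:
  assumes "f \<in> column_functions n" and "g \<in> column_functions n"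
    and "\<And>i. i < n \<Longrightarrow> f ([], i) = g ([], i)"
  shows "f = g"
proof
  fix j :: "'a list \<times> nat"
  show "f j = g j"
    using assms by (cases j; cases "fst j = [] \<and> snd j < n") (auto simp: column_functions_def)
qed

lemma column_surj:
  assumes "w \<in> carrier_vec n"
  shows "\<exists>f\<in>column_functions n. w = column n f"
  using assms
  by (intro bexI[of _ "\<lambda>(l, i). if l = [] \<and> i < n then w $ i else 0"])
    (auto simp: column_functions_def column_def)

lemma subspace_column_functions: "fvs.subspace (column_functions n)"
  by (rule fvs.subspaceI) (auto simp: column_functions_def fscale_apply)

lemma presented_module_vec:
  "presented (module_vec TYPE('k::field) n) (column_functions n :: ('v list \<times> nat \<Rightarrow> 'k) set) (column n)"
proof
  show "fvs.subspace (column_functions n :: ('v list \<times> nat \<Rightarrow> 'k) set)"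
    by (rule subspace_column_functions)
  show "carrier (module_vec TYPE('k) n) = column n ` (column_functions n :: ('v list \<times> nat \<Rightarrow> 'k) set)"
    using column_surj by (fastforce simp: module_vec_def column_def)
qed (auto simp: module_vec_def column_def fscale_apply)

lemma column_inj:
  "f \<in> column_functions n \<Longrightarrow> g \<in> column_functions n \<Longrightarrow> column n f = column n g \<Longrightarrow> f = g"
  by (rule column_functions_eqI) (auto simp: column_def vec_eq_iff)

lemma column_graph_functions:
  assumes "J \<subseteq> {..<n}"
  shows "column n ` (graph_functions n J q :: ('v list \<times> nat \<Rightarrow> 'k::field) set) = graph n J q"
proof -
  have "column n f \<in> graph n J q \<longleftrightarrow> f \<in> graph_functions n J q"
    if "f \<in> column_functions n" for f :: "'v list \<times> nat \<Rightarrow> 'k"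
  proof -
    have "(\<Sum>j\<in>J. q i j * column n f $ j) = (\<Sum>j\<in>J. q i j * f ([], j))" for i
      using assms by (intro sum.cong) (auto simp: column_index)
    then show ?thesis
      using that by (simp add: graph_def graph_functions_def column_index) (simp add: column_def)
  qed
  moreover have "graph_functions n J q \<subseteq> (column_functions n :: ('v list \<times> nat \<Rightarrow> 'k) set)"
    by (auto simp: graph_functions_def)
  moreover have "\<exists>f\<in>column_functions n :: ('v list \<times> nat \<Rightarrow> 'k) set. w = column n f" if "w \<in> graph n J q" for w
    using that by (intro column_surj) (simp add: graph_def)
  ultimately show ?thesis
    by blast
qed

lemma subspace_graph_functions: "fvs.subspace (graph_functions n J q)"
proof (rule fvs.subspaceI)
  show "0 \<in> graph_functions n J q"
    by (simp add: graph_functions_def fvs.subspace_0[OF subspace_column_functions])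
  show "f + g \<in> graph_functions n J q" if "f \<in> graph_functions n J q" "g \<in> graph_functions n J q" for f g
    using that
    by (simp add: graph_functions_def fvs.subspace_add[OF subspace_column_functions] algebra_simps sum.distrib)
  show "fscale c f \<in> graph_functions n J q" if "f \<in> graph_functions n J q" for c f
    using that
    by (simp add: graph_functions_def fvs.subspace_scale[OF subspace_column_functions] fscale_apply
        sum_distrib_left mult.left_commute)
qed

lemma graph_basis_column: "graph_basis n J q j \<in> column_functions n"
  by (auto simp: graph_basis_def column_functions_def)

lemma graph_basis_mem:
  assumes "J \<subseteq> {..<n}" and "j \<in> J"
  shows "graph_basis n J q j \<in> graph_functions n J q"
proof -
  have "finite J"
    using assms(1) finite_subset by blast
  have "(\<Sum>l\<in>J. q i l * graph_basis n J q j ([], l)) = (\<Sum>l\<in>J. if l = j then q i l else 0)" for i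
    using assms by (intro sum.cong) (auto simp: graph_basis_def)
  then have "(\<Sum>l\<in>J. q i l * graph_basis n J q j ([], l)) = q i j" for i
    using \<open>finite J\<close> assms(2) by simp
  then show ?thesis
    by (simp add: graph_functions_def graph_basis_column) (simp add: graph_basis_def)
qed

lemma graph_functions_span:
  fixes q :: "nat \<Rightarrow> nat \<Rightarrow> 'k::field"
  assumes "J \<subseteq> {..<n}"
  shows "(graph_functions n J q :: ('v list \<times> nat \<Rightarrow> 'k) set) = fvs.span (graph_basis n J q ` J)"
    (is "?G = fvs.span (?b ` J)")
proof
  have "finite J"
    using assms finite_subset by blast
  show "fvs.span (?b ` J) \<subseteq> ?G"
    using graph_basis_mem[OF assms] by (intro fvs.span_minimal subspace_graph_functions) blast
  show "?G \<subseteq> fvs.span (?b ` J)"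
  proof
    fix f :: "'v list \<times> nat \<Rightarrow> 'k"
    assume f: "f \<in> ?G"
    \<comment> \<open>The coefficients are the coordinates of \<open>f\<close> in \<open>J\<close>,
      because the basis restricts to the standard basis there.\<close>
    let ?g = "\<Sum>j\<in>J. fscale (f ([], j)) (?b j)"
    have "?g \<in> column_functions n"
      by (intro fvs.subspace_sum fvs.subspace_scale subspace_column_functions graph_basis_column)
    moreover have "f ([], i) = ?g ([], i)" if "i < n" for i
    proof -
      have "?g ([], i) = (\<Sum>j\<in>J. f ([], j) * ?b j ([], i))"
        by (simp add: sum_fun_apply fscale_apply)
      also have "\<dots> = f ([], i)"
      proof (cases "i \<in> J")
        case True
        have "(\<Sum>j\<in>J. f ([], j) * ?b j ([], i)) = (\<Sum>j\<in>J. if i = j then f ([], j) else 0)"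
          using True that by (intro sum.cong) (auto simp: graph_basis_def)
        then show ?thesis
          using \<open>finite J\<close> True by simp
      next
        case False
        then show ?thesis
          using f that by (simp add: graph_functions_def graph_basis_def mult.commute)
      qed
      finally show ?thesis ..
    qed
    ultimately have "f = ?g"
      using f by (intro column_functions_eqI) (auto simp: graph_functions_def)
    also have "\<dots> \<in> fvs.span (?b ` J)"
      by (intro fvs.span_sum fvs.span_scale fvs.span_base imageI)
    finally show "f \<in> fvs.span (?b ` J)" .
  qed
qed

lemma presented_graph:
  assumes "J \<subseteq> {..<n}"
  shows "presented ((module_vec TYPE('k::field) n)\<lparr>carrier := graph n J q\<rparr>)
    (graph_functions n J q :: ('v list \<times> nat \<Rightarrow> 'k) set) (column n)"
proof -
  have "graph_functions n J q \<subseteq> (column_functions n :: ('v list \<times> nat \<Rightarrow> 'k) set)"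
    by (auto simp: graph_functions_def)
  then show ?thesis
    using presented.presented_sub[OF presented_module_vec subspace_graph_functions]
      column_graph_functions[OF assms] by metis
qed

lemma column_eq_zero_iff:
  assumes "f \<in> column_functions n"
  shows "column n f = \<zero>\<^bsub>module_vec TYPE('k::field) n\<^esub> \<longleftrightarrow> f = (0 :: 'v list \<times> nat \<Rightarrow> 'k)"
  using presented.s_zero[OF presented_module_vec, of n] column_inj[OF assms, of 0]
    fvs.subspace_0[OF subspace_column_functions, of n] by metis

lemma dim_graph:
  fixes q :: "nat \<Rightarrow> nat \<Rightarrow> 'k::field"
  assumes "J \<subseteq> {..<n}"
  shows "vectorspace.dim class_ring ((module_vec TYPE('k) n)\<lparr>carrier := graph n J q\<rparr>) = card J"
proof (rule presented.dim_eq_card[OF presented_graph[OF assms]])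
  \<comment> \<open>The statement fixes no type for the list entries of the index set, so
    \<open>unit\<close> is chosen.\<close>
  let ?v = "graph_basis n J q :: nat \<Rightarrow> unit list \<times> nat \<Rightarrow> 'k"
  show "finite J"
    using assms finite_subset by blast
  show "fvs.subspace {0 :: unit list \<times> nat \<Rightarrow> 'k}"
    by (rule fvs.subspace_single_0)
  show "column n f = \<zero>\<^bsub>(module_vec TYPE('k) n)\<lparr>carrier := graph n J q\<rparr>\<^esub> \<longleftrightarrow> f \<in> {0 :: unit list \<times> nat \<Rightarrow> 'k}"
    if "f \<in> graph_functions n J q" for f
    using column_eq_zero_iff[of f n] that by (simp add: graph_functions_def)
  show "?v ` J \<subseteq> graph_functions n J q"
    using graph_basis_mem[OF assms] by blast
  show "graph_functions n J q \<subseteq> fvs.span (?v ` J \<union> {0})"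
    unfolding graph_functions_span[OF assms] by (intro fvs.span_mono) blast
  show "?v a \<notin> fvs.span (?v ` (J - {a}) \<union> {0})" if a: "a \<in> J" for a
  proof
    assume "?v a \<in> fvs.span (?v ` (J - {a}) \<union> {0})"
    \<comment> \<open>Coordinate \<open>a\<close> vanishes on all basis vectors but the one at
      \<open>a\<close>.\<close>
    moreover have "fvs.span (?v ` (J - {a}) \<union> {0}) \<subseteq> {f. f ([], a) = 0}"
    proof (rule fvs.span_minimal)
      show "?v ` (J - {a}) \<union> {0} \<subseteq> {f. f ([], a) = 0}"
        using a by (auto simp: graph_basis_def)
      show "fvs.subspace {f :: unit list \<times> nat \<Rightarrow> 'k. f ([], a) = 0}"
        by (rule fvs.subspaceI) (auto simp: fscale_apply)
    qed
    ultimately have "?v a ([], a) = 0"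
      by blast
    moreover have "?v a ([], a) = 1"
      using a assms by (auto simp: graph_basis_def)
    ultimately show False
      by simp
  qed
qed

text \<open>For a set \<open>J\<close> of coordinates that is minimal among those separating the vectors of \<open>U\<close>, the
  space \<open>U\<close> contains vectors which restrict to the standard basis on \<open>J\<close>.\<close>

lemma subspace_eq_graph_functions:
  fixes U :: "('v list \<times> nat \<Rightarrow> 'k::field) set"
  assumes U: "fvs.subspace U" "U \<subseteq> column_functions n"
  obtains J q where "J \<subseteq> {..<n}" "U = graph_functions n J q"
proof -
  define P where "P = (\<lambda>J. J \<subseteq> {..<n} \<and> (\<forall>f\<in>U. (\<forall>j\<in>J. f ([], j) = 0) \<longrightarrow> f = 0))"
  have "P {..<n}"
  proof -
    have "f = 0" if "f \<in> U" "\<forall>j\<in>{..<n}. f ([], j) = 0" for f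
      using that U(2) fvs.subspace_0[OF subspace_column_functions, of n]
      by (intro column_functions_eqI[of f n 0]) auto
    then show ?thesis
      by (auto simp: P_def)
  qed
  define J where "J = arg_min card P"
  have J: "P J" and least: "\<And>J'. P J' \<Longrightarrow> card J \<le> card J'"
    unfolding J_def using arg_min_nat_lemma[of P "{..<n}" card, OF \<open>P {..<n}\<close>] by blast+
  have Jn: "J \<subseteq> {..<n}" and sep: "\<And>f. f \<in> U \<Longrightarrow> (\<And>j. j \<in> J \<Longrightarrow> f ([], j) = 0) \<Longrightarrow> f = 0"
    using J by (auto simp: P_def)
  have finJ: "finite J"
    using Jn finite_subset by blast
  \<comment> \<open>By minimality \<open>J - {j}\<close> does not separate, so a nonzero vector of
    \<open>U\<close> vanishes on it. Since \<open>J\<close> does separate, its coordinate at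
    \<open>j\<close> is nonzero and can be scaled to 1.\<close>
  have "\<exists>e\<in>U. \<forall>l\<in>J. e ([], l) = of_bool (l = j)" if j: "j \<in> J" for j
  proof -
    have "\<not> P (J - {j})"
      using least[of "J - {j}"] card_Diff1_less[OF finJ j] by auto
    then obtain f where f: "f \<in> U" "f \<noteq> 0" "\<And>l. l \<in> J \<Longrightarrow> l \<noteq> j \<Longrightarrow> f ([], l) = 0"
      using Jn by (auto simp: P_def)
    have "f ([], j) \<noteq> 0"
      using sep[OF f(1)] f(2,3) by metis
    then show ?thesis
      using f(3) by (intro bexI[of _ "fscale (inverse (f ([], j))) f"] fvs.subspace_scale[OF U(1) f(1)])
        (auto simp: fscale_apply)
  qed
  then obtain e where e: "\<And>j. j \<in> J \<Longrightarrow> e j \<in> U" "\<And>j l. j \<in> J \<Longrightarrow> l \<in> J \<Longrightarrow> e j ([], l) = of_bool (l = j)"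
    by metis
  let ?q = "\<lambda>i j. e j ([], i)"
  have basis: "graph_basis n J ?q j = e j" if "j \<in> J" for j
    using e(1)[OF that] e(2)[OF that] U(2) that
    by (intro column_functions_eqI[OF graph_basis_column]) (auto simp: graph_basis_def)
  have "U = graph_functions n J ?q"
  proof
    show "graph_functions n J ?q \<subseteq> U"
      unfolding graph_functions_span[OF Jn] using basis e(1) by (intro fvs.span_minimal U(1)) auto
    show "U \<subseteq> graph_functions n J ?q"
    proof
      fix f
      assume f: "f \<in> U"
      let ?g = "\<Sum>j\<in>J. fscale (f ([], j)) (e j)"
      have "?g \<in> fvs.span (graph_basis n J ?q ` J)"
        using basis by (intro fvs.span_sum fvs.span_scale fvs.span_base) (metis imageI)
      then have g: "?g \<in> graph_functions n J ?q"
        unfolding graph_functions_span[OF Jn] .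
      have "f - ?g = 0"
      proof (rule sep)
        show "f - ?g \<in> U"
          using e(1) by (intro fvs.subspace_diff fvs.subspace_sum fvs.subspace_scale U(1) f)
        fix l
        assume l: "l \<in> J"
        have "?g ([], l) = (\<Sum>j\<in>J. f ([], j) * e j ([], l))"
          by (simp add: sum_fun_apply fscale_apply)
        also have "\<dots> = (\<Sum>j\<in>J. if l = j then f ([], j) else 0)"
          using e(2) l by (intro sum.cong) auto
        finally show "(f - ?g) ([], l) = 0"
          using finJ l by simp
      qed
      then show "f \<in> graph_functions n J ?q"
        using g by simp
    qed
  qed
  then show ?thesis
    using Jn that by blast
qed

text \<open>The exchange step of the simplex method: the equation of row \<open>i\<close> is solved
  for the variable \<open>j\<close>, and the result is substituted into the other rows.\<close>

definition pivot :: "nat \<Rightarrow> nat \<Rightarrow> (nat \<Rightarrow> nat \<Rightarrow> 'k::field) \<Rightarrow> nat \<Rightarrow> nat \<Rightarrow> 'k" where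
  "pivot i j q k l =
     (if k = j then if l = i then inverse (q i j) else - q i l * inverse (q i j)
      else if l = i then q k j * inverse (q i j) else q k l - q k j * q i l * inverse (q i j))"

text \<open>The old equation for \<open>w $ i\<close> and the new one for \<open>w $ j\<close> are
  equivalent because \<open>q i j\<close> is invertible; given them, the remaining equations
  coincide.\<close>

lemma graph_pivot:
  fixes q :: "nat \<Rightarrow> nat \<Rightarrow> 'k::field"
  assumes J: "J \<subseteq> {..<n}" "i < n" "i \<notin> J" "j \<in> J" and q: "q i j \<noteq> 0"
  shows "graph n (insert i (J - {j})) (pivot i j q) = graph n J q"
proof -
  let ?L = "J - {j}"
  have fin: "finite J" and j: "j < n"
    using J finite_subset by auto
  have old: "(\<Sum>l\<in>J. q k l * w $ l) = q k j * w $ j + (\<Sum>l\<in>?L. q k l * w $ l)" for k w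
    by (rule sum.remove[OF fin J(4)])
  have new: "(\<Sum>l\<in>insert i ?L. pivot i j q k l * w $ l) =
      pivot i j q k i * w $ i + (\<Sum>l\<in>?L. pivot i j q k l * w $ l)" for k w
    using fin J(3) by (intro sum.insert) simp_all
  have row_j: "(\<Sum>l\<in>?L. pivot i j q j l * w $ l) = - inverse (q i j) * (\<Sum>l\<in>?L. q i l * w $ l)" for w
  proof -
    have "pivot i j q j l * w $ l = - inverse (q i j) * (q i l * w $ l)" if "l \<in> ?L" for l
      using that J(3) by (auto simp: pivot_def mult_ac)
    then show ?thesis
      unfolding sum_distrib_left by (intro sum.cong refl)
  qed
  have row: "(\<Sum>l\<in>?L. pivot i j q k l * w $ l) =
      (\<Sum>l\<in>?L. q k l * w $ l) - q k j * inverse (q i j) * (\<Sum>l\<in>?L. q i l * w $ l)" if "k \<noteq> j" for k w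
  proof -
    have "pivot i j q k l * w $ l = q k l * w $ l - q k j * inverse (q i j) * (q i l * w $ l)"
      if "l \<in> ?L" for l
      using that J(3) \<open>k \<noteq> j\<close> by (auto simp: pivot_def algebra_simps)
    then show ?thesis
      unfolding sum_distrib_left sum_subtractf[symmetric] by (intro sum.cong refl)
  qed
  have solve: "y = inverse c * x + - inverse c * S \<longleftrightarrow> x = c * y + S" if "c \<noteq> 0" for c x y S :: 'k
  proof -
    have "inverse c * x + - inverse c * S = inverse c * (x - S)"
      by (simp add: right_diff_distrib)
    moreover have "c * (inverse c * (x - S)) = x - S"
      by (subst mult.assoc[symmetric]) (simp add: that)
    moreover have "y = inverse c * (x - S) \<longleftrightarrow> c * y = c * (inverse c * (x - S))"
      using that by simp
    ultimately show ?thesis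
      by (metis add_diff_cancel_right' diff_add_cancel)
  qed
  have exchange: "w $ j = (\<Sum>l\<in>insert i ?L. pivot i j q j l * w $ l) \<longleftrightarrow>
      w $ i = (\<Sum>l\<in>J. q i l * w $ l)" for w
    unfolding old new row_j using solve[OF q] by (simp add: pivot_def)
  \<comment> \<open>Substituting the equation for \<open>w $ i\<close> cancels the correction terms
    of the new row against each other.\<close>
  have other: "(\<Sum>l\<in>insert i ?L. pivot i j q k l * w $ l) = (\<Sum>l\<in>J. q k l * w $ l)"
    if "k \<noteq> j" and i: "w $ i = (\<Sum>l\<in>J. q i l * w $ l)" for k w
  proof -
    have "a * inverse c * (c * y + S) + (T - a * inverse c * S) = a * y + T"
      if "c \<noteq> 0" for a c y S T :: 'k
    proof -
      have "a * inverse c * (c * y + S) + (T - a * inverse c * S) = a * (inverse c * c) * y + T"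
        by (simp add: algebra_simps)
      then show ?thesis
        using that by simp
    qed
    from this[OF q] show ?thesis
      unfolding new row[OF that(1)] i unfolding old by (simp add: pivot_def that(1))
  qed
  define D where "D = {..<n} - J - {i}"
  have rows: "{..<n} - insert i ?L = insert j D" "{..<n} - J = insert i D"
    unfolding D_def using J j by auto
  have "(\<forall>k\<in>insert j D. w $ k = (\<Sum>l\<in>insert i ?L. pivot i j q k l * w $ l)) \<longleftrightarrow>
      (\<forall>k\<in>insert i D. w $ k = (\<Sum>l\<in>J. q k l * w $ l))" for w
  proof (cases "w $ i = (\<Sum>l\<in>J. q i l * w $ l)")
    case True
    have "(\<Sum>l\<in>insert i ?L. pivot i j q k l * w $ l) = (\<Sum>l\<in>J. q k l * w $ l)"
      if "k \<in> D" for k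
      using other[OF _ True, of k] that J(4) unfolding D_def by blast
    then have "(\<forall>k\<in>D. w $ k = (\<Sum>l\<in>insert i ?L. pivot i j q k l * w $ l)) \<longleftrightarrow>
        (\<forall>k\<in>D. w $ k = (\<Sum>l\<in>J. q k l * w $ l))"
      by (intro ball_cong refl) (simp only:)
    then show ?thesis
      unfolding ball_simps(7) using True exchange[of w] by blast
  next
    case False
    then show ?thesis
      unfolding ball_simps(7) using exchange[of w] by blast
  qed
  then show ?thesis
    unfolding graph_def rows by simp
qed

text \<open>The basis vector \<open>b\<close> over \<open>J'\<close> at \<open>i\<close> has
  coordinate 1 at \<open>i\<close>, so some term of the row \<open>i\<close> equation over
  \<open>J\<close> is nonzero. Its index \<open>j\<close> differs from \<open>i\<close> and has
  \<open>b\<close> nonzero, whereas \<open>b\<close> vanishes on the rest of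
  \<open>J'\<close>.\<close>

lemma pivot_exists:
  fixes q q' :: "nat \<Rightarrow> nat \<Rightarrow> 'k::field"
  assumes J: "J \<subseteq> {..<n}" "J' \<subseteq> {..<n}" and graph: "graph n J q = graph n J' q'" and i: "i \<in> J' - J"
  obtains j where "j \<in> J - J'" "q i j \<noteq> 0"
proof -
  define b where "b = (graph_basis n J' q' i :: unit list \<times> nat \<Rightarrow> 'k)"
  have "b \<in> graph_functions n J' q'"
    unfolding b_def using i by (intro graph_basis_mem J(2)) simp
  then have "column n b \<in> graph n J q"
    unfolding graph column_graph_functions[where 'v = unit, OF J(2), symmetric] by (rule imageI)
  moreover have "i < n"
    using i J(2) by blast
  ultimately have "column n b $ i = (\<Sum>j\<in>J. q i j * column n b $ j)"
    using i unfolding graph_def by blast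
  moreover have "column n b $ i = 1"
    using i \<open>i < n\<close> by (simp add: column_index b_def graph_basis_def)
  ultimately have "\<not> (\<forall>j\<in>J. q i j * column n b $ j = 0)"
    using sum.neutral[of J "\<lambda>j. q i j * column n b $ j"] by auto
  then obtain j where j: "j \<in> J" "q i j * column n b $ j \<noteq> 0"
    by blast
  have "j < n"
    using j(1) J(1) by blast
  have "j \<notin> J'"
  proof
    assume "j \<in> J'"
    then have "column n b $ j = 0"
      using i j(1) \<open>j < n\<close> by (auto simp: column_index b_def graph_basis_def)
    then show False
      using j(2) by simp
  qed
  then show ?thesis
    using that[of j] j by simp
qed

section \<open>The charts are open embeddings\<close>

lemma graph_cong:
  "(\<And>i j. i < n \<Longrightarrow> i \<notin> J \<Longrightarrow> j \<in> J \<Longrightarrow> q i j = q' i j) \<Longrightarrow> graph n J q = graph n J q'"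
  unfolding graph_def by (intro Collect_cong conj_cong refl ball_cong arg_cong2[of _ _ _ _ "(=)"] sum.cong) auto

text \<open>The entry \<open>q i j\<close> is the coordinate \<open>i\<close> of the unique vector
  of the space that restricts to the unit vector \<open>j\<close> on \<open>J\<close>.\<close>

lemma graph_inj:
  fixes q q' :: "nat \<Rightarrow> nat \<Rightarrow> 'k::field"
  assumes J: "J \<subseteq> {..<n}" and graph: "graph n J q = graph n J q'" and ij: "i < n" "i \<notin> J" "j \<in> J"
  shows "q i j = q' i j"
proof -
  define b where "b = (graph_basis n J q j :: unit list \<times> nat \<Rightarrow> 'k)"
  have "b \<in> graph_functions n J q"
    unfolding b_def by (intro graph_basis_mem J ij)
  then have "column n b \<in> graph n J q"
    unfolding column_graph_functions[where 'v = unit, OF J, symmetric] by (rule imageI)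
  then have "column n b \<in> graph n J q'"
    unfolding graph .
  then have "column n b $ i = (\<Sum>l\<in>J. q' i l * column n b $ l)"
    using ij unfolding graph_def by blast
  also have "\<dots> = (\<Sum>l\<in>J. if l = j then q' i l else 0)"
    using J by (intro sum.cong refl) (auto simp: column_index b_def graph_basis_def subset_iff)
  also have "\<dots> = q' i j"
    using finite_subset[OF J] ij(3) by simp
  finally show ?thesis
    using ij by (simp add: column_index b_def graph_basis_def)
qed

lemma chart_eq:
  "chart Q \<alpha> J p =
    ((\<lambda>x\<in>verts Q. graph (\<alpha> x) (J x) (\<lambda>i j. p (Gr_coord x i j))),
     (\<lambda>a\<in>arcs Q. mat (\<alpha> (head Q a)) (\<alpha> (tail Q a)) (\<lambda>(i, j). p (Rep_coord a i j))))"
  by (simp add: chart_def graph_def)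

lemma chart_indicesD:
  assumes "J \<in> chart_indices Q \<alpha> \<beta>" and "x \<in> verts Q"
  shows "J x \<subseteq> {..<\<alpha> x}" "card (J x) = \<beta> x" "finite (J x)"
proof -
  show "J x \<subseteq> {..<\<alpha> x}" "card (J x) = \<beta> x"
    using assms by (auto simp: chart_indices_def)
  then show "finite (J x)"
    using finite_subset by blast
qed

lemma Gr_coord_mem [simp]:
  "Gr_coord x i j \<in> chart_coords Q \<alpha> J \<longleftrightarrow> x \<in> verts Q \<and> i < \<alpha> x \<and> i \<notin> J x \<and> j \<in> J x"
  by (auto simp: chart_coords_def)

lemma Rep_coord_mem [simp]:
  "Rep_coord a i j \<in> chart_coords Q \<alpha> J \<longleftrightarrow> a \<in> arcs Q \<and> i < \<alpha> (head Q a) \<and> j < \<alpha> (tail Q a)"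
  by (auto simp: chart_coords_def)

lemma chart_mem:
  fixes p :: "('v, 'e) coordinate \<Rightarrow> 'k::field"
  assumes J: "J \<in> chart_indices Q \<alpha> \<beta>"
  shows "chart Q \<alpha> J p \<in> grassmannian Q \<alpha> \<beta> \<times> rep_space Q \<alpha>"
proof -
  have "VectorSpace.subspace class_ring (graph (\<alpha> x) (J x) q) (module_vec TYPE('k) (\<alpha> x))"
    if "x \<in> verts Q" for x and q :: "nat \<Rightarrow> nat \<Rightarrow> 'k"
  proof -
    have "graph_functions (\<alpha> x) (J x) q \<subseteq> (column_functions (\<alpha> x) :: (unit list \<times> nat \<Rightarrow> 'k) set)"
      by (auto simp: graph_functions_def)
    then show ?thesis
      using presented.subspace_image[OF presented_module_vec subspace_graph_functions]
        column_graph_functions[OF chart_indicesD(1)[OF J that], of q, where 'v = unit] by metis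
  qed
  then show ?thesis
    using chart_indicesD[OF J] by (auto simp: chart_eq grassmannian_def rep_space_def dim_graph)
qed

lemma chart_inj:
  fixes p q :: "('v, 'e) coordinate \<Rightarrow> 'k::field"
  assumes J: "J \<in> chart_indices Q \<alpha> \<beta>"
    and pq: "p \<in> affine_space (chart_coords Q \<alpha> J)" "q \<in> affine_space (chart_coords Q \<alpha> J)"
    and eq: "chart Q \<alpha> J p = chart Q \<alpha> J q"
  shows "p = q"
proof -
  have eq': "graph (\<alpha> x) (J x) (\<lambda>i j. p (Gr_coord x i j)) = graph (\<alpha> x) (J x) (\<lambda>i j. q (Gr_coord x i j))"
    if "x \<in> verts Q" for x
    using eq that unfolding chart_eq prod.inject by (metis (no_types, lifting) restrict_apply')
  have Gr: "p (Gr_coord x i j) = q (Gr_coord x i j)" if "x \<in> verts Q" "i < \<alpha> x" "i \<notin> J x" "j \<in> J x" for x i j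
    using graph_inj[OF chart_indicesD(1)[OF J that(1)] eq'[OF that(1)] that(2-4)] .
  have mats: "mat (\<alpha> (head Q a)) (\<alpha> (tail Q a)) (\<lambda>(i, j). p (Rep_coord a i j)) =
      mat (\<alpha> (head Q a)) (\<alpha> (tail Q a)) (\<lambda>(i, j). q (Rep_coord a i j))" if "a \<in> arcs Q" for a
    using eq that unfolding chart_eq prod.inject by (metis (no_types, lifting) restrict_apply')
  have Rep: "p (Rep_coord a i j) = q (Rep_coord a i j)"
    if "a \<in> arcs Q" "i < \<alpha> (head Q a)" "j < \<alpha> (tail Q a)" for a i j
    using arg_cong[OF mats[OF that(1)], of "\<lambda>M. M $$ (i, j)"] that by simp
  show ?thesis
  proof (rule PiE_ext)
    show "p \<in> (\<Pi>\<^sub>E c\<in>chart_coords Q \<alpha> J. UNIV)" "q \<in> (\<Pi>\<^sub>E c\<in>chart_coords Q \<alpha> J. UNIV)"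
      using pq by (simp_all add: affine_space_def)
    show "p c = q c" if "c \<in> chart_coords Q \<alpha> J" for c
      using that Gr Rep by (cases c) simp_all
  qed
qed

text \<open>Any subspace of columns is a graph over some set of coordinates, and
  \<open>dim_graph\<close> forces that set to have \<open>\<beta> x\<close> elements.\<close>

lemma chart_cover:
  fixes W :: "'v \<Rightarrow> 'k::field vec set"
  assumes W: "W \<in> grassmannian Q \<alpha> \<beta>" and \<phi>: "\<phi> \<in> rep_space Q \<alpha>"
  shows "\<exists>J\<in>chart_indices Q \<alpha> \<beta>. \<exists>p\<in>affine_space (chart_coords Q \<alpha> J). chart Q \<alpha> J p = (W, \<phi>)"
proof -
  have "\<exists>J q. J \<subseteq> {..<\<alpha> x} \<and> card J = \<beta> x \<and> W x = graph (\<alpha> x) J q" if x: "x \<in> verts Q" for x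
  proof -
    have sub: "VectorSpace.subspace class_ring (W x) (module_vec TYPE('k) (\<alpha> x))"
      and dim: "vectorspace.dim class_ring ((module_vec TYPE('k) (\<alpha> x))\<lparr>carrier := W x\<rparr>) = \<beta> x"
      using W x by (auto simp: grassmannian_def)
    let ?U = "{f \<in> column_functions (\<alpha> x) :: (unit list \<times> nat \<Rightarrow> 'k) set. column (\<alpha> x) f \<in> W x}"
    obtain J q where J: "J \<subseteq> {..<\<alpha> x}" "?U = graph_functions (\<alpha> x) J q"
      using presented.subspace_preimage[OF presented_module_vec[where 'v = unit] sub]
      by (rule subspace_eq_graph_functions) auto
    have "W x \<subseteq> carrier (module_vec TYPE('k) (\<alpha> x))"
      using sub by (auto simp: VectorSpace.subspace_def submodule_def)
    then have "W x = column (\<alpha> x) ` ?U"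
      by (rule presented.image_preimage[OF presented_module_vec, symmetric])
    then have "W x = graph (\<alpha> x) J q"
      unfolding J(2) column_graph_functions[OF J(1)] .
    moreover from this have "card J = \<beta> x"
      using dim dim_graph[OF J(1), of q] by simp
    ultimately show ?thesis
      using J(1) by blast
  qed
  then have "\<exists>J q. \<forall>x\<in>verts Q. J x \<subseteq> {..<\<alpha> x} \<and> card (J x) = \<beta> x \<and> W x = graph (\<alpha> x) (J x) (q x)"
    by metis
  then obtain J0 q where Jq: "\<And>x. x \<in> verts Q \<Longrightarrow> J0 x \<subseteq> {..<\<alpha> x}" "\<And>x. x \<in> verts Q \<Longrightarrow> card (J0 x) = \<beta> x"
      "\<And>x. x \<in> verts Q \<Longrightarrow> W x = graph (\<alpha> x) (J0 x) (q x)"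
    by metis
  define J where "J = restrict J0 (verts Q)"
  define p where "p = (\<lambda>c\<in>chart_coords Q \<alpha> J. case c of Gr_coord x i j \<Rightarrow> q x i j | Rep_coord a i j \<Rightarrow> \<phi> a $$ (i, j))"
  have "J \<in> chart_indices Q \<alpha> \<beta>"
    using Jq by (auto simp: J_def chart_indices_def)
  moreover have "p \<in> affine_space (chart_coords Q \<alpha> J)"
    by (simp add: p_def affine_space_def)
  moreover have "chart Q \<alpha> J p = (W, \<phi>)"
  proof -
    have "graph (\<alpha> x) (J x) (\<lambda>i j. p (Gr_coord x i j)) = W x" if "x \<in> verts Q" for x
    proof -
      have "graph (\<alpha> x) (J x) (\<lambda>i j. p (Gr_coord x i j)) = graph (\<alpha> x) (J x) (q x)"
        using that by (intro graph_cong) (simp add: p_def)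
      then show ?thesis
        using Jq(3)[OF that] that by (simp add: J_def)
    qed
    moreover have "mat (\<alpha> (head Q a)) (\<alpha> (tail Q a)) (\<lambda>(i, j). p (Rep_coord a i j)) = \<phi> a"
      if "a \<in> arcs Q" for a
      using \<phi> that by (intro eq_matI) (auto simp: rep_space_def p_def dest!: PiE_mem[of _ _ _ a])
    moreover have "W \<in> extensional (verts Q)" "\<phi> \<in> extensional (arcs Q)"
      using W \<phi> by (auto simp: grassmannian_def rep_space_def PiE_def)
    ultimately show ?thesis
      unfolding chart_eq by (auto simp: extensional_def restrict_def fun_eq_iff)
  qed
  ultimately show ?thesis
    by blast
qed

text \<open>The transition between two charts whose index sets differ by one exchange at
  \<open>x\<close>. It is total, as the inverse of 0 is 0, but it represents the same point only
  where the coordinate at \<open>i\<close>, \<open>j\<close> is nonzero.\<close>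

definition chart_pivot ::
  "('v, 'e) pre_digraph \<Rightarrow> ('v \<Rightarrow> nat) \<Rightarrow> ('v \<Rightarrow> nat set) \<Rightarrow> 'v \<Rightarrow> nat \<Rightarrow> nat \<Rightarrow>
   (('v, 'e) coordinate \<Rightarrow> 'k::field) \<Rightarrow> ('v, 'e) coordinate \<Rightarrow> 'k" where
  "chart_pivot Q \<alpha> J x i j p =
     (\<lambda>c\<in>chart_coords Q \<alpha> (J(x := insert i (J x - {j}))).
        case c of Gr_coord y k l \<Rightarrow> if y = x then pivot i j (\<lambda>k l. p (Gr_coord x k l)) k l else p c
        | Rep_coord a k l \<Rightarrow> p c)"

context
  fixes Q :: "('v, 'e) pre_digraph" and \<alpha> \<beta> :: "'v \<Rightarrow> nat" and J :: "'v \<Rightarrow> nat set" and x :: 'v and i j :: nat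
  assumes J: "J \<in> chart_indices Q \<alpha> \<beta>" and x: "x \<in> verts Q" and i: "i < \<alpha> x" "i \<notin> J x" and j: "j \<in> J x"
begin

lemma chart_indices_pivot: "J(x := insert i (J x - {j})) \<in> chart_indices Q \<alpha> \<beta>"
proof -
  have "card (insert i (J x - {j})) = \<beta> x"
  proof -
    have "card (insert i (J x - {j})) = Suc (card (J x - {j}))"
      using chart_indicesD(3)[OF J x] i(2) by (intro card_insert_disjoint) auto
    then show ?thesis
      using card_Suc_Diff1[OF chart_indicesD(3)[OF J x] j] chart_indicesD(2)[OF J x] by simp
  qed
  moreover have "J \<in> extensional (verts Q)"
    using J by (auto simp: chart_indices_def PiE_def)
  ultimately show ?thesis
    using J x i(1) chart_indicesD[OF J]
    by (auto simp: chart_indices_def PiE_def Pi_def extensional_def)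
qed

lemma chart_chart_pivot:
  fixes p :: "('v, 'e) coordinate \<Rightarrow> 'k::field"
  assumes p: "p (Gr_coord x i j) \<noteq> 0"
  shows "chart Q \<alpha> (J(x := insert i (J x - {j}))) (chart_pivot Q \<alpha> J x i j p) = chart Q \<alpha> J p"
proof -
  let ?J = "J(x := insert i (J x - {j}))" and ?t = "chart_pivot Q \<alpha> J x i j p"
  have "graph (\<alpha> y) (?J y) (\<lambda>k l. ?t (Gr_coord y k l)) = graph (\<alpha> y) (J y) (\<lambda>k l. p (Gr_coord y k l))"
    if y: "y \<in> verts Q" for y
  proof (cases "y = x")
    case True
    have "graph (\<alpha> x) (?J x) (\<lambda>k l. ?t (Gr_coord x k l)) =
        graph (\<alpha> x) (?J x) (pivot i j (\<lambda>k l. p (Gr_coord x k l)))"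
      using x by (intro graph_cong) (simp add: chart_pivot_def)
    also have "\<dots> = graph (\<alpha> x) (J x) (\<lambda>k l. p (Gr_coord x k l))"
      using graph_pivot[OF chart_indicesD(1)[OF J x] i j, of "\<lambda>k l. p (Gr_coord x k l)"] p by simp
    finally show ?thesis
      using True by simp
  next
    case False
    then show ?thesis
      unfolding fun_upd_other[OF False] using y by (intro graph_cong) (simp add: chart_pivot_def)
  qed
  moreover have "mat (\<alpha> (head Q a)) (\<alpha> (tail Q a)) (\<lambda>(k, l). ?t (Rep_coord a k l)) =
      mat (\<alpha> (head Q a)) (\<alpha> (tail Q a)) (\<lambda>(k, l). p (Rep_coord a k l))" if "a \<in> arcs Q" for a
    using that by (intro eq_matI) (simp_all add: chart_pivot_def)
  ultimately show ?thesis
    unfolding chart_eq by (intro arg_cong2[of _ _ _ _ Pair] restrict_ext) simp_all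
qed

text \<open>A polynomial pulled back along the exchange has a power of one coordinate as
  denominator. Sums and products are brought to the exponent \<open>N + M\<close>.\<close>

lemma chart_pivot_polynomial:
  assumes "f \<in> polynomial_functions (chart_coords Q \<alpha> (J(x := insert i (J x - {j}))))"
  shows "\<exists>N. \<exists>g\<in>polynomial_functions (chart_coords Q \<alpha> J). \<forall>p. p (Gr_coord x i j) \<noteq> (0 :: 'k::field) \<longrightarrow>
    f (chart_pivot Q \<alpha> J x i j p) * p (Gr_coord x i j) ^ N = g p"
  using assms
proof induction
  case (const c)
  show ?case
    by (rule exI[of _ 0], rule bexI[OF _ polynomial_functions.const[of c]]) simp
next
  case (coord c)
  show ?case
  proof (cases c)
    case (Rep_coord a k l)
    then show ?thesis
      using coord by (intro exI[of _ 0] bexI[of _ "\<lambda>p. p c"] polynomial_functions.coord) (simp_all add: chart_pivot_def)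
  next
    case (Gr_coord y k l)
    show ?thesis
    proof (cases "y = x")
      case False
      then show ?thesis
        using coord Gr_coord
        by (intro exI[of _ 0] bexI[of _ "\<lambda>p. p c"] polynomial_functions.coord) (simp_all add: chart_pivot_def)
    next
      case True
      have kl: "k < \<alpha> x" "k \<noteq> i" "k = j \<or> k \<notin> J x" "l = i \<or> l \<in> J x \<and> l \<noteq> j"
        using coord Gr_coord True by auto
      \<comment> \<open>The exchanged entry times the pivot element, in the four cases of
        \<open>pivot\<close>; every case has at most one inverse factor, so exponent 1 is
        enough.\<close>
      define g where "g = (\<lambda>p :: ('v, 'e) coordinate \<Rightarrow> 'k.
        if k = j then if l = i then 1 else - p (Gr_coord x i l)
        else if l = i then p (Gr_coord x k j)
        else p (Gr_coord x k l) * p (Gr_coord x i j) - p (Gr_coord x k j) * p (Gr_coord x i l))"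
      have "g \<in> polynomial_functions (chart_coords Q \<alpha> J)"
        unfolding g_def using kl x i j
        by (cases "k = j"; cases "l = i")
          (simp_all add: polynomial_functions.const polynomial_uminus polynomial_diff
            polynomial_functions.mult polynomial_functions.coord)
      moreover have "chart_pivot Q \<alpha> J x i j p c * p (Gr_coord x i j) ^ 1 = g p"
        if "p (Gr_coord x i j) \<noteq> 0" for p
        using coord Gr_coord True that
        by (auto simp: chart_pivot_def pivot_def g_def left_diff_distrib mult.assoc)
      ultimately show ?thesis
        by blast
    qed
  qed
next
  case (add f g)
  then obtain N f' M g' where f': "f' \<in> polynomial_functions (chart_coords Q \<alpha> J)"
      "\<And>p. p (Gr_coord x i j) \<noteq> 0 \<Longrightarrow> f (chart_pivot Q \<alpha> J x i j p) * p (Gr_coord x i j) ^ N = f' p"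
    and g': "g' \<in> polynomial_functions (chart_coords Q \<alpha> J)"
      "\<And>p. p (Gr_coord x i j) \<noteq> 0 \<Longrightarrow> g (chart_pivot Q \<alpha> J x i j p) * p (Gr_coord x i j) ^ M = g' p"
    by blast
  have d: "(\<lambda>p. p (Gr_coord x i j)) \<in> polynomial_functions (chart_coords Q \<alpha> J)"
    using x i j by (intro polynomial_functions.coord) simp
  show ?case
  proof (intro exI[of _ "N + M"] bexI allI impI)
    show "(\<lambda>p. f' p * p (Gr_coord x i j) ^ M + g' p * p (Gr_coord x i j) ^ N)
        \<in> polynomial_functions (chart_coords Q \<alpha> J)"
      by (intro polynomial_functions.add polynomial_functions.mult polynomial_power d f'(1) g'(1))
  qed (simp add: power_add algebra_simps flip: f'(2) g'(2))
next
  case (mult f g)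
  then obtain N f' M g' where f': "f' \<in> polynomial_functions (chart_coords Q \<alpha> J)"
      "\<And>p. p (Gr_coord x i j) \<noteq> 0 \<Longrightarrow> f (chart_pivot Q \<alpha> J x i j p) * p (Gr_coord x i j) ^ N = f' p"
    and g': "g' \<in> polynomial_functions (chart_coords Q \<alpha> J)"
      "\<And>p. p (Gr_coord x i j) \<noteq> 0 \<Longrightarrow> g (chart_pivot Q \<alpha> J x i j p) * p (Gr_coord x i j) ^ M = g' p"
    by blast
  show ?case
  proof (rule exI[of _ "N + M"], rule bexI[of _ "\<lambda>p. f' p * g' p"])
    show "(\<lambda>p. f' p * g' p) \<in> polynomial_functions (chart_coords Q \<alpha> J)"
      by (intro polynomial_functions.mult f'(1) g'(1))
  qed (simp add: power_add mult_ac flip: f'(2) g'(2))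
qed

end

text \<open>A point in the image of the chart \<open>J\<close> and of the chart \<open>J'\<close> is connected to the chart \<open>J\<close> by
  exchanging one coordinate at a time. Each exchange is a rational map whose denominators are powers of a
  single coordinate.\<close>

lemma chart_image_neighbourhood:
  fixes V :: "(('v, 'e) coordinate \<Rightarrow> 'k::field) set"
  assumes fin: "finite (verts Q)" and J: "J \<in> chart_indices Q \<alpha> \<beta>"
    and V: "openin (zariski_affine (chart_coords Q \<alpha> J)) V"
    and "J' \<in> chart_indices Q \<alpha> \<beta>" and "q \<in> affine_space (chart_coords Q \<alpha> J')"
    and "chart Q \<alpha> J' q \<in> chart Q \<alpha> J ` V"
  shows "\<exists>f\<in>polynomial_functions (chart_coords Q \<alpha> J'). f q \<noteq> 0 \<and>
    (\<forall>q'\<in>affine_space (chart_coords Q \<alpha> J'). f q' \<noteq> 0 \<longrightarrow> chart Q \<alpha> J' q' \<in> chart Q \<alpha> J ` V)"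
  using assms(4-)
\<comment> \<open>The measure counts the coordinates of \<open>J\<close> missing from
  \<open>J'\<close>; each exchange brings in one of them and discards a coordinate outside
  \<open>J\<close>.\<close>
proof (induction "\<Sum>x\<in>verts Q. card (J x - J' x)" arbitrary: J' q rule: less_induct)
  case less
  note J' = less.prems(1) and q = less.prems(2)
  show ?case
  proof (cases "\<forall>x\<in>verts Q. J x \<subseteq> J' x")
    case True
    \<comment> \<open>Inclusion becomes equality because both sets have \<open>\<beta> x\<close>
      elements.\<close>
    have "J = J'"
    proof (rule PiE_ext)
      show "J \<in> (\<Pi>\<^sub>E x\<in>verts Q. UNIV)" "J' \<in> (\<Pi>\<^sub>E x\<in>verts Q. UNIV)"
        using J J' by (auto simp: chart_indices_def PiE_def)
      show "J x = J' x" if "x \<in> verts Q" for x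
        using True that chart_indicesD[OF J that] chart_indicesD[OF J' that]
        by (intro card_subset_eq) auto
    qed
    obtain v where v: "v \<in> V" "chart Q \<alpha> J' q = chart Q \<alpha> J v"
      using less.prems(3) by blast
    have Vsub: "V \<subseteq> affine_space (chart_coords Q \<alpha> J)"
      using V by (simp add: openin_zariski_affine)
    then have "q = v"
      using chart_inj[OF J, of q v] v q \<open>J = J'\<close> by auto
    then obtain f where f: "f \<in> polynomial_functions (chart_coords Q \<alpha> J)" "f q \<noteq> 0"
        "\<forall>q'\<in>affine_space (chart_coords Q \<alpha> J). f q' \<noteq> 0 \<longrightarrow> q' \<in> V"
      using V v(1) unfolding openin_zariski_affine by blast
    then show ?thesis
      using \<open>J = J'\<close> by (intro bexI[of _ f]) auto
  next
    case False
    then obtain x i where x: "x \<in> verts Q" and i: "i \<in> J x - J' x"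
      by blast
    obtain v where v: "v \<in> V" "chart Q \<alpha> J' q = chart Q \<alpha> J v"
      using less.prems(3) by blast
    have "graph (\<alpha> x) (J' x) (\<lambda>i j. q (Gr_coord x i j)) = graph (\<alpha> x) (J x) (\<lambda>i j. v (Gr_coord x i j))"
      using v(2) x unfolding chart_eq prod.inject by (metis (no_types, lifting) restrict_apply')
    then obtain j where j: "j \<in> J' x - J x" "q (Gr_coord x i j) \<noteq> 0"
      by (rule pivot_exists[OF chart_indicesD(1)[OF J' x] chart_indicesD(1)[OF J x] _ i])
    have i': "i < \<alpha> x" "i \<notin> J' x" and j': "j \<in> J' x"
      using i j(1) chart_indicesD(1)[OF J x] by auto
    define J2 where "J2 = J'(x := insert i (J' x - {j}))"
    have J2: "J2 \<in> chart_indices Q \<alpha> \<beta>"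
      unfolding J2_def by (rule chart_indices_pivot[OF J' x i' j'])
    let ?t = "chart_pivot Q \<alpha> J' x i j"
    have t: "?t p \<in> affine_space (chart_coords Q \<alpha> J2)" for p :: "('v, 'e) coordinate \<Rightarrow> 'k"
      by (simp add: chart_pivot_def affine_space_def J2_def)
    have chart_t: "chart Q \<alpha> J2 (?t p) = chart Q \<alpha> J' p" if "p (Gr_coord x i j) \<noteq> 0"
      for p :: "('v, 'e) coordinate \<Rightarrow> 'k"
      unfolding J2_def by (rule chart_chart_pivot[where \<beta> = \<beta> and p = p, OF J' x i' j' that])
    have "J x - J2 x = J x - J' x - {i}"
      using i j(1) by (auto simp: J2_def)
    then have "card (J x - J2 x) < card (J x - J' x)"
      using i chart_indicesD(3)[OF J x] by (metis card_Diff1_less finite_Diff)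
    then have "(\<Sum>x\<in>verts Q. card (J x - J2 x)) < (\<Sum>x\<in>verts Q. card (J x - J' x))"
      using x fin by (intro sum_strict_mono_ex1) (auto simp: J2_def)
    then obtain f where f: "f \<in> polynomial_functions (chart_coords Q \<alpha> J2)" "f (?t q) \<noteq> 0"
        "\<And>q'. q' \<in> affine_space (chart_coords Q \<alpha> J2) \<Longrightarrow> f q' \<noteq> 0 \<Longrightarrow> chart Q \<alpha> J2 q' \<in> chart Q \<alpha> J ` V"
      using less.hyps[OF _ J2 t, of q] less.prems(3) chart_t[of q, OF j(2)] by auto
    obtain N g where g: "g \<in> polynomial_functions (chart_coords Q \<alpha> J')"
        "\<And>p. p (Gr_coord x i j) \<noteq> 0 \<Longrightarrow> f (?t p) * p (Gr_coord x i j) ^ N = g p"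
      using chart_pivot_polynomial[OF J' x i' j'] f(1) unfolding J2_def by blast
    show ?thesis
    proof (intro bexI conjI ballI impI)
      \<comment> \<open>The second factor ensures that the exchange is valid at the point, the first
        that \<open>f\<close> does not vanish at the exchanged point.\<close>
      show "(\<lambda>p. g p * p (Gr_coord x i j)) \<in> polynomial_functions (chart_coords Q \<alpha> J')"
        using x i' j' g(1) by (intro polynomial_functions.mult polynomial_functions.coord) simp_all
      show "g q * q (Gr_coord x i j) \<noteq> 0"
        using f(2) j(2) by (simp flip: g(2))
      fix q'
      assume "g q' * q' (Gr_coord x i j) \<noteq> 0"
      then have d: "q' (Gr_coord x i j) \<noteq> 0" and "g q' \<noteq> 0"
        by simp_all
      then have "f (?t q') \<noteq> 0"
        using g(2)[of q', OF d] by auto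
      then show "chart Q \<alpha> J' q' \<in> chart Q \<alpha> J ` V"
        using f(3)[OF t] chart_t[of q', OF d] by metis
    qed
  qed
qed

section \<open>Images of open and constructible sets under charts\<close>

lemma chart_image_open:
  fixes V :: "(('v, 'e) coordinate \<Rightarrow> 'k::field) set"
  assumes fin: "finite (verts Q)" and J: "J \<in> chart_indices Q \<alpha> \<beta>"
    and V: "openin (zariski_affine (chart_coords Q \<alpha> J)) V"
  shows "openin (zariski_product Q \<alpha> \<beta>) (chart Q \<alpha> J ` V)"
  unfolding openin_zariski_product zariski_open_def
proof (intro conjI ballI)
  show "chart Q \<alpha> J ` V \<subseteq> grassmannian Q \<alpha> \<beta> \<times> rep_space Q \<alpha>"
    using chart_mem[OF J] by blast
  show "openin (zariski_affine (chart_coords Q \<alpha> J'))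
      {p \<in> affine_space (chart_coords Q \<alpha> J'). chart Q \<alpha> J' p \<in> chart Q \<alpha> J ` V}"
    if "J' \<in> chart_indices Q \<alpha> \<beta>" for J'
    unfolding openin_zariski_affine
    using chart_image_neighbourhood[OF assms that] by auto
qed

text \<open>The image of a closed set need not be closed, but by injectivity it is the difference of
  two open images. Injectivity also lets images commute with intersections.\<close>

lemma constructible_chart_image:
  fixes T :: "(('v, 'e) coordinate \<Rightarrow> 'k::field) set"
  assumes fin: "finite (verts Q)" and J: "J \<in> chart_indices Q \<alpha> \<beta>"
    and T: "constructible (zariski_affine (chart_coords Q \<alpha> J)) T"
  shows "constructible (zariski_product Q \<alpha> \<beta>) (chart Q \<alpha> J ` T)"
proof -
  let ?A = "affine_space (chart_coords Q \<alpha> J) :: (('v, 'e) coordinate \<Rightarrow> 'k) set"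
  have inj: "inj_on (chart Q \<alpha> J) ?A"
    using chart_inj[OF J] by (intro inj_onI)
  have open_image: "constructible (zariski_product Q \<alpha> \<beta>) (chart Q \<alpha> J ` V)"
    if "openin (zariski_affine (chart_coords Q \<alpha> J)) V" for V :: "(('v, 'e) coordinate \<Rightarrow> 'k) set"
    by (intro constructible.intros(1) chart_image_open fin J that)
  show ?thesis
    using T
  proof induction
    case (1 S)
    then show ?case
      by (rule open_image)
  next
    case (2 S)
    then have S: "S \<subseteq> ?A" "openin (zariski_affine (chart_coords Q \<alpha> J)) (?A - S)"
      by (simp_all add: closedin_def topspace_zariski_affine)
    have "chart Q \<alpha> J ` S = chart Q \<alpha> J ` ?A - chart Q \<alpha> J ` (?A - S)"
      using inj_on_image_set_diff[OF inj, of ?A "?A - S"] S(1) by (simp add: double_diff)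
    moreover have "openin (zariski_affine (chart_coords Q \<alpha> J)) ?A"
      using openin_topspace topspace_zariski_affine by metis
    ultimately show ?case
      using constructible_diff open_image S(2) by metis
  next
    case (3 S T)
    then show ?case
      by (simp add: image_Un constructible.intros(3))
  next
    case (4 S T)
    then have "S \<subseteq> ?A" "T \<subseteq> ?A"
      using constructible_subset topspace_zariski_affine by blast+
    then show ?case
      using 4 inj_on_image_Int[OF inj] by (simp add: constructible.intros(4))
  qed
qed

text \<open>There are finitely many charts and they cover, so \<open>S\<close> is the finite union
  of the images of its preimages.\<close>

lemma constructible_from_charts:
  fixes S :: "(('v \<Rightarrow> 'k::field vec set) \<times> ('e \<Rightarrow> 'k mat)) set"
  assumes fin: "finite (verts Q)" and S: "S \<subseteq> grassmannian Q \<alpha> \<beta> \<times> rep_space Q \<alpha>"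
    and T: "\<And>J. J \<in> chart_indices Q \<alpha> \<beta> \<Longrightarrow> constructible (zariski_affine (chart_coords Q \<alpha> J))
      {p \<in> affine_space (chart_coords Q \<alpha> J). chart Q \<alpha> J p \<in> S}"
  shows "constructible (zariski_product Q \<alpha> \<beta>) S"
proof -
  let ?T = "\<lambda>J. {p \<in> affine_space (chart_coords Q \<alpha> J). chart Q \<alpha> J p \<in> S}"
  have "finite (chart_indices Q \<alpha> \<beta>)"
    unfolding chart_indices_def using fin by (intro finite_PiE) auto
  then have "constructible (zariski_product Q \<alpha> \<beta>) (\<Union>J\<in>chart_indices Q \<alpha> \<beta>. chart Q \<alpha> J ` ?T J)"
    by (intro constructible_UN constructible_chart_image fin T)
  moreover have "(\<Union>J\<in>chart_indices Q \<alpha> \<beta>. chart Q \<alpha> J ` ?T J) = S"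
  proof
    show "S \<subseteq> (\<Union>J\<in>chart_indices Q \<alpha> \<beta>. chart Q \<alpha> J ` ?T J)"
    proof
      fix z
      assume "z \<in> S"
      moreover obtain W \<phi> where "z = (W, \<phi>)"
        by (cases z)
      moreover from calculation obtain J p where "J \<in> chart_indices Q \<alpha> \<beta>"
          "p \<in> affine_space (chart_coords Q \<alpha> J)" "chart Q \<alpha> J p = (W, \<phi>)"
        using chart_cover[of W Q \<alpha> \<beta> \<phi>] S by blast
      ultimately show "z \<in> (\<Union>J\<in>chart_indices Q \<alpha> \<beta>. chart Q \<alpha> J ` ?T J)"
        by force
    qed
  qed auto
  ultimately show ?thesis
    by simp
qed

section \<open>Rank loci in a chart\<close>

context definable_functions
begin

section \<open>Definability of graphs and of inequalities between ranks\<close>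

lemma dvec_graph_basis:
  assumes "\<And>i. i < n \<Longrightarrow> i \<notin> J \<Longrightarrow> (\<lambda>p. q p i j) \<in> D"
  shows "dvec (\<lambda>p. graph_basis n J (q p) j)"
proof (rule dvecI)
  show "finite ({[]} \<times> {..<n})"
    by simp
  show "(\<lambda>p. graph_basis n J (q p) j l) \<in> D" for l :: "'b list \<times> nat"
    using assms const by (cases l; cases "fst l = [] \<and> snd l < n"; cases "snd l \<in> J")
      (auto simp: graph_basis_def)
  show "graph_basis n J (q p) j l = 0" if "l \<notin> {[]} \<times> {..<n}" for p and l :: "'b list \<times> nat"
    using that by (cases l) (auto simp: graph_basis_def)
qed

lemma dsub_graph_functions:
  assumes "J \<subseteq> {..<n}" and "\<And>i j. i < n \<Longrightarrow> i \<notin> J \<Longrightarrow> j \<in> J \<Longrightarrow> (\<lambda>p. q p i j) \<in> D"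
  shows "dsub (\<lambda>p. graph_functions n J (q p) :: ('v list \<times> nat \<Rightarrow> 'k) set)"
proof (rule dsubI)
  let ?G = "(\<lambda>j p. graph_basis n J (q p) j :: 'v list \<times> nat \<Rightarrow> 'k) ` J"
  show "finite ?G"
    using finite_subset[OF assms(1)] by simp
  show "dvec v" if "v \<in> ?G" for v
    using that assms(2) by (auto intro!: dvec_graph_basis)
  show "graph_functions n J (q p) = fvs.span ((\<lambda>v. v p) ` ?G)" for p
    unfolding graph_functions_span[OF assms(1)] by (simp add: image_image)
qed

lemma dsub_column_functions: "dsub (\<lambda>_. column_functions n :: ('v list \<times> nat \<Rightarrow> 'k) set)"
proof -
  have "graph_functions n {..<n} (\<lambda>_ _. 0) = (column_functions n :: ('v list \<times> nat \<Rightarrow> 'k) set)"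
    by (auto simp: graph_functions_def)
  moreover have "dsub (\<lambda>_. graph_functions n {..<n} (\<lambda>_ _. 0) :: ('v list \<times> nat \<Rightarrow> 'k) set)"
    by (rule dsub_graph_functions) simp_all
  ultimately show ?thesis
    by simp
qed

text \<open>The first rank is replaced by each of its finitely many values in turn. The condition
  \<open>T\<close> is arbitrary so that the resulting constant can be absorbed into it.\<close>

lemma dpred_dfin_sum:
  fixes ts :: "(real \<times> ('y \<Rightarrow> nat)) list" and T :: "real \<Rightarrow> bool"
  assumes "\<And>c r. (c, r) \<in> set ts \<Longrightarrow> dfin (\<lambda>p. r (w p))"
  shows "dpred (\<lambda>p. T (\<Sum>(c, r)\<leftarrow>ts. c * real (r (w p))))"
  using assms
proof (induction ts arbitrary: T)
  case Nil
  then show ?case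
    by simp
next
  case (Cons t ts)
  obtain c r where t: "t = (c, r)"
    by (cases t)
  have r: "finite ((\<lambda>p. r (w p)) ` X)" "\<And>n. dpred (\<lambda>p. r (w p) = n)"
    using Cons.prems[of c r] by (simp_all add: t dfin_def)
  have "dpred (\<lambda>p. T' (\<Sum>(c, r)\<leftarrow>ts. c * real (r (w p))))" for T'
  proof (rule Cons.IH)
    show "dfin (\<lambda>p. r (w p))" if "(c, r) \<in> set ts" for c r
      using that by (intro Cons.prems[of c r]) simp
  qed
  then have "dpred (\<lambda>p. \<exists>n\<in>(\<lambda>p. r (w p)) ` X. r (w p) = n \<and>
      T (c * real n + (\<Sum>(c, r)\<leftarrow>ts. c * real (r (w p)))))"
    by (intro dpred_bex dpred_conj r)
  then show ?case
    by (rule dpred_cong) (auto simp: t)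
qed

end

text \<open>The set \<open>X\<close> is left open because it is taken twice: as the whole affine
  space, where membership in the bundle is tested, and as the points of the bundle, where the maps
  preserve the subspaces and both representations make sense.\<close>

locale bundle_chart = fin_digraph Q
  for Q :: "('v, 'e) pre_digraph" +
  fixes \<alpha> \<beta> :: "'v \<Rightarrow> nat" and J :: "'v \<Rightarrow> nat set" and X :: "(('v, 'e) coordinate \<Rightarrow> 'k::field) set"
  assumes J: "J \<in> chart_indices Q \<alpha> \<beta>" and X: "X \<subseteq> affine_space (chart_coords Q \<alpha> J)"
begin

sublocale definable_functions X "piecewise_polynomials (chart_coords Q \<alpha> J) X"
  by (rule definable_piecewise_polynomials[OF X])

lemma coordinate_definable:
  "c \<in> chart_coords Q \<alpha> J \<Longrightarrow> (\<lambda>p. p c) \<in> piecewise_polynomials (chart_coords Q \<alpha> J) X"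
  by (intro piecewise_polynomials.polynomial polynomial_functions.coord)

lemma constructible_dpred:
  assumes "dpred P"
  obtains C where "constructible (zariski_affine (chart_coords Q \<alpha> J)) C" "X \<inter> C = {p \<in> X. P p}"
proof -
  have "(\<lambda>p. of_bool (\<not> P p) :: 'k) \<in> piecewise_polynomials (chart_coords Q \<alpha> J) X"
    using dpred_not[OF assms] unfolding dpred_def .
  then show ?thesis
    using X by (rule piecewise_polynomials_zero_set) (use that in auto)
qed

definition G :: "'v \<Rightarrow> (('v, 'e) coordinate \<Rightarrow> 'k) \<Rightarrow> ('v list \<times> nat \<Rightarrow> 'k) set" where
  "G x p = graph_functions (\<alpha> x) (J x) (\<lambda>i j. p (Gr_coord x i j))"

definition F :: "'e \<Rightarrow> (('v, 'e) coordinate \<Rightarrow> 'k) \<Rightarrow> ('v list \<times> nat \<Rightarrow> 'k) \<Rightarrow> 'v list \<times> nat \<Rightarrow> 'k" where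
  "F a p f = (\<lambda>(l, i). if l = [] \<and> i < \<alpha> (head Q a)
     then \<Sum>j<\<alpha> (tail Q a). p (Rep_coord a i j) * f ([], j) else 0)"

abbreviation W :: "(('v, 'e) coordinate \<Rightarrow> 'k) \<Rightarrow> 'v \<Rightarrow> 'k vec set" where
  "W p \<equiv> fst (chart Q \<alpha> J p)"

abbreviation \<phi> :: "(('v, 'e) coordinate \<Rightarrow> 'k) \<Rightarrow> 'e \<Rightarrow> 'k mat" where
  "\<phi> p \<equiv> snd (chart Q \<alpha> J p)"

lemma W_eq: "x \<in> verts Q \<Longrightarrow> W p x = column (\<alpha> x) ` G x p"
  using column_graph_functions[OF chart_indicesD(1)[OF J], of x "\<lambda>i j. p (Gr_coord x i j)", where 'v = 'v]
  by (simp add: chart_eq G_def)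

lemma W_eq_restrict: "W p = (\<lambda>x\<in>verts Q. column (\<alpha> x) ` G x p)"
proof
  show "W p x = (\<lambda>x\<in>verts Q. column (\<alpha> x) ` G x p) x" for x
    using W_eq[of x p] by (cases "x \<in> verts Q") (simp_all add: chart_eq)
qed

lemma G_subset: "G x p \<subseteq> column_functions (\<alpha> x)"
  by (auto simp: G_def graph_functions_def)

lemma G_subspace: "fvs.subspace (G x p)"
  unfolding G_def by (rule subspace_graph_functions)

lemma F_column: "F a p f \<in> column_functions (\<alpha> (head Q a))"
  by (auto simp: F_def column_functions_def)

lemma F_linear: "fun_linear (F a p)"
  by (rule fun_linearI)
    (auto simp: F_def fun_eq_iff fscale_apply algebra_simps sum.distrib sum_distrib_left)

lemma column_F: "a \<in> arcs Q \<Longrightarrow> column (\<alpha> (head Q a)) (F a p f) = \<phi> p a *\<^sub>v column (\<alpha> (tail Q a)) f"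
  by (rule eq_vecI)
    (auto simp: chart_eq column_def F_def scalar_prod_def lessThan_atLeast0 intro!: sum.cong)

lemma mem_W_iff:
  assumes "x \<in> verts Q" and "f \<in> column_functions (\<alpha> x)"
  shows "column (\<alpha> x) f \<in> W p x \<longleftrightarrow> f \<in> G x p"
  unfolding W_eq[OF assms(1)] using column_inj[OF assms(2)] G_subset by blast

lemma dsub_G: "x \<in> verts Q \<Longrightarrow> dsub (G x)"
  unfolding G_def[abs_def] using chart_indicesD(1)[OF J]
  by (intro dsub_graph_functions coordinate_definable) simp_all

lemma dmap_F:
  assumes a: "a \<in> arcs Q"
  shows "dmap (F a)"
proof (rule dmapI)
  show "fun_linear (F a p)" for p
    by (rule F_linear)
  fix v :: "(('v, 'e) coordinate \<Rightarrow> 'k) \<Rightarrow> 'v list \<times> nat \<Rightarrow> 'k"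
  assume v: "dvec v"
  show "dvec (\<lambda>p. F a p (v p))"
  proof (rule dvecI)
    show "finite ({[]} \<times> {..<\<alpha> (head Q a)})"
      by simp
    show "F a p (v p) l = 0" if "l \<notin> {[]} \<times> {..<\<alpha> (head Q a)}" for p l
      using that by (cases l) (auto simp: F_def)
    show "(\<lambda>p. F a p (v p) l) \<in> piecewise_polynomials (chart_coords Q \<alpha> J) X" for l
    proof (cases "fst l = [] \<and> snd l < \<alpha> (head Q a)")
      case True
      have "(\<lambda>p. \<Sum>j<\<alpha> (tail Q a). p (Rep_coord a (snd l) j) * v p ([], j))
          \<in> piecewise_polynomials (chart_coords Q \<alpha> J) X"
        using True a by (intro sum mult coordinate_definable dvec_component v) simp
      then show ?thesis
        using True by (cases l) (simp add: F_def)
    next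
      case False
      then show ?thesis
        using const[of 0] by (cases l) (auto simp: F_def)
    qed
  qed
qed

lemma chart_mem_bundle_iff:
  "chart Q \<alpha> J p \<in> subrep_bundle Q \<alpha> \<beta> \<longleftrightarrow> (\<forall>a\<in>arcs Q. F a p ` G (tail Q a) p \<subseteq> G (head Q a) p)"
proof -
  have "(\<lambda>v. \<phi> p a *\<^sub>v v) ` W p (tail Q a) \<subseteq> W p (head Q a) \<longleftrightarrow> F a p ` G (tail Q a) p \<subseteq> G (head Q a) p"
    if a: "a \<in> arcs Q" for a
  proof -
    have "(\<lambda>v. \<phi> p a *\<^sub>v v) ` W p (tail Q a) = column (\<alpha> (head Q a)) ` F a p ` G (tail Q a) p"
      using W_eq[of "tail Q a" p] column_F[OF a] a by (simp add: image_image)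
    then show ?thesis
      using mem_W_iff[OF head_in_verts[OF a] F_column, of p] by (simp add: image_subset_iff)
  qed
  then show ?thesis
    using chart_mem[OF J, of p] by (cases "chart Q \<alpha> J p") (simp add: subrep_bundle_def)
qed

lemma dpred_bundle: "dpred (\<lambda>p. chart Q \<alpha> J p \<in> subrep_bundle Q \<alpha> \<beta>)"
  unfolding chart_mem_bundle_iff
  by (intro dpred_ball dpred_subset dsub_image dmap_F dsub_G) simp_all

lemma column_kernel: "{f \<in> column_functions n. column n f = \<zero>\<^bsub>module_vec TYPE('k) n\<^esub>} = {0 :: 'v list \<times> nat \<Rightarrow> 'k}"
  using column_eq_zero_iff[of _ n] fvs.subspace_0[OF subspace_column_functions, of n] by auto

lemma definable_sub_rep:
  assumes in_bundle: "\<And>p. p \<in> X \<Longrightarrow> chart Q \<alpha> J p \<in> subrep_bundle Q \<alpha> \<beta>"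
  shows "definable_rep Q (\<lambda>p. sub_rep (matrix_rep \<alpha> (\<phi> p)) (W p))"
proof (rule definable_repI)
  fix x
  assume x: "x \<in> verts Q"
  show "dsub (G x)"
    by (rule dsub_G[OF x])
  have "{f \<in> G x p. column (\<alpha> x) f = \<zero>\<^bsub>module_vec TYPE('k) (\<alpha> x)\<^esub>} = {0}" for p
    using column_kernel[of "\<alpha> x"] G_subset[of x p] fvs.subspace_0[OF G_subspace, of x p] by blast
  then show "dsub (\<lambda>p. {f \<in> G x p. column (\<alpha> x) f =
      \<zero>\<^bsub>rep.space (sub_rep (matrix_rep \<alpha> (\<phi> p)) (W p)) x\<^esub>})"
    using dsub_zero by (simp add: sub_rep_def matrix_rep_def)
  show "presented (rep.space (sub_rep (matrix_rep \<alpha> (\<phi> p)) (W p)) x) (G x p) (column (\<alpha> x))" for p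
    using presented.presented_sub[OF presented_module_vec G_subspace[of x p] G_subset] W_eq[OF x, of p]
    by (simp add: sub_rep_def matrix_rep_def)
next
  fix a
  assume a: "a \<in> arcs Q"
  show "dmap (F a)"
    by (rule dmap_F[OF a])
  show "F a p f \<in> G (head Q a) p" if "p \<in> X" "f \<in> G (tail Q a) p" for p f
    using in_bundle[OF that(1)] a that(2) unfolding chart_mem_bundle_iff by blast
  show "maps (sub_rep (matrix_rep \<alpha> (\<phi> p)) (W p)) a (column (\<alpha> (tail Q a)) f) =
      column (\<alpha> (head Q a)) (F a p f)" for p f
    by (simp add: sub_rep_def matrix_rep_def column_F[OF a])
qed

lemma presented_matrix_rep:
  "presented_rep Q (matrix_rep \<alpha> (\<phi> p)) (\<lambda>x. column_functions (\<alpha> x)) (\<lambda>x. column (\<alpha> x)) (\<lambda>a. F a p)"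
proof (intro presented_rep.intro fin_digraph_axioms presented_rep_axioms.intro)
  show "presented (rep.space (matrix_rep \<alpha> (\<phi> p)) x) (column_functions (\<alpha> x)) (column (\<alpha> x))" for x
    by (simp add: matrix_rep_def presented_module_vec)
qed (simp_all add: F_linear F_column matrix_rep_def column_F)

text \<open>The subrepresentation is presented by \<open>G\<close> with kernel zero; the quotient is
  presented by all columns with kernel \<open>G\<close>, and the same lifts \<open>F\<close> serve
  for both.\<close>

lemma definable_quotient_rep:
  assumes in_bundle: "\<And>p. p \<in> X \<Longrightarrow> chart Q \<alpha> J p \<in> subrep_bundle Q \<alpha> \<beta>"
  shows "definable_rep Q (\<lambda>p. quotient_rep Q (matrix_rep \<alpha> (\<phi> p)) (W p))"
proof (rule definable_repI)
  fix x
  assume x: "x \<in> verts Q"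
  let ?s = "\<lambda>p (f :: 'v list \<times> nat \<Rightarrow> 'k). W p x +>\<^bsub>module_vec TYPE('k) (\<alpha> x)\<^esub> column (\<alpha> x) f"
  show "dsub (\<lambda>_. column_functions (\<alpha> x))"
    by (rule dsub_column_functions)
  note quotient_facts = presented.presented_quotient[OF presented_module_vec G_subspace G_subset]
  have quotient: "presented (quotient_space (module_vec TYPE('k) (\<alpha> x)) (W p x)) (column_functions (\<alpha> x)) (?s p)" for p
    unfolding W_eq[OF x] by (rule quotient_facts(1))
  have zero: "?s p f = \<zero>\<^bsub>quotient_space (module_vec TYPE('k) (\<alpha> x)) (W p x)\<^esub> \<longleftrightarrow> f \<in> G x p"
    if "f \<in> column_functions (\<alpha> x)" for p f
    using quotient_facts(2)[OF that, of p] mem_W_iff[OF x that, of p] unfolding W_eq[OF x, of p] by simp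
  have kernel: "{f \<in> column_functions (\<alpha> x). ?s p f =
      \<zero>\<^bsub>quotient_space (module_vec TYPE('k) (\<alpha> x)) (W p x)\<^esub>} = G x p" for p
    using zero[of _ p] G_subset[of x p] by blast
  show "dsub (\<lambda>p. {f \<in> column_functions (\<alpha> x). ?s p f =
      \<zero>\<^bsub>rep.space (quotient_rep Q (matrix_rep \<alpha> (\<phi> p)) (W p)) x\<^esub>})"
    using dsub_G[OF x] by (rule dsub_cong) (simp add: kernel quotient_rep_def matrix_rep_def)
  show "presented (rep.space (quotient_rep Q (matrix_rep \<alpha> (\<phi> p)) (W p)) x) (column_functions (\<alpha> x)) (?s p)" for p
    using quotient by (simp add: quotient_rep_def matrix_rep_def)
next
  fix a
  assume a: "a \<in> arcs Q"
  show "dmap (F a)"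
    by (rule dmap_F[OF a])
  show "F a p f \<in> column_functions (\<alpha> (head Q a))" for p f
    by (rule F_column)
  show "maps (quotient_rep Q (matrix_rep \<alpha> (\<phi> p)) (W p)) a
      (W p (tail Q a) +>\<^bsub>module_vec TYPE('k) (\<alpha> (tail Q a))\<^esub> column (\<alpha> (tail Q a)) f) =
      W p (head Q a) +>\<^bsub>module_vec TYPE('k) (\<alpha> (head Q a))\<^esub> column (\<alpha> (head Q a)) (F a p f)"
    if p: "p \<in> X" and f: "f \<in> column_functions (\<alpha> (tail Q a))" for p f
  proof -
    have "F a p f \<in> G (head Q a) p" if "a \<in> arcs Q" "f \<in> G (tail Q a) p" for a f
      using in_bundle[OF p] that unfolding chart_mem_bundle_iff by blast
    from presented_rep.quotient_map[OF presented_matrix_rep, of "\<lambda>x. G x p", OF G_subspace G_subset this a f]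
    show ?thesis
      using W_eq[OF tail_in_verts[OF a], of p] W_eq[OF head_in_verts[OF a], of p]
      by (simp add: matrix_rep_def W_eq_restrict[symmetric])
  qed
qed

lemma dpred_rank_inequality:
  assumes Q: "quiver Q" and in_bundle: "\<And>p. p \<in> X \<Longrightarrow> chart Q \<alpha> J p \<in> subrep_bundle Q \<alpha> \<beta>"
    and P: "P \<in> rank_inequalities Q \<alpha>"
  shows "dpred (\<lambda>p. P (chart Q \<alpha> J p))"
proof -
  have "dfin (\<lambda>p. r (chart Q \<alpha> J p))" if "r \<in> bundle_rank_functions Q \<alpha>"
    for r :: "('v \<Rightarrow> 'k vec set) \<times> ('e \<Rightarrow> 'k mat) \<Rightarrow> nat"
    using that dfin_rank_function[OF Q _ definable_sub_rep[OF in_bundle]]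
      dfin_rank_function[OF Q _ definable_quotient_rep[OF in_bundle]]
    by (auto simp: bundle_rank_functions_def case_prod_beta)
  then have sum: "dpred (\<lambda>p. T (\<Sum>(c, r)\<leftarrow>ts. c * real (r (chart Q \<alpha> J p))))"
    if "snd ` set ts \<subseteq> bundle_rank_functions Q \<alpha>" for ts and T :: "real \<Rightarrow> bool"
    using that by (intro dpred_dfin_sum) force
  from P consider
    (le) ts d where "P = (\<lambda>p. (\<Sum>(c, r)\<leftarrow>ts. c * real (r p)) \<le> d)" "snd ` set ts \<subseteq> bundle_rank_functions Q \<alpha>"
    | (less) ts d where "P = (\<lambda>p. (\<Sum>(c, r)\<leftarrow>ts. c * real (r p)) < d)" "snd ` set ts \<subseteq> bundle_rank_functions Q \<alpha>"
    unfolding rank_inequalities_def by blast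
  then show ?thesis
  proof cases
    case le
    then show ?thesis
      using sum[of ts "\<lambda>y. y \<le> d"] by simp
  next
    case less
    then show ?thesis
      using sum[of ts "\<lambda>y. y < d"] by simp
  qed
qed

end

theorem theorem17:
  fixes Q :: "('v::infinite, 'e::infinite) pre_digraph"
    and \<alpha> \<beta> :: "'v \<Rightarrow> nat"
    and S :: "(('v \<Rightarrow> 'k::field vec set) \<times> ('e \<Rightarrow> 'k mat)) set"
  assumes "quiver Q"
    and "\<forall>x\<in>verts Q. \<beta> x \<le> \<alpha> x"
    and "rank_locus Q \<alpha> \<beta> S"
  shows "constructible (subrep_bundle_topology Q \<alpha> \<beta>) S"
proof -
  interpret fin_digraph Q
    using assms(1) by (simp add: quiver_def)
  obtain Ps where Ps: "set Ps \<subseteq> rank_inequalities Q \<alpha>"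
      "S = {z \<in> subrep_bundle Q \<alpha> \<beta>. \<forall>P\<in>set Ps. P z}"
    using assms(3) unfolding rank_locus_def by blast
  have "constructible (zariski_product Q \<alpha> \<beta>) S"
  proof (rule constructible_from_charts)
    show "finite (verts Q)"
      by simp
    show "S \<subseteq> grassmannian Q \<alpha> \<beta> \<times> rep_space Q \<alpha>"
      unfolding Ps(2) subrep_bundle_def by auto
    fix J
    assume J: "J \<in> chart_indices Q \<alpha> \<beta>"
    let ?A = "affine_space (chart_coords Q \<alpha> J) :: (('v, 'e) coordinate \<Rightarrow> 'k) set"
    let ?B = "{p \<in> ?A. chart Q \<alpha> J p \<in> subrep_bundle Q \<alpha> \<beta>}"
    interpret A: bundle_chart Q \<alpha> \<beta> J ?A
      by unfold_locales (simp_all add: J)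
    interpret B: bundle_chart Q \<alpha> \<beta> J ?B
      by unfold_locales (auto simp: J)
    obtain C1 where C1: "constructible (zariski_affine (chart_coords Q \<alpha> J)) C1" "?A \<inter> C1 = ?B"
      using A.dpred_bundle by (rule A.constructible_dpred)
    have "B.dpred (\<lambda>p. \<forall>P\<in>set Ps. P (chart Q \<alpha> J p))"
      using Ps(1) by (intro B.dpred_ball B.dpred_rank_inequality assms(1)) auto
    then obtain C2 where C2: "constructible (zariski_affine (chart_coords Q \<alpha> J)) C2"
        "?B \<inter> C2 = {p \<in> ?B. \<forall>P\<in>set Ps. P (chart Q \<alpha> J p)}"
      by (rule B.constructible_dpred)
    \<comment> \<open>A constructible set lies in the topspace \<open>?A\<close>, so
      \<open>C1\<close> equals \<open>?B\<close>, whereas \<open>C2\<close> is known only on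
      \<open>?B\<close>; the intersection removes the uncontrolled rest.\<close>
    have "{p \<in> ?A. chart Q \<alpha> J p \<in> S} = C1 \<inter> C2"
      using C1(2) C2(2) constructible_subset[OF C1(1)] unfolding Ps(2) topspace_zariski_affine by blast
    then show "constructible (zariski_affine (chart_coords Q \<alpha> J)) {p \<in> ?A. chart Q \<alpha> J p \<in> S}"
      using C1(1) C2(1) by (simp add: constructible.intros(4))
  qed
  then have "constructible (subrep_bundle_topology Q \<alpha> \<beta>) (S \<inter> subrep_bundle Q \<alpha> \<beta>)"
    unfolding subrep_bundle_topology_def by (rule constructible_subtopology)
  moreover have "S \<inter> subrep_bundle Q \<alpha> \<beta> = S"
    unfolding Ps(2) by blast
  ultimately show ?thesis
    by simp
qed

end
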